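(* Let $L$ be a multiplicative Hom-Lie algebra. Equipped with the comultiplication $\Delta_L\colon\overline{U}(L)\to\overline{U}(L)\otimes\overline{U}(L)$, i.e. the morphism of multiplicative Hom-associative algebras determined by $\Delta_L(x)=\alpha(x)\otimes1+1\otimes\alpha(x)$ for $x\in L$, the multiplicative Hom-associative algebra $\overline{U}(L)$ becomes a Hom-bialgebra.
   Context: $\mathbf{k}$ is a field of characteristic $0$; modules, linearity and $\otimes$ are over $\mathbf{k}$. A Hom-module is a pair $(V,\alpha)$ of a module and a linear map $\alpha\colon V\to V$. A Hom-nonassociative algebra is $(A,\mu,\alpha,\eta)$ with $(A,\alpha)$ a Hom-module, $\mu\colon A\otimes A\to A$ linear (written $xy$), and $\eta\colon\mathbf{k}\to A$ linear with $\eta(1)=1$ a two-sided unit; morphisms are linear maps preserving $\mu,\alpha,\eta$. Non-unital versions drop $\eta$. It is a multiplicative Hom-associative algebra if $(xy)\alpha(z)=\alpha(x)(yz)$ and $\alpha(xy)=\alpha(x)\alpha(y)$. Tensor products have $(x\otimes x')(y\otimes y')=xy\otimes x'y'$, twisting map $\alpha\otimes\alpha'$, unit $1\otimes1$. A multiplicative Hom-Lie algebra is a non-unital Hom-nonassociative algebra $(L,[-,-],\alpha)$ with $[x,y]=-[y,x]$, $[\alpha(x),[y,z]]+[\alpha(z),[x,y]]+[\alpha(y),[z,x]]=0$, and $\alpha([x,y])=[\alpha(x),\alpha(y)]$ for all $x,y,z\in L$. For a Hom-module $W$, $F_1(W)=\mathbf{k}\oplus F_{HNAs}(W)$, where $F_{HNAs}(W)$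 is the free non-unital Hom-nonassociative algebra on the Hom-module $W$ (left adjoint of the functor forgetting the multiplication); it has multiplication $\mu_F$ given by $(s,u)(t,v)=(st,sv+tu+uv)$, map $\alpha_F$ equal to the given one on $F_{HNAs}(W)$ and the identity on $\mathbf{k}$, and unit the inclusion of $\mathbf{k}$; $W$ is naturally included in $F_1(W)$. For a multiplicative Hom-Lie algebra $L$, regarded as a Hom-module $(L,\alpha)$, set $\overline{U}(L)=F_1(L)/\overline{I}^\infty$ with the structure maps induced by $\mu_F,\alpha_F$ and the unit. Here $\langle S\rangle$ is the smallest two-sided ideal (submodule closed under left and right multiplication by $F_1(L)$) containing $S$; $\overline{I}^1$ is the ideal generated by the images of $\mu_F\circ(\mu_F\otimes\alpha_F-\alpha_F\otimes\mu_F)$ and $\alpha_F\circ\mu_F-\mu_F\circ\alpha_F^{\otimes2}$ together with all $[x,y]-(xy-yx)$ for $x,y\in L$; $\overline{I}^{n+1}=\langle\overline{I}^n\cup\alpha_F(\overline{I}^n)\rangle$; $\overline{I}^\infty=\bigcup_{n\ge1}\overline{I}^n$. An element $x\in L$ also denotes its image in $\overline{U}(L)$. A Hom-bialgebra is a quadruple $(B,\mu,\Delta,\alpha)$ in which $(B,\mu,\alpha)$ is a (non-unital) multiplicative Hom-associative algebra and $\Delta\colon B\to B\otimes B$ is a morphism of Hom-associative algebras with $(\Delta\otimes\alpha)\circ\Delta=(\alpha\otimes\Delta)\circ\Delta$. *)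

theory Defs
  imports "HOL-Algebra.Module" "HOL-Algebra.QuotRing"
begin

text \<open>
  The library record \<open>module\<close> already has the fields \<open>mult\<close> and \<open>one\<close>, so one extension by the
  twisting map serves Hom-modules (which ignore \<open>mult\<close> and \<open>one\<close>), non-unital Hom-algebras (which
  ignore \<open>one\<close>), Hom-Lie algebras (where \<open>mult\<close> is the bracket) and unital Hom-algebras (where
  the unit map is \<open>c \<mapsto> c \<odot> \<one>\<close>).  Multiplications are given as bilinear operations.
\<close>

record ('a, 'b) hom_module = "('a, 'b) module" +
  twist :: "'b \<Rightarrow> 'b" (\<open>\<alpha>\<index>\<close>)

definition linear_map ::
  "('a, 'm) ring_scheme \<Rightarrow> ('a, 'b, 'n) module_scheme \<Rightarrow> ('a, 'c, 'p) module_scheme \<Rightarrow> ('b \<Rightarrow> 'c) \<Rightarrow> bool"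
  where "linear_map K V W f \<longleftrightarrow>
    f \<in> carrier V \<rightarrow> carrier W \<and>
    (\<forall>x\<in>carrier V. \<forall>y\<in>carrier V. f (x \<oplus>\<^bsub>V\<^esub> y) = f x \<oplus>\<^bsub>W\<^esub> f y) \<and>
    (\<forall>c\<in>carrier K. \<forall>x\<in>carrier V. f (c \<odot>\<^bsub>V\<^esub> x) = c \<odot>\<^bsub>W\<^esub> f x)"

locale hom_module = module K V for K (structure) and V :: "('a, 'b, 'n) hom_module_scheme" (structure) +
  assumes twist_linear: "linear_map K V V \<alpha>\<^bsub>V\<^esub>"

locale hom_nonassoc_alg = hom_module K A
  for K (structure) and A :: "('a, 'b, 'n) hom_module_scheme" (structure) +
  assumes mult_closed:
      "\<lbrakk>x \<in> carrier A; y \<in> carrier A\<rbrakk> \<Longrightarrow> x \<otimes>\<^bsub>A\<^esub> y \<in> carrier A"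
    and mult_add_left:
      "\<lbrakk>x \<in> carrier A; y \<in> carrier A; z \<in> carrier A\<rbrakk>
        \<Longrightarrow> (x \<oplus>\<^bsub>A\<^esub> y) \<otimes>\<^bsub>A\<^esub> z = x \<otimes>\<^bsub>A\<^esub> z \<oplus>\<^bsub>A\<^esub> y \<otimes>\<^bsub>A\<^esub> z"
    and mult_add_right:
      "\<lbrakk>x \<in> carrier A; y \<in> carrier A; z \<in> carrier A\<rbrakk>
        \<Longrightarrow> x \<otimes>\<^bsub>A\<^esub> (y \<oplus>\<^bsub>A\<^esub> z) = x \<otimes>\<^bsub>A\<^esub> y \<oplus>\<^bsub>A\<^esub> x \<otimes>\<^bsub>A\<^esub> z"
    and mult_smult_left:
      "\<lbrakk>c \<in> carrier K; x \<in> carrier A; y \<in> carrier A\<rbrakk>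
        \<Longrightarrow> (c \<odot>\<^bsub>A\<^esub> x) \<otimes>\<^bsub>A\<^esub> y = c \<odot>\<^bsub>A\<^esub> (x \<otimes>\<^bsub>A\<^esub> y)"
    and mult_smult_right:
      "\<lbrakk>c \<in> carrier K; x \<in> carrier A; y \<in> carrier A\<rbrakk>
        \<Longrightarrow> x \<otimes>\<^bsub>A\<^esub> (c \<odot>\<^bsub>A\<^esub> y) = c \<odot>\<^bsub>A\<^esub> (x \<otimes>\<^bsub>A\<^esub> y)"

locale unital_hom_nonassoc_alg = hom_nonassoc_alg K A
  for K (structure) and A :: "('a, 'b, 'n) hom_module_scheme" (structure) +
  assumes unit_closed: "\<one>\<^bsub>A\<^esub> \<in> carrier A"
    and unit_left: "x \<in> carrier A \<Longrightarrow> \<one>\<^bsub>A\<^esub> \<otimes>\<^bsub>A\<^esub> x = x"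
    and unit_right: "x \<in> carrier A \<Longrightarrow> x \<otimes>\<^bsub>A\<^esub> \<one>\<^bsub>A\<^esub> = x"

locale mult_hom_assoc_alg = hom_nonassoc_alg K A
  for K (structure) and A :: "('a, 'b, 'n) hom_module_scheme" (structure) +
  assumes hom_assoc:
      "\<lbrakk>x \<in> carrier A; y \<in> carrier A; z \<in> carrier A\<rbrakk>
        \<Longrightarrow> (x \<otimes>\<^bsub>A\<^esub> y) \<otimes>\<^bsub>A\<^esub> \<alpha>\<^bsub>A\<^esub> z = \<alpha>\<^bsub>A\<^esub> x \<otimes>\<^bsub>A\<^esub> (y \<otimes>\<^bsub>A\<^esub> z)"
    and multiplicative:
      "\<lbrakk>x \<in> carrier A; y \<in> carrier A\<rbrakk> \<Longrightarrow> \<alpha>\<^bsub>A\<^esub> (x \<otimes>\<^bsub>A\<^esub> y) = \<alpha>\<^bsub>A\<^esub> x \<otimes>\<^bsub>A\<^esub> \<alpha>\<^bsub>A\<^esub> y"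

locale unital_mult_hom_assoc_alg = unital_hom_nonassoc_alg K A + mult_hom_assoc_alg K A
  for K (structure) and A :: "('a, 'b, 'n) hom_module_scheme" (structure)

locale mult_hom_lie_alg = hom_nonassoc_alg K L
  for K (structure) and L :: "('a, 'b, 'n) hom_module_scheme" (structure) +
  assumes skew_symmetric:
      "\<lbrakk>x \<in> carrier L; y \<in> carrier L\<rbrakk> \<Longrightarrow> x \<otimes>\<^bsub>L\<^esub> y = \<ominus>\<^bsub>L\<^esub> (y \<otimes>\<^bsub>L\<^esub> x)"
    and hom_jacobi:
      "\<lbrakk>x \<in> carrier L; y \<in> carrier L; z \<in> carrier L\<rbrakk>
        \<Longrightarrow> \<alpha>\<^bsub>L\<^esub> x \<otimes>\<^bsub>L\<^esub> (y \<otimes>\<^bsub>L\<^esub> z) \<oplus>\<^bsub>L\<^esub> \<alpha>\<^bsub>L\<^esub> z \<otimes>\<^bsub>L\<^esub> (x \<otimes>\<^bsub>L\<^esub> y) \<oplus>\<^bsub>L\<^esub> \<alpha>\<^bsub>L\<^esub> y \<otimes>\<^bsub>L\<^esub> (z \<otimes>\<^bsub>L\<^esub> x) = \<zero>\<^bsub>L\<^esub>"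
    and multiplicative:
      "\<lbrakk>x \<in> carrier L; y \<in> carrier L\<rbrakk> \<Longrightarrow> \<alpha>\<^bsub>L\<^esub> (x \<otimes>\<^bsub>L\<^esub> y) = \<alpha>\<^bsub>L\<^esub> x \<otimes>\<^bsub>L\<^esub> \<alpha>\<^bsub>L\<^esub> y"

definition hom_alg_morphism ::
  "('a, 'm) ring_scheme \<Rightarrow> ('a, 'b, 'n) hom_module_scheme \<Rightarrow> ('a, 'c, 'p) hom_module_scheme \<Rightarrow> ('b \<Rightarrow> 'c) \<Rightarrow> bool"
  where "hom_alg_morphism K A B f \<longleftrightarrow>
    linear_map K A B f \<and>
    (\<forall>x\<in>carrier A. \<forall>y\<in>carrier A. f (x \<otimes>\<^bsub>A\<^esub> y) = f x \<otimes>\<^bsub>B\<^esub> f y) \<and>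
    (\<forall>x\<in>carrier A. f (\<alpha>\<^bsub>A\<^esub> x) = \<alpha>\<^bsub>B\<^esub> (f x))"

definition unital_hom_alg_morphism ::
  "('a, 'm) ring_scheme \<Rightarrow> ('a, 'b, 'n) hom_module_scheme \<Rightarrow> ('a, 'c, 'p) hom_module_scheme \<Rightarrow> ('b \<Rightarrow> 'c) \<Rightarrow> bool"
  where "unital_hom_alg_morphism K A B f \<longleftrightarrow> hom_alg_morphism K A B f \<and> f \<one>\<^bsub>A\<^esub> = \<one>\<^bsub>B\<^esub>"


section \<open>Free modules, quotients, ideals\<close>

definition free_module :: "('a, 'm) ring_scheme \<Rightarrow> 's set \<Rightarrow> ('a, 's \<Rightarrow> 'a) module"
  where "free_module K S =
    \<lparr>carrier = {\<phi>. (\<forall>s. \<phi> s \<in> carrier K) \<and> (\<forall>s. s \<notin> S \<longrightarrow> \<phi> s = \<zero>\<^bsub>K\<^esub>) \<and> finite {s. \<phi> s \<noteq> \<zero>\<^bsub>K\<^esub>}},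
     mult = undefined, one = undefined,
     zero = (\<lambda>s. \<zero>\<^bsub>K\<^esub>), add = (\<lambda>\<phi> \<psi> s. \<phi> s \<oplus>\<^bsub>K\<^esub> \<psi> s), smult = (\<lambda>c \<phi> s. c \<otimes>\<^bsub>K\<^esub> \<phi> s)\<rparr>"

definition basis_vec :: "('a, 'm) ring_scheme \<Rightarrow> 's \<Rightarrow> 's \<Rightarrow> 'a"
  where "basis_vec K s = (\<lambda>t. if t = s then \<one>\<^bsub>K\<^esub> else \<zero>\<^bsub>K\<^esub>)"

definition lin_ext ::
  "('a, 'm) ring_scheme \<Rightarrow> ('a, 'b, 'n) module_scheme \<Rightarrow> ('s \<Rightarrow> 'b) \<Rightarrow> ('s \<Rightarrow> 'a) \<Rightarrow> 'b"
  where "lin_ext K M b \<phi> = (\<Oplus>\<^bsub>M\<^esub>s\<in>{s. \<phi> s \<noteq> \<zero>\<^bsub>K\<^esub>}. \<phi> s \<odot>\<^bsub>M\<^esub> b s)"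

definition submodule_generated ::
  "('a, 'm) ring_scheme \<Rightarrow> ('a, 'b, 'n) module_scheme \<Rightarrow> 'b set \<Rightarrow> 'b set"
  where "submodule_generated K M S = \<Inter>{N. submodule N K M \<and> S \<subseteq> N}"

definition two_sided_ideal ::
  "('a, 'm) ring_scheme \<Rightarrow> ('a, 'b, 'n) module_scheme \<Rightarrow> 'b set \<Rightarrow> bool"
  where "two_sided_ideal K A I \<longleftrightarrow> submodule I K A \<and>
    (\<forall>a\<in>carrier A. \<forall>x\<in>I. a \<otimes>\<^bsub>A\<^esub> x \<in> I \<and> x \<otimes>\<^bsub>A\<^esub> a \<in> I)"

definition ideal_generated ::
  "('a, 'm) ring_scheme \<Rightarrow> ('a, 'b, 'n) module_scheme \<Rightarrow> 'b set \<Rightarrow> 'b set"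
  where "ideal_generated K A S = \<Inter>{I. two_sided_ideal K A I \<and> S \<subseteq> I}"

definition module_quotient :: "('a, 'b, 'n) module_scheme \<Rightarrow> 'b set \<Rightarrow> ('a, 'b set) module"
  where "module_quotient M N =
    \<lparr>carrier = a_rcosets\<^bsub>M\<^esub> N, mult = undefined, one = undefined, zero = N, add = set_add M,
     smult = (\<lambda>c X. \<Union>x\<in>X. N +>\<^bsub>M\<^esub> (c \<odot>\<^bsub>M\<^esub> x))\<rparr>"

text \<open>Quotient by a two-sided ideal \<open>I\<close> with \<open>\<alpha>(I) \<subseteq> I\<close>; cf. \<^const>\<open>FactRing\<close>.\<close>

definition hom_quotient :: "('a, 'b, 'n) hom_module_scheme \<Rightarrow> 'b set \<Rightarrow> ('a, 'b set) hom_module"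
  where "hom_quotient A I =
    \<lparr>carrier = a_rcosets\<^bsub>A\<^esub> I, mult = rcoset_mult A I, one = I +>\<^bsub>A\<^esub> \<one>\<^bsub>A\<^esub>, zero = I, add = set_add A,
     smult = (\<lambda>c X. \<Union>x\<in>X. I +>\<^bsub>A\<^esub> (c \<odot>\<^bsub>A\<^esub> x)),
     twist = (\<lambda>X. \<Union>x\<in>X. I +>\<^bsub>A\<^esub> \<alpha>\<^bsub>A\<^esub> x)\<rparr>"


section \<open>Tensor products\<close>

definition pair_module ::
  "('a, 'm) ring_scheme \<Rightarrow> ('a, 'b, 'n) module_scheme \<Rightarrow> ('a, 'c, 'p) module_scheme \<Rightarrow> ('a, 'b \<times> 'c \<Rightarrow> 'a) module"
  where "pair_module K V W = free_module K (carrier V \<times> carrier W)"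

definition tensor_relations ::
  "('a, 'm) ring_scheme \<Rightarrow> ('a, 'b, 'n) module_scheme \<Rightarrow> ('a, 'c, 'p) module_scheme \<Rightarrow> ('b \<times> 'c \<Rightarrow> 'a) set"
  where "tensor_relations K V W = (let P = pair_module K V W; e = (\<lambda>v w. basis_vec K (v, w)) in
    submodule_generated K P
      ({e (v \<oplus>\<^bsub>V\<^esub> v') w \<ominus>\<^bsub>P\<^esub> (e v w \<oplus>\<^bsub>P\<^esub> e v' w) | v v' w. v \<in> carrier V \<and> v' \<in> carrier V \<and> w \<in> carrier W} \<union>
       {e v (w \<oplus>\<^bsub>W\<^esub> w') \<ominus>\<^bsub>P\<^esub> (e v w \<oplus>\<^bsub>P\<^esub> e v w') | v w w'. v \<in> carrier V \<and> w \<in> carrier W \<and> w' \<in> carrier W} \<union>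
       {e (c \<odot>\<^bsub>V\<^esub> v) w \<ominus>\<^bsub>P\<^esub> c \<odot>\<^bsub>P\<^esub> e v w | c v w. c \<in> carrier K \<and> v \<in> carrier V \<and> w \<in> carrier W} \<union>
       {e v (c \<odot>\<^bsub>W\<^esub> w) \<ominus>\<^bsub>P\<^esub> c \<odot>\<^bsub>P\<^esub> e v w | c v w. c \<in> carrier K \<and> v \<in> carrier V \<and> w \<in> carrier W}))"

definition tensor_module ::
  "('a, 'm) ring_scheme \<Rightarrow> ('a, 'b, 'n) module_scheme \<Rightarrow> ('a, 'c, 'p) module_scheme \<Rightarrow> ('a, ('b \<times> 'c \<Rightarrow> 'a) set) module"
  where "tensor_module K V W = module_quotient (pair_module K V W) (tensor_relations K V W)"

definition pure_tensor ::
  "('a, 'm) ring_scheme \<Rightarrow> ('a, 'b, 'n) module_scheme \<Rightarrow> ('a, 'c, 'p) module_scheme \<Rightarrow> 'b \<Rightarrow> 'c \<Rightarrow> ('b \<times> 'c \<Rightarrow> 'a) set"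
  where "pure_tensor K V W v w = tensor_relations K V W +>\<^bsub>pair_module K V W\<^esub> basis_vec K (v, w)"

text \<open>
  The linear map out of a tensor product induced by a bilinear map \<open>b\<close> into \<open>T\<close>: the linear
  extension of \<open>b\<close> to formal combinations of pairs is constant on each coset \<open>X\<close>.
\<close>

definition tensor_lift ::
  "('a, 'm) ring_scheme \<Rightarrow> ('a, 'd, 'q) module_scheme \<Rightarrow> ('b \<Rightarrow> 'c \<Rightarrow> 'd) \<Rightarrow> ('b \<times> 'c \<Rightarrow> 'a) set \<Rightarrow> 'd"
  where "tensor_lift K T b X = the_elem (lin_ext K T (\<lambda>(v, w). b v w) ` X)"

text \<open>\<open>tensor_map K V W f g\<close> is \<open>f \<otimes> g\<close>, where \<open>V\<close> and \<open>W\<close> are the codomains of \<open>f\<close> and \<open>g\<close>.\<close>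

definition tensor_map ::
  "('a, 'm) ring_scheme \<Rightarrow> ('a, 'd, 'n) module_scheme \<Rightarrow> ('a, 'e, 'p) module_scheme
    \<Rightarrow> ('b \<Rightarrow> 'd) \<Rightarrow> ('c \<Rightarrow> 'e) \<Rightarrow> ('b \<times> 'c \<Rightarrow> 'a) set \<Rightarrow> ('d \<times> 'e \<Rightarrow> 'a) set"
  where "tensor_map K V W f g =
    tensor_lift K (tensor_module K V W) (\<lambda>v w. pure_tensor K V W (f v) (g w))"

text \<open>The canonical identification of \<open>(U \<otimes> V) \<otimes> W\<close> with \<open>U \<otimes> (V \<otimes> W)\<close>.\<close>

definition tensor_assoc ::
  "('a, 'm) ring_scheme \<Rightarrow> ('a, 'b, 'n) module_scheme \<Rightarrow> ('a, 'c, 'p) module_scheme \<Rightarrow> ('a, 'd, 'q) module_scheme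
    \<Rightarrow> (('b \<times> 'c \<Rightarrow> 'a) set \<times> 'd \<Rightarrow> 'a) set \<Rightarrow> ('b \<times> ('c \<times> 'd \<Rightarrow> 'a) set \<Rightarrow> 'a) set"
  where "tensor_assoc K U V W =
    (let T = tensor_module K U (tensor_module K V W) in
     tensor_lift K T (\<lambda>X w.
       tensor_lift K T (\<lambda>u v. pure_tensor K U (tensor_module K V W) u (pure_tensor K V W v w)) X))"

text \<open>If \<open>A\<close> and \<open>B\<close> are non-unital, the field \<open>one\<close> of \<open>A \<otimes> B\<close> carries no meaning.\<close>

definition tensor_alg ::
  "('a, 'm) ring_scheme \<Rightarrow> ('a, 'b, 'n) hom_module_scheme \<Rightarrow> ('a, 'c, 'p) hom_module_scheme
    \<Rightarrow> ('a, ('b \<times> 'c \<Rightarrow> 'a) set) hom_module"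
  where "tensor_alg K A B = (let T = tensor_module K A B in
    \<lparr>carrier = carrier T,
     mult = (\<lambda>X Y. tensor_lift K T (\<lambda>x x'.
               tensor_lift K T (\<lambda>y y'. pure_tensor K A B (x \<otimes>\<^bsub>A\<^esub> y) (x' \<otimes>\<^bsub>B\<^esub> y')) Y) X),
     one = pure_tensor K A B \<one>\<^bsub>A\<^esub> \<one>\<^bsub>B\<^esub>,
     zero = \<zero>\<^bsub>T\<^esub>, add = add T, smult = smult T,
     twist = tensor_map K A B \<alpha>\<^bsub>A\<^esub> \<alpha>\<^bsub>B\<^esub>\<rparr>)"


section \<open>Hom-bialgebras\<close>

locale hom_bialgebra = mult_hom_assoc_alg K B
  for K (structure) and B :: "('a, 'b, 'n) hom_module_scheme" (structure) and \<Delta> +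
  assumes comult_morphism: "hom_alg_morphism K B (tensor_alg K B B) \<Delta>"
    and hom_coassoc:
      "x \<in> carrier B \<Longrightarrow>
        tensor_assoc K B B B (tensor_map K (tensor_alg K B B) B \<Delta> \<alpha>\<^bsub>B\<^esub> (\<Delta> x)) =
        tensor_map K B (tensor_alg K B B) \<alpha>\<^bsub>B\<^esub> \<Delta> (\<Delta> x)"


section \<open>The free Hom-nonassociative algebra on a Hom-module\<close>

text \<open>
  The free algebra on \<open>W\<close> is presented as formal linear combinations of terms built from
  generators \<open>w \<in> W\<close>, products and applications of the twisting map, modulo the least two-sided,
  twist-stable ideal that makes \<open>Gen\<close> linear and compatible with the twisting map of \<open>W\<close>.
\<close>

datatype (gens: 'w) hna_term = Gen 'w | Prod "'w hna_term" "'w hna_term" | Twist "'w hna_term"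

definition term_alg ::
  "('a, 'm) ring_scheme \<Rightarrow> ('a, 'b, 'n) hom_module_scheme \<Rightarrow> ('a, 'b hna_term \<Rightarrow> 'a) hom_module"
  where "term_alg K W = (let M = free_module K {t. gens t \<subseteq> carrier W} in
    \<lparr>carrier = carrier M,
     mult = (\<lambda>\<phi> \<psi> t. case t of Prod u v \<Rightarrow> \<phi> u \<otimes>\<^bsub>K\<^esub> \<psi> v | _ \<Rightarrow> \<zero>\<^bsub>K\<^esub>),
     one = undefined,
     zero = \<zero>\<^bsub>M\<^esub>, add = add M, smult = smult M,
     twist = (\<lambda>\<phi> t. case t of Twist u \<Rightarrow> \<phi> u | _ \<Rightarrow> \<zero>\<^bsub>K\<^esub>)\<rparr>)"

definition term_relations ::
  "('a, 'm) ring_scheme \<Rightarrow> ('a, 'b, 'n) hom_module_scheme \<Rightarrow> ('b hna_term \<Rightarrow> 'a) set"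
  where "term_relations K W = (let T = term_alg K W; g = (\<lambda>w. basis_vec K (Gen w)) in
    \<Inter>{I. two_sided_ideal K T I \<and> \<alpha>\<^bsub>T\<^esub> ` I \<subseteq> I \<and>
        {g (v \<oplus>\<^bsub>W\<^esub> w) \<ominus>\<^bsub>T\<^esub> (g v \<oplus>\<^bsub>T\<^esub> g w) | v w. v \<in> carrier W \<and> w \<in> carrier W} \<subseteq> I \<and>
        {g (c \<odot>\<^bsub>W\<^esub> w) \<ominus>\<^bsub>T\<^esub> c \<odot>\<^bsub>T\<^esub> g w | c w. c \<in> carrier K \<and> w \<in> carrier W} \<subseteq> I \<and>
        {g (\<alpha>\<^bsub>W\<^esub> w) \<ominus>\<^bsub>T\<^esub> \<alpha>\<^bsub>T\<^esub> (g w) | w. w \<in> carrier W} \<subseteq> I})"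

definition free_hna ::
  "('a, 'm) ring_scheme \<Rightarrow> ('a, 'b, 'n) hom_module_scheme \<Rightarrow> ('a, ('b hna_term \<Rightarrow> 'a) set) hom_module"
  where "free_hna K W = hom_quotient (term_alg K W) (term_relations K W)"

definition free_hna_gen ::
  "('a, 'm) ring_scheme \<Rightarrow> ('a, 'b, 'n) hom_module_scheme \<Rightarrow> 'b \<Rightarrow> ('b hna_term \<Rightarrow> 'a) set"
  where "free_hna_gen K W w = term_relations K W +>\<^bsub>term_alg K W\<^esub> basis_vec K (Gen w)"

definition unitization ::
  "('a, 'm) ring_scheme \<Rightarrow> ('a, 'b, 'n) hom_module_scheme \<Rightarrow> ('a, 'a \<times> 'b) hom_module"
  where "unitization K A =
    \<lparr>carrier = carrier K \<times> carrier A,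
     mult = (\<lambda>(s, u) (t, v). (s \<otimes>\<^bsub>K\<^esub> t, s \<odot>\<^bsub>A\<^esub> v \<oplus>\<^bsub>A\<^esub> t \<odot>\<^bsub>A\<^esub> u \<oplus>\<^bsub>A\<^esub> u \<otimes>\<^bsub>A\<^esub> v)),
     one = (\<one>\<^bsub>K\<^esub>, \<zero>\<^bsub>A\<^esub>),
     zero = (\<zero>\<^bsub>K\<^esub>, \<zero>\<^bsub>A\<^esub>),
     add = (\<lambda>(s, u) (t, v). (s \<oplus>\<^bsub>K\<^esub> t, u \<oplus>\<^bsub>A\<^esub> v)),
     smult = (\<lambda>c (s, u). (c \<otimes>\<^bsub>K\<^esub> s, c \<odot>\<^bsub>A\<^esub> u)),
     twist = (\<lambda>(s, u). (s, \<alpha>\<^bsub>A\<^esub> u))\<rparr>"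

text \<open>The unital free algebra \<open>F\<^sub>1(W)\<close> and the inclusion of \<open>W\<close>.\<close>

definition free_unital_hna ::
  "('a, 'm) ring_scheme \<Rightarrow> ('a, 'b, 'n) hom_module_scheme \<Rightarrow> ('a, 'a \<times> ('b hna_term \<Rightarrow> 'a) set) hom_module"
  where "free_unital_hna K W = unitization K (free_hna K W)"

definition free_unital_hna_gen ::
  "('a, 'm) ring_scheme \<Rightarrow> ('a, 'b, 'n) hom_module_scheme \<Rightarrow> 'b \<Rightarrow> 'a \<times> ('b hna_term \<Rightarrow> 'a) set"
  where "free_unital_hna_gen K W w = (\<zero>\<^bsub>K\<^esub>, free_hna_gen K W w)"


section \<open>The enveloping algebra of a multiplicative Hom-Lie algebra\<close>

text \<open>
  The images of \<open>\<mu>(\<mu> \<otimes> \<alpha> - \<alpha> \<otimes> \<mu>)\<close> and \<open>\<alpha>\<mu> - \<mu>(\<alpha> \<otimes> \<alpha>)\<close> are the spans of the values at pure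
  tensors, so these values generate the same ideal.
\<close>

definition envelope_relations ::
  "('a, 'm) ring_scheme \<Rightarrow> ('a, 'b, 'n) hom_module_scheme \<Rightarrow> ('a \<times> ('b hna_term \<Rightarrow> 'a) set) set"
  where "envelope_relations K L = (let F = free_unital_hna K L; j = free_unital_hna_gen K L in
    {(x \<otimes>\<^bsub>F\<^esub> y) \<otimes>\<^bsub>F\<^esub> \<alpha>\<^bsub>F\<^esub> z \<ominus>\<^bsub>F\<^esub> \<alpha>\<^bsub>F\<^esub> x \<otimes>\<^bsub>F\<^esub> (y \<otimes>\<^bsub>F\<^esub> z) | x y z.
        x \<in> carrier F \<and> y \<in> carrier F \<and> z \<in> carrier F} \<union>
    {\<alpha>\<^bsub>F\<^esub> (x \<otimes>\<^bsub>F\<^esub> y) \<ominus>\<^bsub>F\<^esub> \<alpha>\<^bsub>F\<^esub> x \<otimes>\<^bsub>F\<^esub> \<alpha>\<^bsub>F\<^esub> y | x y. x \<in> carrier F \<and> y \<in> carrier F} \<union>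
    {j (x \<otimes>\<^bsub>L\<^esub> y) \<ominus>\<^bsub>F\<^esub> (j x \<otimes>\<^bsub>F\<^esub> j y \<ominus>\<^bsub>F\<^esub> j y \<otimes>\<^bsub>F\<^esub> j x) | x y. x \<in> carrier L \<and> y \<in> carrier L})"

text \<open>Indexed from 0: \<open>envelope_ideal_seq K L n\<close> is the \<open>(n+1)\<close>-st ideal.\<close>

primrec envelope_ideal_seq ::
  "('a, 'm) ring_scheme \<Rightarrow> ('a, 'b, 'n) hom_module_scheme \<Rightarrow> nat \<Rightarrow> ('a \<times> ('b hna_term \<Rightarrow> 'a) set) set"
  where
    "envelope_ideal_seq K L 0 = ideal_generated K (free_unital_hna K L) (envelope_relations K L)"
  | "envelope_ideal_seq K L (Suc n) =
      ideal_generated K (free_unital_hna K L)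
        (envelope_ideal_seq K L n \<union> \<alpha>\<^bsub>free_unital_hna K L\<^esub> ` envelope_ideal_seq K L n)"

definition envelope_ideal ::
  "('a, 'm) ring_scheme \<Rightarrow> ('a, 'b, 'n) hom_module_scheme \<Rightarrow> ('a \<times> ('b hna_term \<Rightarrow> 'a) set) set"
  where "envelope_ideal K L = (\<Union>n. envelope_ideal_seq K L n)"

definition envelope ::
  "('a, 'm) ring_scheme \<Rightarrow> ('a, 'b, 'n) hom_module_scheme
    \<Rightarrow> ('a, ('a \<times> ('b hna_term \<Rightarrow> 'a) set) set) hom_module"
  where "envelope K L = hom_quotient (free_unital_hna K L) (envelope_ideal K L)"

definition envelope_gen ::
  "('a, 'm) ring_scheme \<Rightarrow> ('a, 'b, 'n) hom_module_scheme \<Rightarrow> 'b \<Rightarrow> ('a \<times> ('b hna_term \<Rightarrow> 'a) set) set"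
  where "envelope_gen K L x = envelope_ideal K L +>\<^bsub>free_unital_hna K L\<^esub> free_unital_hna_gen K L x"

definition is_envelope_comult ::
  "('a, 'm) ring_scheme \<Rightarrow> ('a, 'b, 'n) hom_module_scheme
    \<Rightarrow> (('a \<times> ('b hna_term \<Rightarrow> 'a) set) set
        \<Rightarrow> (('a \<times> ('b hna_term \<Rightarrow> 'a) set) set \<times> ('a \<times> ('b hna_term \<Rightarrow> 'a) set) set \<Rightarrow> 'a) set) \<Rightarrow> bool"
  where "is_envelope_comult K L \<Delta> \<longleftrightarrow>
    (let U = envelope K L; \<iota> = envelope_gen K L in
      unital_hom_alg_morphism K U (tensor_alg K U U) \<Delta> \<and>
      (\<forall>x\<in>carrier L. \<Delta> (\<iota> x) =
        pure_tensor K U U (\<iota> (\<alpha>\<^bsub>L\<^esub> x)) \<one>\<^bsub>U\<^esub> \<oplus>\<^bsub>tensor_alg K U U\<^esub> pure_tensor K U U \<one>\<^bsub>U\<^esub> (\<iota> (\<alpha>\<^bsub>L\<^esub> x))))"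

end

theory Submission
  imports Defs
begin

text \<open>
  The enveloping algebra \<open>U\<close> of \<open>L\<close> is generated, as a unital Hom-algebra, by the image of \<open>L\<close>, and
  it is universal: a linear map \<open>f\<close> from \<open>L\<close> to a unital multiplicative Hom-associative algebra \<open>B\<close>
  with \<open>\<alpha>(1) = 1\<close> extends to \<open>U\<close> as soon as it commutes with the twisting maps and satisfies
  \<open>f [x, y] = f x f y - f y f x\<close>.  This is \<open>envelope_lift\<close>; generation is used in the form of
  \<open>envelope_ext\<close>, by which two unital morphisms out of \<open>U\<close> that agree on \<open>L\<close> are equal.  Everything
  about the comultiplication follows from these two facts.

  For existence take \<open>B = U \<otimes> U\<close> and \<open>f x = \<alpha>(x) \<otimes> 1 + 1 \<otimes> \<alpha>(x)\<close>.  In the commutator of \<open>f x\<close> and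
  \<open>f y\<close> the mixed terms \<open>\<alpha>(x) \<otimes> \<alpha>(y)\<close> and \<open>\<alpha>(y) \<otimes> \<alpha>(x)\<close> occur with both signs and cancel, so only the
  commutators in the two factors survive, and \<open>\<alpha> [x, y] = [\<alpha> x, \<alpha> y]\<close> identifies the result with
  \<open>f [x, y]\<close>.  Uniqueness is generation.  For coassociativity, \<open>\<alpha>\<close> is itself a unital endomorphism of
  \<open>U\<close> because \<open>U\<close> is multiplicative; hence \<open>(\<Delta> \<otimes> \<alpha>) \<Delta>\<close>, followed by the associator, and \<open>(\<alpha> \<otimes> \<Delta>) \<Delta>\<close>
  are unital morphisms from \<open>U\<close> to \<open>U \<otimes> (U \<otimes> U)\<close>, and on a generator \<open>x\<close> both take the value
  \<open>u \<otimes> 1 \<otimes> 1 + 1 \<otimes> u \<otimes> 1 + 1 \<otimes> 1 \<otimes> u\<close> with \<open>u = \<alpha>(\<alpha>(x))\<close>.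

  The larger part of the development supplies the two facts and the tensor calculus.  The algebra \<open>U\<close>
  is built in layers: linear combinations of formal terms, a quotient of these (the free
  Hom-nonassociative algebra), the adjunction of a unit, and a further quotient.  Each layer has a
  lifting lemma and an induction or surjectivity statement, and the layers compose.  A tensor product is a
  quotient of a free module; bilinear maps lift to it, and additive statements about its elements
  need only be checked on pure tensors, which gives the algebra identities of a tensor product of
  Hom-algebras and shows that \<open>f \<otimes> g\<close> and the associator are morphisms.
\<close>

section \<open>Linear maps, submodules and morphisms\<close>

lemma linear_map_closed: "linear_map K V W f \<Longrightarrow> x \<in> carrier V \<Longrightarrow> f x \<in> carrier W"
  by (auto simp: linear_map_def)

lemma linear_map_add:
  "linear_map K V W f \<Longrightarrow> x \<in> carrier V \<Longrightarrow> y \<in> carrier V \<Longrightarrow> f (x \<oplus>\<^bsub>V\<^esub> y) = f x \<oplus>\<^bsub>W\<^esub> f y"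
  by (auto simp: linear_map_def)

lemma linear_map_smult:
  "linear_map K V W f \<Longrightarrow> c \<in> carrier K \<Longrightarrow> x \<in> carrier V \<Longrightarrow> f (c \<odot>\<^bsub>V\<^esub> x) = c \<odot>\<^bsub>W\<^esub> f x"
  by (auto simp: linear_map_def)

lemma linear_map_comp:
  "linear_map K U V f \<Longrightarrow> linear_map K V W g \<Longrightarrow> linear_map K U W (\<lambda>x. g (f x))"
  by (auto simp: linear_map_def Pi_iff)

lemma (in abelian_group) minus_eq_zero_iff:
  assumes "x \<in> carrier G" "y \<in> carrier G"
  shows "x \<ominus> y = \<zero> \<longleftrightarrow> x = y"
proof
  assume "x \<ominus> y = \<zero>"
  then have "x = \<ominus> (\<ominus> y)"
    using assms minus_equality[of x "\<ominus> y"] by (simp add: a_minus_def)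
  then show "x = y"
    using assms by simp
qed (use assms in \<open>simp add: a_minus_def r_neg\<close>)

lemma (in module) minus_eq_smult:
  assumes "x \<in> carrier M" "y \<in> carrier M"
  shows "x \<ominus>\<^bsub>M\<^esub> y = x \<oplus>\<^bsub>M\<^esub> (\<ominus> \<one>) \<odot>\<^bsub>M\<^esub> y"
  using assms by (simp add: smult_l_minus a_minus_def)

lemma linear_map_zero:
  assumes "module K V" "module K W" "linear_map K V W f"
  shows "f \<zero>\<^bsub>V\<^esub> = \<zero>\<^bsub>W\<^esub>"
proof -
  interpret V: module K V by fact
  interpret W: module K W by fact
  have "f \<zero>\<^bsub>V\<^esub> = f (\<zero>\<^bsub>K\<^esub> \<odot>\<^bsub>V\<^esub> \<zero>\<^bsub>V\<^esub>)"
    by simp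
  also have "\<dots> = \<zero>\<^bsub>K\<^esub> \<odot>\<^bsub>W\<^esub> f \<zero>\<^bsub>V\<^esub>"
    by (rule linear_map_smult[OF assms(3)]) simp_all
  also have "\<dots> = \<zero>\<^bsub>W\<^esub>"
    by (simp add: linear_map_closed[OF assms(3)])
  finally show ?thesis .
qed

lemma linear_map_minus:
  assumes "module K V" "module K W" "linear_map K V W f" "x \<in> carrier V" "y \<in> carrier V"
  shows "f (x \<ominus>\<^bsub>V\<^esub> y) = f x \<ominus>\<^bsub>W\<^esub> f y"
proof -
  interpret V: module K V by fact
  interpret W: module K W by fact
  show ?thesis
    using assms(3-5) by (simp add: V.minus_eq_smult W.minus_eq_smult linear_map_add
        linear_map_smult linear_map_closed)
qed

lemma linear_map_cong:
  "(\<And>x. x \<in> carrier V \<Longrightarrow> f x = g x) \<Longrightarrow> module K V \<Longrightarrow> linear_map K V W g \<Longrightarrow> linear_map K V W f"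
  by (auto simp: linear_map_def module.smult_closed abelian_monoid.a_closed
      abelian_group.axioms(1)[OF module.axioms(2)])

lemma linear_map_plus:
  assumes "module K W" "linear_map K V W f" "linear_map K V W g"
  shows "linear_map K V W (\<lambda>x. f x \<oplus>\<^bsub>W\<^esub> g x)"
proof -
  interpret W: module K W by fact
  show ?thesis
    using assms(2,3) by (auto simp: linear_map_def Pi_iff W.smult_r_distr W.a_ac)
qed

text \<open>Closure under negation follows from closure under multiplication by \<open>-1\<close>.\<close>

lemma (in module) submoduleI_closed:
  assumes "H \<subseteq> carrier M" "\<zero>\<^bsub>M\<^esub> \<in> H" "\<And>x y. x \<in> H \<Longrightarrow> y \<in> H \<Longrightarrow> x \<oplus>\<^bsub>M\<^esub> y \<in> H"
    "\<And>c x. c \<in> carrier R \<Longrightarrow> x \<in> H \<Longrightarrow> c \<odot>\<^bsub>M\<^esub> x \<in> H"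
  shows "submodule H R M"
proof (rule submoduleI)
  fix x assume "x \<in> H"
  then have "\<ominus>\<^bsub>M\<^esub> x = (\<ominus> \<one>) \<odot>\<^bsub>M\<^esub> x"
    using assms(1) by (auto simp: smult_l_minus)
  then show "\<ominus>\<^bsub>M\<^esub> x \<in> H"
    using assms(4) \<open>x \<in> H\<close> by simp
qed (use assms in auto)

lemma (in module) submodule_zero: "submodule H R M \<Longrightarrow> \<zero>\<^bsub>M\<^esub> \<in> H"
  using subgroup.one_closed[OF submodule.axioms(1)] by fastforce

lemma submodule_kernel:
  assumes "module K V" "module K W" "linear_map K V W f"
  shows "submodule {x \<in> carrier V. f x = \<zero>\<^bsub>W\<^esub>} K V"
proof -
  interpret V: module K V by fact
  interpret W: module K W by fact
  show ?thesis
    using assms linear_map_zero[OF assms]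
    by (intro V.submoduleI_closed) (auto simp: linear_map_add linear_map_smult)
qed

lemma submodule_equalizer:
  assumes "module K V" "module K W" "linear_map K V W f" "linear_map K V W g"
  shows "submodule {x \<in> carrier V. f x = g x} K V"
proof -
  interpret V: module K V by fact
  interpret W: module K W by fact
  show ?thesis
    using assms linear_map_zero[of K V W f] linear_map_zero[of K V W g]
    by (intro V.submoduleI_closed) (auto simp: linear_map_add linear_map_smult)
qed

lemma submodule_Inter:
  assumes "module K M" "\<And>N. N \<in> \<N> \<Longrightarrow> submodule N K M" "\<N> \<noteq> {}"
  shows "submodule (\<Inter>\<N>) K M"
proof -
  interpret M: module K M by fact
  show ?thesis
  proof (rule M.submoduleI_closed)
    show "\<Inter>\<N> \<subseteq> carrier M"
      using assms(3) M.submoduleE(1)[OF assms(2)] by blast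
    show "\<zero>\<^bsub>M\<^esub> \<in> \<Inter>\<N>"
      using M.submodule_zero[OF assms(2)] by blast
    show "x \<oplus>\<^bsub>M\<^esub> y \<in> \<Inter>\<N>" if "x \<in> \<Inter>\<N>" "y \<in> \<Inter>\<N>" for x y
      using M.submoduleE(5)[OF assms(2)] that by blast
    show "c \<odot>\<^bsub>M\<^esub> x \<in> \<Inter>\<N>" if "c \<in> carrier K" "x \<in> \<Inter>\<N>" for c x
      using M.submoduleE(4)[OF assms(2)] that by blast
  qed
qed

lemma two_sided_ideal_Inter:
  assumes "module K A" "\<And>I. I \<in> \<I> \<Longrightarrow> two_sided_ideal K A I" "\<I> \<noteq> {}"
  shows "two_sided_ideal K A (\<Inter>\<I>)"
  using submodule_Inter[OF assms(1), of \<I>] assms(2,3) unfolding two_sided_ideal_def by blast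

lemma submodule_generated_submodule:
  assumes "module K M" "S \<subseteq> carrier M"
  shows "submodule (submodule_generated K M S) K M"
  unfolding submodule_generated_def
  using assms module.carrier_is_submodule by (intro submodule_Inter) blast+

lemma submodule_generated_incl: "S \<subseteq> submodule_generated K M S"
  by (auto simp: submodule_generated_def)

lemma submodule_generated_least:
  "submodule N K M \<Longrightarrow> S \<subseteq> N \<Longrightarrow> submodule_generated K M S \<subseteq> N"
  by (auto simp: submodule_generated_def)

lemma ideal_generated_incl: "S \<subseteq> ideal_generated K A S"
  by (auto simp: ideal_generated_def)

lemma ideal_generated_least:
  "two_sided_ideal K A I \<Longrightarrow> S \<subseteq> I \<Longrightarrow> ideal_generated K A S \<subseteq> I"
  by (auto simp: ideal_generated_def)

lemma (in hom_nonassoc_alg) carrier_two_sided_ideal: "two_sided_ideal K A (carrier A)"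
  by (auto simp: two_sided_ideal_def carrier_is_submodule mult_closed)

lemma ideal_generated_ideal:
  assumes "hom_nonassoc_alg K A" "S \<subseteq> carrier A"
  shows "two_sided_ideal K A (ideal_generated K A S)"
proof -
  interpret hom_nonassoc_alg K A by fact
  show ?thesis
    unfolding ideal_generated_def
    using assms(2) carrier_two_sided_ideal module_axioms by (intro two_sided_ideal_Inter) blast+
qed

lemma morphism_linear: "hom_alg_morphism K A B f \<Longrightarrow> linear_map K A B f"
  and morphism_mult: "hom_alg_morphism K A B f \<Longrightarrow> x \<in> carrier A \<Longrightarrow> y \<in> carrier A \<Longrightarrow>
    f (x \<otimes>\<^bsub>A\<^esub> y) = f x \<otimes>\<^bsub>B\<^esub> f y"
  and morphism_twist: "hom_alg_morphism K A B f \<Longrightarrow> x \<in> carrier A \<Longrightarrow> f (\<alpha>\<^bsub>A\<^esub> x) = \<alpha>\<^bsub>B\<^esub> (f x)"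
  by (auto simp: hom_alg_morphism_def)

lemmas morphism_closed = linear_map_closed[OF morphism_linear]
  and morphism_add = linear_map_add[OF morphism_linear]
  and morphism_smult = linear_map_smult[OF morphism_linear]

lemma unital_morphism_morphism: "unital_hom_alg_morphism K A B f \<Longrightarrow> hom_alg_morphism K A B f"
  and unital_morphism_one: "unital_hom_alg_morphism K A B f \<Longrightarrow> f \<one>\<^bsub>A\<^esub> = \<one>\<^bsub>B\<^esub>"
  by (auto simp: unital_hom_alg_morphism_def)

lemma morphism_comp:
  "hom_alg_morphism K A B f \<Longrightarrow> hom_alg_morphism K B C g \<Longrightarrow> hom_alg_morphism K A C (\<lambda>x. g (f x))"
  using linear_map_comp[of K A B f C g] linear_map_closed[of K A B f]
  by (simp add: hom_alg_morphism_def)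

lemma (in hom_module) twist_closed: "x \<in> carrier V \<Longrightarrow> \<alpha>\<^bsub>V\<^esub> x \<in> carrier V"
  and twist_add: "x \<in> carrier V \<Longrightarrow> y \<in> carrier V \<Longrightarrow> \<alpha>\<^bsub>V\<^esub> (x \<oplus>\<^bsub>V\<^esub> y) = \<alpha>\<^bsub>V\<^esub> x \<oplus>\<^bsub>V\<^esub> \<alpha>\<^bsub>V\<^esub> y"
  and twist_smult: "c \<in> carrier K \<Longrightarrow> x \<in> carrier V \<Longrightarrow> \<alpha>\<^bsub>V\<^esub> (c \<odot>\<^bsub>V\<^esub> x) = c \<odot>\<^bsub>V\<^esub> \<alpha>\<^bsub>V\<^esub> x"
  using twist_linear by (auto simp: linear_map_def)

lemma (in hom_nonassoc_alg) mult_linear_left: "y \<in> carrier A \<Longrightarrow> linear_map K A A (\<lambda>x. x \<otimes>\<^bsub>A\<^esub> y)"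
  and mult_linear_right: "x \<in> carrier A \<Longrightarrow> linear_map K A A (\<lambda>y. x \<otimes>\<^bsub>A\<^esub> y)"
  by (auto simp: linear_map_def mult_closed mult_add_left mult_add_right mult_smult_left mult_smult_right)

lemma (in hom_nonassoc_alg) mult_zero_left: "x \<in> carrier A \<Longrightarrow> \<zero>\<^bsub>A\<^esub> \<otimes>\<^bsub>A\<^esub> x = \<zero>\<^bsub>A\<^esub>"
  and mult_zero_right: "x \<in> carrier A \<Longrightarrow> x \<otimes>\<^bsub>A\<^esub> \<zero>\<^bsub>A\<^esub> = \<zero>\<^bsub>A\<^esub>"
  using linear_map_zero[OF module_axioms module_axioms mult_linear_left]
    linear_map_zero[OF module_axioms module_axioms mult_linear_right] by auto

text \<open>All ideals of relations below are least ideals of some kind, so a morphism is shown to kill one of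
  them by showing that its kernel belongs to the same kind.\<close>

lemma morphism_kernel_ideal:
  assumes "hom_nonassoc_alg K A" "hom_nonassoc_alg K B" "hom_alg_morphism K A B f"
  shows "two_sided_ideal K A {x \<in> carrier A. f x = \<zero>\<^bsub>B\<^esub>}"
proof -
  interpret A: hom_nonassoc_alg K A by fact
  interpret B: hom_nonassoc_alg K B by fact
  show ?thesis
    unfolding two_sided_ideal_def
    using submodule_kernel[OF A.module_axioms B.module_axioms morphism_linear[OF assms(3)]]
      assms(3)
    by (auto simp: A.mult_closed morphism_mult B.mult_zero_left B.mult_zero_right morphism_closed)
qed

lemma morphism_kernel_twist:
  assumes "hom_nonassoc_alg K A" "hom_nonassoc_alg K B" "hom_alg_morphism K A B f"
    "x \<in> carrier A" "f x = \<zero>\<^bsub>B\<^esub>"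
  shows "f (\<alpha>\<^bsub>A\<^esub> x) = \<zero>\<^bsub>B\<^esub>"
proof -
  interpret B: hom_nonassoc_alg K B by fact
  show ?thesis
    using assms(3-5) linear_map_zero[OF B.module_axioms B.module_axioms B.twist_linear]
    by (simp add: morphism_twist)
qed

section \<open>Quotients\<close>

text \<open>Every identity passes to a surjective image.  The module axioms of the target are part of the
  conclusion, which suits a quotient whose operations are given by formulas on cosets.\<close>

lemma module_surj_image:
  assumes "module K M" "linear_map K M Q p" "p ` carrier M = carrier Q" "p \<zero>\<^bsub>M\<^esub> = \<zero>\<^bsub>Q\<^esub>"
  shows "module K Q"
proof -
  interpret M: module K M by fact
  have ex: "\<exists>x\<in>carrier M. X = p x" if "X \<in> carrier Q" for X
    using that assms(3) by blast
  have cl: "p x \<in> carrier Q" if "x \<in> carrier M" for x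
    using that assms(3) by blast
  have ad: "p x \<oplus>\<^bsub>Q\<^esub> p y = p (x \<oplus>\<^bsub>M\<^esub> y)" if "x \<in> carrier M" "y \<in> carrier M" for x y
    using that linear_map_add[OF assms(2)] by simp
  have sm: "c \<odot>\<^bsub>Q\<^esub> p x = p (c \<odot>\<^bsub>M\<^esub> x)" if "c \<in> carrier K" "x \<in> carrier M" for c x
    using that linear_map_smult[OF assms(2)] by simp
  have ng: "\<exists>y\<in>carrier M. y \<oplus>\<^bsub>M\<^esub> x = \<zero>\<^bsub>M\<^esub>" if "x \<in> carrier M" for x
    using that M.l_neg by blast
  show ?thesis
  proof (rule moduleI)
    show "abelian_group Q"
    proof (rule abelian_groupI)
      fix X assume "X \<in> carrier Q"
      then obtain x where "x \<in> carrier M" "X = p x" using ex by blast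
      moreover from this obtain y where "y \<in> carrier M" "y \<oplus>\<^bsub>M\<^esub> x = \<zero>\<^bsub>M\<^esub>" using ng by blast
      ultimately have "p y \<in> carrier Q" "p y \<oplus>\<^bsub>Q\<^esub> X = \<zero>\<^bsub>Q\<^esub>" by (auto simp: cl ad assms(4))
      then show "\<exists>Y\<in>carrier Q. Y \<oplus>\<^bsub>Q\<^esub> X = \<zero>\<^bsub>Q\<^esub>" by blast
    qed (auto dest!: ex simp: cl ad assms(4)[symmetric] M.a_assoc M.a_comm M.a_lcomm)
  qed (auto dest!: ex simp: cl ad sm M.smult_l_distr M.smult_r_distr M.smult_assoc1 M.R.is_cring)
qed

lemma module_cong:
  assumes "module K M" "carrier M' = carrier M" "add M' = add M" "smult M' = smult M" "zero M' = zero M"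
  shows "module K M'"
proof -
  interpret M: module K M by fact
  show ?thesis
    by (rule module_surj_image[OF assms(1), of _ "\<lambda>x. x"]) (auto simp: linear_map_def assms(2-5))
qed

lemma hom_nonassoc_alg_surj_image:
  assumes "hom_nonassoc_alg K A" "hom_alg_morphism K A Q p" "p ` carrier A = carrier Q"
    "p \<zero>\<^bsub>A\<^esub> = \<zero>\<^bsub>Q\<^esub>"
  shows "hom_nonassoc_alg K Q"
proof -
  interpret A: hom_nonassoc_alg K A by fact
  interpret Q: module K Q
    by (rule module_surj_image[OF A.module_axioms morphism_linear[OF assms(2)] assms(3,4)])
  have ex: "\<exists>x\<in>carrier A. X = p x" if "X \<in> carrier Q" for X
    using that assms(3) by blast
  note rules = morphism_closed[OF assms(2)] morphism_add[OF assms(2), symmetric]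
    morphism_smult[OF assms(2), symmetric] morphism_mult[OF assms(2), symmetric]
    morphism_twist[OF assms(2), symmetric]
  show ?thesis
  proof
    show "linear_map K Q Q \<alpha>\<^bsub>Q\<^esub>"
      by (auto simp: linear_map_def rules A.twist_closed A.twist_add A.twist_smult dest!: ex)
  qed (auto dest!: ex simp: rules A.mult_closed A.mult_add_left A.mult_add_right A.mult_smult_left
      A.mult_smult_right)
qed

lemma unital_hom_nonassoc_alg_surj_image:
  assumes "unital_hom_nonassoc_alg K A" "unital_hom_alg_morphism K A Q p"
    "p ` carrier A = carrier Q" "p \<zero>\<^bsub>A\<^esub> = \<zero>\<^bsub>Q\<^esub>"
  shows "unital_hom_nonassoc_alg K Q"
proof -
  interpret A: unital_hom_nonassoc_alg K A by fact
  note mor = unital_morphism_morphism[OF assms(2)]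
  interpret Q: hom_nonassoc_alg K Q
    by (rule hom_nonassoc_alg_surj_image[OF A.hom_nonassoc_alg_axioms mor assms(3,4)])
  have ex: "\<exists>x\<in>carrier A. X = p x" if "X \<in> carrier Q" for X
    using that assms(3) by blast
  show ?thesis
    by unfold_locales (auto dest!: ex simp: unital_morphism_one[OF assms(2), symmetric]
        morphism_closed[OF mor] morphism_mult[OF mor, symmetric] A.unit_closed A.unit_left A.unit_right)
qed

lemma linear_map_factor:
  assumes "module K M" "linear_map K M Q p" "p ` carrier M = carrier Q" "linear_map K M T f"
    "\<And>x. x \<in> carrier M \<Longrightarrow> g (p x) = f x"
  shows "linear_map K Q T g"
proof -
  interpret M: module K M by fact
  have ex: "\<exists>x\<in>carrier M. X = p x" if "X \<in> carrier Q" for X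
    using that assms(3) by blast
  show ?thesis
    unfolding linear_map_def
    using assms(4)
    by (auto dest!: ex simp: linear_map_add[OF assms(2), symmetric]
        linear_map_smult[OF assms(2), symmetric] assms(5) linear_map_add linear_map_smult
        linear_map_closed)
qed

lemma morphism_factor:
  assumes "hom_nonassoc_alg K A" "hom_alg_morphism K A Q p" "p ` carrier A = carrier Q"
    "hom_alg_morphism K A B f" "\<And>x. x \<in> carrier A \<Longrightarrow> g (p x) = f x"
  shows "hom_alg_morphism K Q B g"
proof -
  interpret A: hom_nonassoc_alg K A by fact
  have ex: "\<exists>x\<in>carrier A. X = p x" if "X \<in> carrier Q" for X
    using that assms(3) by blast
  have "linear_map K Q B g"
    by (rule linear_map_factor[OF A.module_axioms morphism_linear[OF assms(2)] assms(3)
          morphism_linear[OF assms(4)] assms(5)])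
  then show ?thesis
    unfolding hom_alg_morphism_def
    using assms(4)
    by (auto dest!: ex simp: morphism_mult[OF assms(2), symmetric] A.mult_closed A.twist_closed
        morphism_twist[OF assms(2), symmetric] assms(5) morphism_mult morphism_twist)
qed

lemma submodule_abelian_subgroup:
  assumes "module K M" "submodule N K M"
  shows "abelian_subgroup N M"
proof -
  interpret M: module K M by fact
  show ?thesis
    using submodule.axioms(1)[OF assms(2)]
    by (intro abelian_subgroupI3 additive_subgroup.intro) (auto simp: M.abelian_group_axioms)
qed

lemma coset_mem:
  "module K M \<Longrightarrow> submodule N K M \<Longrightarrow> x \<in> carrier M \<Longrightarrow> x \<in> N +>\<^bsub>M\<^esub> x"
  by (rule abelian_subgroup.a_rcos_self[OF submodule_abelian_subgroup])

lemma coset_memD: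
  assumes "module K M" "submodule N K M" "x \<in> carrier M" "y \<in> N +>\<^bsub>M\<^esub> x"
  shows "y \<in> carrier M" "y \<ominus>\<^bsub>M\<^esub> x \<in> N"
proof -
  interpret N: abelian_subgroup N M
    by (rule submodule_abelian_subgroup[OF assms(1,2)])
  show "y \<in> carrier M"
    using assms(3,4) by (rule N.a_elemrcos_carrier)
  show "y \<ominus>\<^bsub>M\<^esub> x \<in> N"
    using assms(3,4) by (simp add: a_minus_def N.a_rcos_module_imp)
qed

lemma coset_eqI:
  assumes "module K M" "submodule N K M" "x \<in> carrier M" "y \<in> carrier M" "y \<ominus>\<^bsub>M\<^esub> x \<in> N"
  shows "N +>\<^bsub>M\<^esub> y = N +>\<^bsub>M\<^esub> x"
proof -
  interpret N: abelian_subgroup N M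
    by (rule submodule_abelian_subgroup[OF assms(1,2)])
  have "y \<in> N +>\<^bsub>M\<^esub> x"
    using assms by (intro N.a_rcos_module_rev) (auto simp: a_minus_def)
  then show ?thesis
    using N.a_repr_independence' assms(3) by metis
qed

lemma coset_zero:
  "module K M \<Longrightarrow> submodule N K M \<Longrightarrow> N +>\<^bsub>M\<^esub> \<zero>\<^bsub>M\<^esub> = N"
  by (metis abelian_group.a_coset_add_zero module.axioms(2) module.submoduleE(1))

lemma coset_add:
  assumes "module K M" "submodule N K M" "x \<in> carrier M" "y \<in> carrier M"
  shows "N +>\<^bsub>M\<^esub> (x \<oplus>\<^bsub>M\<^esub> y) = set_add M (N +>\<^bsub>M\<^esub> x) (N +>\<^bsub>M\<^esub> y)"
  using abelian_subgroup.a_rcos_sum[OF submodule_abelian_subgroup] assms by metis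

lemma coset_map_Union:
  assumes "module K M" "submodule N K M" "linear_map K M M f" "f ` N \<subseteq> N" "x \<in> carrier M"
  shows "(\<Union>y\<in>N +>\<^bsub>M\<^esub> x. N +>\<^bsub>M\<^esub> f y) = N +>\<^bsub>M\<^esub> f x"
proof -
  have "N +>\<^bsub>M\<^esub> f y = N +>\<^bsub>M\<^esub> f x" if "y \<in> N +>\<^bsub>M\<^esub> x" for y
  proof (rule coset_eqI[OF assms(1,2)])
    note y = coset_memD[OF assms(1,2,5) that]
    show "f x \<in> carrier M" "f y \<in> carrier M"
      using assms(3,5) y linear_map_closed by metis+
    show "f y \<ominus>\<^bsub>M\<^esub> f x \<in> N"
      using y assms(4) linear_map_minus[OF assms(1,1,3) y(1) assms(5)] by auto
  qed
  then show ?thesis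
    using coset_mem[OF assms(1,2,5)] by blast
qed

lemma (in module) smult_linear: "c \<in> carrier R \<Longrightarrow> linear_map R M M (\<lambda>x. c \<odot>\<^bsub>M\<^esub> x)"
  by (auto simp: linear_map_def smult_r_distr smult_assoc1[symmetric] R.m_comm)

lemma coset_smult:
  assumes "module K M" "submodule N K M" "c \<in> carrier K" "x \<in> carrier M"
  shows "(\<Union>y\<in>N +>\<^bsub>M\<^esub> x. N +>\<^bsub>M\<^esub> (c \<odot>\<^bsub>M\<^esub> y)) = N +>\<^bsub>M\<^esub> (c \<odot>\<^bsub>M\<^esub> x)"
  using assms module.submoduleE(4)[OF assms(1,2)]
  by (intro coset_map_Union) (auto intro: module.smult_linear)

lemma carrier_cosets: "(\<lambda>x. N +>\<^bsub>M\<^esub> x) ` carrier M = a_rcosets\<^bsub>M\<^esub> N"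
  by (auto simp: A_RCOSETS_def')

lemma coset_in_cosets: "x \<in> carrier M \<Longrightarrow> N +>\<^bsub>M\<^esub> x \<in> a_rcosets\<^bsub>M\<^esub> N"
  by (auto simp: A_RCOSETS_def')

lemma module_quotient_projection:
  assumes "module K M" "submodule N K M"
  shows "linear_map K M (module_quotient M N) (\<lambda>x. N +>\<^bsub>M\<^esub> x)"
  using assms by (auto simp: linear_map_def module_quotient_def coset_add coset_smult coset_in_cosets)

lemma module_quotient_surj: "(\<lambda>x. N +>\<^bsub>M\<^esub> x) ` carrier M = carrier (module_quotient M N)"
  by (simp add: module_quotient_def carrier_cosets)

lemma module_quotient_module:
  assumes "module K M" "submodule N K M"
  shows "module K (module_quotient M N)"
  using assms
  by (intro module_surj_image[OF assms(1) module_quotient_projection[OF assms] module_quotient_surj])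
    (simp add: module_quotient_def coset_zero)

text \<open>For cosets of an ideal the identity \<open>x'y' - xy = (x' - x)y' + x(y' - y)\<close> shows that the product
  of two cosets lies in one coset.\<close>

lemma coset_mult:
  assumes "hom_nonassoc_alg K A" "two_sided_ideal K A I" "x \<in> carrier A" "y \<in> carrier A"
  shows "rcoset_mult A I (I +>\<^bsub>A\<^esub> x) (I +>\<^bsub>A\<^esub> y) = I +>\<^bsub>A\<^esub> (x \<otimes>\<^bsub>A\<^esub> y)"
proof -
  interpret A: hom_nonassoc_alg K A by fact
  have I: "submodule I K A"
    using assms(2) by (simp add: two_sided_ideal_def)
  note mem = coset_memD[OF A.module_axioms I]
  have "I +>\<^bsub>A\<^esub> (x' \<otimes>\<^bsub>A\<^esub> y') = I +>\<^bsub>A\<^esub> (x \<otimes>\<^bsub>A\<^esub> y)"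
    if "x' \<in> I +>\<^bsub>A\<^esub> x" "y' \<in> I +>\<^bsub>A\<^esub> y" for x' y'
  proof -
    note x' = mem[OF assms(3) that(1)] and y' = mem[OF assms(4) that(2)]
    have "I +>\<^bsub>A\<^esub> (x' \<otimes>\<^bsub>A\<^esub> y') = I +>\<^bsub>A\<^esub> (x \<otimes>\<^bsub>A\<^esub> y')"
    proof (rule coset_eqI[OF A.module_axioms I])
      have "x' \<otimes>\<^bsub>A\<^esub> y' \<ominus>\<^bsub>A\<^esub> x \<otimes>\<^bsub>A\<^esub> y' = (x' \<ominus>\<^bsub>A\<^esub> x) \<otimes>\<^bsub>A\<^esub> y'"
        using linear_map_minus[OF A.module_axioms A.module_axioms A.mult_linear_left] x' y' assms(3)
        by simp
      then show "x' \<otimes>\<^bsub>A\<^esub> y' \<ominus>\<^bsub>A\<^esub> x \<otimes>\<^bsub>A\<^esub> y' \<in> I"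
        using assms(2) x' y' by (simp add: two_sided_ideal_def)
    qed (use x' y' assms in \<open>auto simp: A.mult_closed\<close>)
    also have "\<dots> = I +>\<^bsub>A\<^esub> (x \<otimes>\<^bsub>A\<^esub> y)"
    proof (rule coset_eqI[OF A.module_axioms I])
      have "x \<otimes>\<^bsub>A\<^esub> y' \<ominus>\<^bsub>A\<^esub> x \<otimes>\<^bsub>A\<^esub> y = x \<otimes>\<^bsub>A\<^esub> (y' \<ominus>\<^bsub>A\<^esub> y)"
        using linear_map_minus[OF A.module_axioms A.module_axioms A.mult_linear_right] y' assms(3,4)
        by simp
      then show "x \<otimes>\<^bsub>A\<^esub> y' \<ominus>\<^bsub>A\<^esub> x \<otimes>\<^bsub>A\<^esub> y \<in> I"
        using assms(2,3) y' by (simp add: two_sided_ideal_def)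
    qed (use x' y' assms in \<open>auto simp: A.mult_closed\<close>)
    finally show ?thesis .
  qed
  then show ?thesis
    unfolding rcoset_mult_def
    using coset_mem[OF A.module_axioms I assms(3)] coset_mem[OF A.module_axioms I assms(4)] by blast
qed

lemma hom_quotient_surj: "(\<lambda>x. I +>\<^bsub>A\<^esub> x) ` carrier A = carrier (hom_quotient A I)"
  by (simp add: hom_quotient_def carrier_cosets)

lemma hom_quotient_projection:
  assumes "hom_nonassoc_alg K A" "two_sided_ideal K A I" "\<alpha>\<^bsub>A\<^esub> ` I \<subseteq> I"
  shows "hom_alg_morphism K A (hom_quotient A I) (\<lambda>x. I +>\<^bsub>A\<^esub> x)"
proof -
  interpret A: hom_nonassoc_alg K A by fact
  have I: "submodule I K A"
    using assms(2) by (simp add: two_sided_ideal_def)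
  show ?thesis
    using coset_map_Union[OF A.module_axioms I A.twist_linear assms(3)]
    by (auto simp: hom_alg_morphism_def linear_map_def hom_quotient_def coset_in_cosets
        coset_add[OF A.module_axioms I] coset_smult[OF A.module_axioms I] coset_mult[OF assms(1,2)])
qed

lemma hom_quotient_zero:
  assumes "hom_nonassoc_alg K A" "two_sided_ideal K A I"
  shows "I +>\<^bsub>A\<^esub> \<zero>\<^bsub>A\<^esub> = \<zero>\<^bsub>hom_quotient A I\<^esub>"
proof -
  interpret A: hom_nonassoc_alg K A by fact
  show ?thesis
    using assms(2) by (simp add: hom_quotient_def two_sided_ideal_def coset_zero[OF A.module_axioms])
qed

lemma hom_quotient_hom_nonassoc_alg:
  assumes "hom_nonassoc_alg K A" "two_sided_ideal K A I" "\<alpha>\<^bsub>A\<^esub> ` I \<subseteq> I"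
  shows "hom_nonassoc_alg K (hom_quotient A I)"
  using hom_nonassoc_alg_surj_image[OF assms(1) hom_quotient_projection[OF assms] hom_quotient_surj
      hom_quotient_zero[OF assms(1,2)]] .

text \<open>A linear map that vanishes on \<open>N\<close> is constant on each coset of \<open>N\<close>.\<close>

lemma the_elem_coset:
  assumes "module K M" "module K T" "submodule N K M" "linear_map K M T f"
    "\<And>x. x \<in> N \<Longrightarrow> f x = \<zero>\<^bsub>T\<^esub>" "x \<in> carrier M"
  shows "the_elem (f ` (N +>\<^bsub>M\<^esub> x)) = f x"
proof -
  interpret T: module K T by fact
  have "f y = f x" if "y \<in> N +>\<^bsub>M\<^esub> x" for y
  proof -
    note y = coset_memD[OF assms(1,3,6) that]
    have "f y \<ominus>\<^bsub>T\<^esub> f x = \<zero>\<^bsub>T\<^esub>"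
      using linear_map_minus[OF assms(1,2,4) y(1) assms(6)] assms(5) y(2) by simp
    then show ?thesis
      using linear_map_closed[OF assms(4)] y(1) assms(6) by (simp add: T.minus_eq_zero_iff)
  qed
  then have "f ` (N +>\<^bsub>M\<^esub> x) = {f x}"
    using coset_mem[OF assms(1,3,6)] by blast
  then show ?thesis
    by simp
qed

lemma hom_quotient_lift:
  assumes "hom_nonassoc_alg K A" "hom_nonassoc_alg K B" "two_sided_ideal K A I" "\<alpha>\<^bsub>A\<^esub> ` I \<subseteq> I"
    "hom_alg_morphism K A B f" "\<And>x. x \<in> I \<Longrightarrow> f x = \<zero>\<^bsub>B\<^esub>"
  obtains g where "hom_alg_morphism K (hom_quotient A I) B g"
    "\<And>x. x \<in> carrier A \<Longrightarrow> g (I +>\<^bsub>A\<^esub> x) = f x"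
proof
  interpret A: hom_nonassoc_alg K A by fact
  interpret B: hom_nonassoc_alg K B by fact
  let ?g = "\<lambda>X. the_elem (f ` X)"
  show g: "?g (I +>\<^bsub>A\<^esub> x) = f x" if "x \<in> carrier A" for x
    using the_elem_coset[OF A.module_axioms B.module_axioms _ morphism_linear] assms that
    by (simp add: two_sided_ideal_def)
  show "hom_alg_morphism K (hom_quotient A I) B ?g"
    by (rule morphism_factor[OF assms(1) hom_quotient_projection[OF assms(1,3,4)] hom_quotient_surj
          assms(5) g])
qed

section \<open>Free modules\<close>

lemma free_module_module:
  assumes "cring K"
  shows "module K (free_module K S)"
proof -
  interpret K: cring K by fact
  let ?M = "free_module K S"
  have fin_add: "finite {s. \<phi> s \<oplus>\<^bsub>K\<^esub> \<psi> s \<noteq> \<zero>\<^bsub>K\<^esub>}"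
    if "finite {s. \<phi> s \<noteq> \<zero>\<^bsub>K\<^esub>}" "finite {s. \<psi> s \<noteq> \<zero>\<^bsub>K\<^esub>}" for \<phi> \<psi>
    by (rule finite_subset[OF _ finite_UnI[OF that]]) auto
  have fin_smult: "finite {s. c \<otimes>\<^bsub>K\<^esub> \<phi> s \<noteq> \<zero>\<^bsub>K\<^esub>}"
    if "c \<in> carrier K" "finite {s. \<phi> s \<noteq> \<zero>\<^bsub>K\<^esub>}" for c \<phi>
    using that(1) by (auto intro: finite_subset[OF _ that(2)])
  show ?thesis
  proof (rule moduleI)
    show "abelian_group ?M"
    proof (rule abelian_groupI)
      fix \<phi> assume "\<phi> \<in> carrier ?M"
      then have "(\<lambda>s. \<ominus>\<^bsub>K\<^esub> \<one>\<^bsub>K\<^esub> \<otimes>\<^bsub>K\<^esub> \<phi> s) \<in> carrier ?M"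
        "(\<lambda>s. \<ominus>\<^bsub>K\<^esub> \<one>\<^bsub>K\<^esub> \<otimes>\<^bsub>K\<^esub> \<phi> s) \<oplus>\<^bsub>?M\<^esub> \<phi> = \<zero>\<^bsub>?M\<^esub>"
        using fin_smult[of "\<ominus>\<^bsub>K\<^esub> \<one>\<^bsub>K\<^esub>" \<phi>]
        by (auto simp: free_module_def K.l_minus K.l_neg)
      then show "\<exists>\<psi>\<in>carrier ?M. \<psi> \<oplus>\<^bsub>?M\<^esub> \<phi> = \<zero>\<^bsub>?M\<^esub>" by blast
    qed (auto simp: free_module_def K.a_ac fin_add)
  qed (auto simp: free_module_def assms fin_smult K.l_distr K.r_distr K.m_assoc)
qed

lemma basis_vec_carrier:
  assumes "cring K" "s \<in> S"
  shows "basis_vec K s \<in> carrier (free_module K S)"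
proof -
  interpret K: cring K by fact
  show ?thesis
    using assms(2) by (auto simp: free_module_def basis_vec_def intro: finite_subset[of _ "{s}"])
qed

text \<open>Induction on a finite set containing the support, splitting off one coefficient at a time.\<close>

lemma free_module_span:
  assumes "cring K" "submodule N K (free_module K S)" "\<And>s. s \<in> S \<Longrightarrow> basis_vec K s \<in> N"
    "\<phi> \<in> carrier (free_module K S)"
  shows "\<phi> \<in> N"
proof -
  interpret K: cring K by fact
  interpret M: module K "free_module K S"
    by (rule free_module_module[OF assms(1)])
  note N = M.submoduleE[OF assms(2)] M.submodule_zero[OF assms(2)]
  have "\<phi> \<in> N"
    if "finite F" "\<phi> \<in> carrier (free_module K S)" "{s. \<phi> s \<noteq> \<zero>\<^bsub>K\<^esub>} \<subseteq> F" for F \<phi>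
    using that
  proof (induction F arbitrary: \<phi> rule: finite_induct)
    case empty
    then have "\<phi> = \<zero>\<^bsub>free_module K S\<^esub>"
      by (auto simp: free_module_def)
    then show ?case
      using N by simp
  next
    case (insert s F)
    let ?\<psi> = "\<phi>(s := \<zero>\<^bsub>K\<^esub>)"
    have \<psi>: "?\<psi> \<in> carrier (free_module K S)"
      using insert.prems(1) by (auto simp: free_module_def intro: finite_subset[rotated])
    show ?case
    proof (cases "s \<in> S")
      case True
      have "\<phi> = \<phi> s \<odot>\<^bsub>free_module K S\<^esub> basis_vec K s \<oplus>\<^bsub>free_module K S\<^esub> ?\<psi>"
        using insert.prems(1) by (auto simp: free_module_def basis_vec_def)
      moreover have "?\<psi> \<in> N"
        using insert.prems(2) by (intro insert.IH \<psi>) auto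
      moreover have "\<phi> s \<in> carrier K"
        using insert.prems(1) by (auto simp: free_module_def)
      ultimately show ?thesis
        using N(4,5) assms(3)[OF True] by metis
    next
      case False
      then have "\<phi> s = \<zero>\<^bsub>K\<^esub>"
        using insert.prems(1) by (auto simp: free_module_def)
      then show ?thesis
        using insert.prems(2) by (intro insert.IH[OF insert.prems(1)]) auto
    qed
  qed
  from this[OF _ assms(4)] show ?thesis
    using assms(4) by (auto simp: free_module_def)
qed

lemma free_module_ext:
  assumes "cring K" "module K T" "linear_map K (free_module K S) T f"
    "linear_map K (free_module K S) T g"
    "\<And>s. s \<in> S \<Longrightarrow> f (basis_vec K s) = g (basis_vec K s)" "\<phi> \<in> carrier (free_module K S)"
  shows "f \<phi> = g \<phi>"
proof -
  have "\<phi> \<in> {\<phi> \<in> carrier (free_module K S). f \<phi> = g \<phi>}"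
    by (rule free_module_span[OF assms(1) submodule_equalizer[OF free_module_module[OF assms(1)]
            assms(2-4)] _ assms(6)]) (simp add: assms(5) basis_vec_carrier[OF assms(1)])
  then show ?thesis
    by simp
qed

text \<open>The supports of \<open>\<phi>\<close>, \<open>\<psi>\<close>, \<open>\<phi> + \<psi>\<close> and \<open>c \<phi>\<close> may differ; summing over a common finite set that
  contains them makes linearity a termwise matter.\<close>

lemma lin_ext_superset:
  assumes "module K T" "\<phi> \<in> carrier (free_module K S)" "b \<in> S \<rightarrow> carrier T"
    "finite F" "{s. \<phi> s \<noteq> \<zero>\<^bsub>K\<^esub>} \<subseteq> F" "F \<subseteq> S"
  shows "lin_ext K T b \<phi> = (\<Oplus>\<^bsub>T\<^esub>s\<in>F. \<phi> s \<odot>\<^bsub>T\<^esub> b s)"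
proof -
  interpret T: module K T by fact
  show ?thesis
    unfolding lin_ext_def
    using assms(2-6)
    by (intro T.add.finprod_mono_neutral_cong_left) (auto simp: free_module_def Pi_iff subset_iff)
qed

lemma lin_ext_linear:
  assumes "module K T" "b \<in> S \<rightarrow> carrier T"
  shows "linear_map K (free_module K S) T (lin_ext K T b)"
proof -
  interpret T: module K T by fact
  interpret M: module K "free_module K S"
    by (rule free_module_module[OF T.R.is_cring])
  let ?supp = "\<lambda>\<phi>. {s. \<phi> s \<noteq> \<zero>\<^bsub>K\<^esub>}"
  have supp: "finite (?supp \<phi>)" "?supp \<phi> \<subseteq> S" "\<And>s. \<phi> s \<in> carrier K"
    if "\<phi> \<in> carrier (free_module K S)" for \<phi>
    using that by (auto simp: free_module_def)
  have b: "b s \<in> carrier T" if "s \<in> S" for s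
    using assms(2) that by blast
  have "lin_ext K T b \<phi> \<in> carrier T" if "\<phi> \<in> carrier (free_module K S)" for \<phi>
    unfolding lin_ext_def using supp[OF that] b by (intro T.finsum_closed) auto
  moreover have "lin_ext K T b (\<phi> \<oplus>\<^bsub>free_module K S\<^esub> \<psi>) = lin_ext K T b \<phi> \<oplus>\<^bsub>T\<^esub> lin_ext K T b \<psi>"
    if \<phi>: "\<phi> \<in> carrier (free_module K S)" and \<psi>: "\<psi> \<in> carrier (free_module K S)" for \<phi> \<psi>
  proof -
    let ?F = "?supp \<phi> \<union> ?supp \<psi>"
    have F: "finite ?F" "?F \<subseteq> S"
      using supp[OF \<phi>] supp[OF \<psi>] by auto
    have sum: "(\<phi> \<oplus>\<^bsub>free_module K S\<^esub> \<psi>) s = \<phi> s \<oplus>\<^bsub>K\<^esub> \<psi> s" for s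
      by (simp add: free_module_def)
    have "lin_ext K T b (\<phi> \<oplus>\<^bsub>free_module K S\<^esub> \<psi>)
        = (\<Oplus>\<^bsub>T\<^esub>s\<in>?F. (\<phi> \<oplus>\<^bsub>free_module K S\<^esub> \<psi>) s \<odot>\<^bsub>T\<^esub> b s)"
      using F \<phi> \<psi> by (intro lin_ext_superset[OF assms(1) _ assms(2)]) (auto simp: sum)
    also have "\<dots> = (\<Oplus>\<^bsub>T\<^esub>s\<in>?F. \<phi> s \<odot>\<^bsub>T\<^esub> b s \<oplus>\<^bsub>T\<^esub> \<psi> s \<odot>\<^bsub>T\<^esub> b s)"
      using F b supp[OF \<phi>] supp[OF \<psi>]
      by (intro T.finsum_cong') (auto simp: sum T.smult_l_distr)
    also have "\<dots> = (\<Oplus>\<^bsub>T\<^esub>s\<in>?F. \<phi> s \<odot>\<^bsub>T\<^esub> b s) \<oplus>\<^bsub>T\<^esub> (\<Oplus>\<^bsub>T\<^esub>s\<in>?F. \<psi> s \<odot>\<^bsub>T\<^esub> b s)"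
      using F b supp[OF \<phi>] supp[OF \<psi>] by (intro T.finsum_addf) auto
    also have "\<dots> = lin_ext K T b \<phi> \<oplus>\<^bsub>T\<^esub> lin_ext K T b \<psi>"
      using F lin_ext_superset[OF assms(1) \<phi> assms(2), of ?F]
        lin_ext_superset[OF assms(1) \<psi> assms(2), of ?F] by simp
    finally show ?thesis .
  qed
  moreover have "lin_ext K T b (c \<odot>\<^bsub>free_module K S\<^esub> \<phi>) = c \<odot>\<^bsub>T\<^esub> lin_ext K T b \<phi>"
    if c: "c \<in> carrier K" and \<phi>: "\<phi> \<in> carrier (free_module K S)" for c \<phi>
  proof -
    let ?F = "?supp \<phi>"
    note F = supp[OF \<phi>]
    have mul: "(c \<odot>\<^bsub>free_module K S\<^esub> \<phi>) s = c \<otimes>\<^bsub>K\<^esub> \<phi> s" for s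
      by (simp add: free_module_def)
    have "lin_ext K T b (c \<odot>\<^bsub>free_module K S\<^esub> \<phi>)
        = (\<Oplus>\<^bsub>T\<^esub>s\<in>?F. (c \<odot>\<^bsub>free_module K S\<^esub> \<phi>) s \<odot>\<^bsub>T\<^esub> b s)"
      using F \<phi> c by (intro lin_ext_superset[OF assms(1) _ assms(2)]) (auto simp: mul)
    also have "\<dots> = (\<Oplus>\<^bsub>T\<^esub>s\<in>?F. c \<odot>\<^bsub>T\<^esub> (\<phi> s \<odot>\<^bsub>T\<^esub> b s))"
      using F b c by (intro T.finsum_cong') (auto simp: mul T.smult_assoc1)
    also have "\<dots> = c \<odot>\<^bsub>T\<^esub> lin_ext K T b \<phi>"
      unfolding lin_ext_def using F b c by (intro T.finsum_smult_ldistr[symmetric]) auto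
    finally show ?thesis .
  qed
  ultimately show ?thesis
    by (auto simp: linear_map_def)
qed

lemma lin_ext_basis_vec:
  assumes "module K T" "b s \<in> carrier T"
  shows "lin_ext K T b (basis_vec K s) = b s"
proof -
  interpret T: module K T by fact
  have "lin_ext K T b (basis_vec K s) = (\<Oplus>\<^bsub>T\<^esub>t\<in>{s}. basis_vec K s t \<odot>\<^bsub>T\<^esub> b t)"
    by (rule lin_ext_superset[OF assms(1) basis_vec_carrier[OF T.R.is_cring, of s "{s}"]])
      (use assms(2) in \<open>auto simp: basis_vec_def\<close>)
  also have "\<dots> = b s"
    using assms(2) by (simp add: basis_vec_def)
  finally show ?thesis .
qed

section \<open>Tensor products\<close>

definition bilinear_map ::
  "('a, 'm) ring_scheme \<Rightarrow> ('a, 'b, 'n) module_scheme \<Rightarrow> ('a, 'c, 'p) module_scheme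
    \<Rightarrow> ('a, 'd, 'q) module_scheme \<Rightarrow> ('b \<Rightarrow> 'c \<Rightarrow> 'd) \<Rightarrow> bool"
  where "bilinear_map K V W T b \<longleftrightarrow>
    (\<forall>v\<in>carrier V. linear_map K W T (\<lambda>w. b v w)) \<and> (\<forall>w\<in>carrier W. linear_map K V T (\<lambda>v. b v w))"

lemma bilinear_mapD:
  assumes "bilinear_map K V W T b"
  shows "v \<in> carrier V \<Longrightarrow> linear_map K W T (\<lambda>w. b v w)"
    and "w \<in> carrier W \<Longrightarrow> linear_map K V T (\<lambda>v. b v w)"
    and "v \<in> carrier V \<Longrightarrow> w \<in> carrier W \<Longrightarrow> b v w \<in> carrier T"
  using assms by (auto simp: bilinear_map_def linear_map_def)

lemma bilinear_map_comp:
  assumes "bilinear_map K V W T b" "linear_map K V' V f" "linear_map K W' W g"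
  shows "bilinear_map K V' W' T (\<lambda>v w. b (f v) (g w))"
  unfolding bilinear_map_def
  using bilinear_mapD(1,2)[OF assms(1)] linear_map_comp[OF assms(2)] linear_map_comp[OF assms(3)]
    linear_map_closed[OF assms(2)] linear_map_closed[OF assms(3)] by blast

locale tensor_product = V: module K V + W: module K W
  for K :: "('a, 'm) ring_scheme" and V :: "('a, 'b, 'n) module_scheme"
    and W :: "('a, 'c, 'p) module_scheme"
begin

lemma pair_module: "module K (pair_module K V W)"
  unfolding pair_module_def by (rule free_module_module[OF V.R.is_cring])

lemma pair_basis_carrier:
  "v \<in> carrier V \<Longrightarrow> w \<in> carrier W \<Longrightarrow> basis_vec K (v, w) \<in> carrier (pair_module K V W)"
  unfolding pair_module_def by (rule basis_vec_carrier[OF V.R.is_cring]) simp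

lemma tensor_relations_submodule: "submodule (tensor_relations K V W) K (pair_module K V W)"
proof -
  interpret P: module K "pair_module K V W"
    by (rule pair_module)
  show ?thesis
    unfolding tensor_relations_def Let_def
    by (rule submodule_generated_submodule[OF pair_module])
      (auto intro!: pair_basis_carrier P.minus_closed P.smult_closed P.a_closed)
qed

lemma tensor_module: "module K (tensor_module K V W)"
  unfolding tensor_module_def
  by (rule module_quotient_module[OF pair_module tensor_relations_submodule])

lemma tensor_projection_linear:
  "linear_map K (pair_module K V W) (tensor_module K V W)
    (\<lambda>x. tensor_relations K V W +>\<^bsub>pair_module K V W\<^esub> x)"
  unfolding tensor_module_def
  by (rule module_quotient_projection[OF pair_module tensor_relations_submodule])

lemma tensor_projection_surj:
  "(\<lambda>x. tensor_relations K V W +>\<^bsub>pair_module K V W\<^esub> x) ` carrier (pair_module K V W)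
    = carrier (tensor_module K V W)"
  unfolding tensor_module_def by (rule module_quotient_surj)

lemma pure_tensor_eqI:
  assumes "x \<in> carrier (pair_module K V W)" "v \<in> carrier V" "w \<in> carrier W"
    "basis_vec K (v, w) \<ominus>\<^bsub>pair_module K V W\<^esub> x \<in> tensor_relations K V W"
  shows "pure_tensor K V W v w = tensor_relations K V W +>\<^bsub>pair_module K V W\<^esub> x"
  unfolding pure_tensor_def
  using coset_eqI[OF pair_module tensor_relations_submodule assms(1) pair_basis_carrier assms(4)]
    assms(2,3) by simp

lemma tensor_relations_mem:
  shows "\<lbrakk>v \<in> carrier V; v' \<in> carrier V; w \<in> carrier W\<rbrakk> \<Longrightarrow> basis_vec K (v \<oplus>\<^bsub>V\<^esub> v', w)
      \<ominus>\<^bsub>pair_module K V W\<^esub> (basis_vec K (v, w) \<oplus>\<^bsub>pair_module K V W\<^esub> basis_vec K (v', w))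
      \<in> tensor_relations K V W"
    and "\<lbrakk>v \<in> carrier V; w \<in> carrier W; w' \<in> carrier W\<rbrakk> \<Longrightarrow> basis_vec K (v, w \<oplus>\<^bsub>W\<^esub> w')
      \<ominus>\<^bsub>pair_module K V W\<^esub> (basis_vec K (v, w) \<oplus>\<^bsub>pair_module K V W\<^esub> basis_vec K (v, w'))
      \<in> tensor_relations K V W"
    and "\<lbrakk>c \<in> carrier K; v \<in> carrier V; w \<in> carrier W\<rbrakk> \<Longrightarrow> basis_vec K (c \<odot>\<^bsub>V\<^esub> v, w)
      \<ominus>\<^bsub>pair_module K V W\<^esub> c \<odot>\<^bsub>pair_module K V W\<^esub> basis_vec K (v, w) \<in> tensor_relations K V W"
    and "\<lbrakk>c \<in> carrier K; v \<in> carrier V; w \<in> carrier W\<rbrakk> \<Longrightarrow> basis_vec K (v, c \<odot>\<^bsub>W\<^esub> w)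
      \<ominus>\<^bsub>pair_module K V W\<^esub> c \<odot>\<^bsub>pair_module K V W\<^esub> basis_vec K (v, w) \<in> tensor_relations K V W"
  unfolding tensor_relations_def Let_def
  by (rule subsetD[OF submodule_generated_incl], blast)+

lemma pure_tensor_bilinear: "bilinear_map K V W (tensor_module K V W) (pure_tensor K V W)"
proof -
  interpret P: module K "pair_module K V W"
    by (rule pair_module)
  note lin = linear_map_add[OF tensor_projection_linear] linear_map_smult[OF tensor_projection_linear]
    linear_map_closed[OF tensor_projection_linear]
  have "pure_tensor K V W v w \<in> carrier (tensor_module K V W)"
    if "v \<in> carrier V" "w \<in> carrier W" for v w
    using that by (simp add: pure_tensor_def lin pair_basis_carrier)
  moreover have "pure_tensor K V W (v \<oplus>\<^bsub>V\<^esub> v') w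
      = pure_tensor K V W v w \<oplus>\<^bsub>tensor_module K V W\<^esub> pure_tensor K V W v' w"
    if "v \<in> carrier V" "v' \<in> carrier V" "w \<in> carrier W" for v v' w
    using that pure_tensor_eqI[OF _ _ _ tensor_relations_mem(1)[OF that]]
    by (simp add: pure_tensor_def lin pair_basis_carrier)
  moreover have "pure_tensor K V W v (w \<oplus>\<^bsub>W\<^esub> w')
      = pure_tensor K V W v w \<oplus>\<^bsub>tensor_module K V W\<^esub> pure_tensor K V W v w'"
    if "v \<in> carrier V" "w \<in> carrier W" "w' \<in> carrier W" for v w w'
    using that pure_tensor_eqI[OF _ _ _ tensor_relations_mem(2)[OF that]]
    by (simp add: pure_tensor_def lin pair_basis_carrier)
  moreover have "pure_tensor K V W (c \<odot>\<^bsub>V\<^esub> v) w = c \<odot>\<^bsub>tensor_module K V W\<^esub> pure_tensor K V W v w"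
    if "c \<in> carrier K" "v \<in> carrier V" "w \<in> carrier W" for c v w
    using that pure_tensor_eqI[OF _ _ _ tensor_relations_mem(3)[OF that]]
    by (simp add: pure_tensor_def lin pair_basis_carrier)
  moreover have "pure_tensor K V W v (c \<odot>\<^bsub>W\<^esub> w) = c \<odot>\<^bsub>tensor_module K V W\<^esub> pure_tensor K V W v w"
    if "c \<in> carrier K" "v \<in> carrier V" "w \<in> carrier W" for c v w
    using that pure_tensor_eqI[OF _ _ _ tensor_relations_mem(4)[OF that]]
    by (simp add: pure_tensor_def lin pair_basis_carrier)
  ultimately show ?thesis
    by (simp add: bilinear_map_def linear_map_def Pi_iff)
qed

lemma pure_tensor_carrier:
  "v \<in> carrier V \<Longrightarrow> w \<in> carrier W \<Longrightarrow> pure_tensor K V W v w \<in> carrier (tensor_module K V W)"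
  by (rule bilinear_mapD(3)[OF pure_tensor_bilinear])

lemma tensor_span:
  assumes "submodule N K (tensor_module K V W)"
    "\<And>v w. v \<in> carrier V \<Longrightarrow> w \<in> carrier W \<Longrightarrow> pure_tensor K V W v w \<in> N"
    "X \<in> carrier (tensor_module K V W)"
  shows "X \<in> N"
proof -
  let ?p = "\<lambda>x. tensor_relations K V W +>\<^bsub>pair_module K V W\<^esub> x"
  interpret P: module K "pair_module K V W"
    by (rule pair_module)
  interpret T: module K "tensor_module K V W"
    by (rule tensor_module)
  have "submodule {x \<in> carrier (pair_module K V W). ?p x \<in> N} K (pair_module K V W)"
  proof (rule P.submoduleI_closed)
    show "\<zero>\<^bsub>pair_module K V W\<^esub> \<in> {x \<in> carrier (pair_module K V W). ?p x \<in> N}"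
      using T.submodule_zero[OF assms(1)]
        linear_map_zero[OF pair_module tensor_module tensor_projection_linear] by simp
  qed (auto simp: linear_map_add[OF tensor_projection_linear] T.submoduleE(4,5)[OF assms(1)]
      linear_map_smult[OF tensor_projection_linear])
  then have sub: "submodule {x \<in> carrier (pair_module K V W). ?p x \<in> N} K
      (free_module K (carrier V \<times> carrier W))"
    by (simp add: pair_module_def)
  have "x \<in> {x \<in> carrier (pair_module K V W). ?p x \<in> N}"
    if "x \<in> carrier (pair_module K V W)" for x
  proof (rule free_module_span[OF V.R.is_cring sub _ that[unfolded pair_module_def]])
    fix s assume "s \<in> carrier V \<times> carrier W"
    then show "basis_vec K s \<in> {x \<in> carrier (pair_module K V W). ?p x \<in> N}"
      using assms(2)[of "fst s" "snd s"] pair_basis_carrier[of "fst s" "snd s"]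
      by (simp add: pure_tensor_def mem_Times_iff)
  qed
  then show ?thesis
    using assms(3) by (auto simp flip: tensor_projection_surj)
qed

lemma tensor_induct [consumes 1, case_names pure add]:
  assumes "X \<in> carrier (tensor_module K V W)"
    and pure: "\<And>v w. v \<in> carrier V \<Longrightarrow> w \<in> carrier W \<Longrightarrow> P (pure_tensor K V W v w)"
    and add: "\<And>X Y. X \<in> carrier (tensor_module K V W) \<Longrightarrow> Y \<in> carrier (tensor_module K V W) \<Longrightarrow>
      P X \<Longrightarrow> P Y \<Longrightarrow> P (X \<oplus>\<^bsub>tensor_module K V W\<^esub> Y)"
  shows "P X"
proof -
  let ?T = "tensor_module K V W"
  interpret T: module K ?T
    by (rule tensor_module)
  \<comment> \<open>Sums of pure tensors are closed under scalars because \<open>c (v \<otimes> w) = (c v) \<otimes> w\<close>.\<close>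
  let ?N = "{X \<in> carrier ?T. \<forall>c\<in>carrier K. P (c \<odot>\<^bsub>?T\<^esub> X)}"
  have sm: "c \<odot>\<^bsub>?T\<^esub> pure_tensor K V W v w = pure_tensor K V W (c \<odot>\<^bsub>V\<^esub> v) w"
    if "c \<in> carrier K" "v \<in> carrier V" "w \<in> carrier W" for c v w
    using linear_map_smult[OF bilinear_mapD(2)[OF pure_tensor_bilinear]] that by simp
  have "P (pure_tensor K V W \<zero>\<^bsub>V\<^esub> \<zero>\<^bsub>W\<^esub>)"
    by (intro pure) simp_all
  then have zero: "P \<zero>\<^bsub>?T\<^esub>"
    using linear_map_zero[OF V.module_axioms tensor_module
        bilinear_mapD(2)[OF pure_tensor_bilinear W.zero_closed]] by simp
  have "submodule ?N K ?T"
  proof (rule T.submoduleI_closed)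
    show "X \<oplus>\<^bsub>?T\<^esub> Y \<in> ?N" if "X \<in> ?N" "Y \<in> ?N" for X Y
      using that by (auto simp: T.smult_r_distr intro!: add)
    show "c \<odot>\<^bsub>?T\<^esub> X \<in> ?N" if "c \<in> carrier K" "X \<in> ?N" for c X
      using that by (auto simp: T.smult_assoc1[symmetric])
  qed (use zero in auto)
  then have "X \<in> ?N"
    by (rule tensor_span[OF _ _ assms(1)]) (simp add: sm pure_tensor_carrier pure)
  then have "P (\<one>\<^bsub>K\<^esub> \<odot>\<^bsub>?T\<^esub> X)"
    by blast
  then show ?thesis
    using assms(1) by simp
qed

context
  fixes T :: "('a, 'd, 'q) module_scheme" and b :: "'b \<Rightarrow> 'c \<Rightarrow> 'd"
  assumes T: "module K T" and b: "bilinear_map K V W T b"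
begin

lemma pair_lin_ext_linear: "linear_map K (pair_module K V W) T (lin_ext K T (\<lambda>(v, w). b v w))"
  unfolding pair_module_def
  using bilinear_mapD(3)[OF b] by (intro lin_ext_linear[OF T]) auto

text \<open>Bilinearity of \<open>b\<close> says exactly that the generators of the tensor relations lie in the kernel of
  the linear extension of \<open>b\<close>.\<close>

lemma pair_lin_ext_relations:
  assumes "x \<in> tensor_relations K V W"
  shows "lin_ext K T (\<lambda>(v, w). b v w) x = \<zero>\<^bsub>T\<^esub>"
proof -
  interpret P: module K "pair_module K V W"
    by (rule pair_module)
  interpret T: module K T
    by (rule T)
  let ?f = "lin_ext K T (\<lambda>(v, w). b v w)"
  have bas: "?f (basis_vec K (v, w)) = b v w" if "v \<in> carrier V" "w \<in> carrier W" for v w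
    using lin_ext_basis_vec[OF T, of "\<lambda>(v, w). b v w" "(v, w)"] bilinear_mapD(3)[OF b] that by simp
  note rules = bas linear_map_minus[OF pair_module T pair_lin_ext_linear] pair_basis_carrier
    linear_map_add[OF pair_lin_ext_linear] linear_map_smult[OF pair_lin_ext_linear]
    T.minus_eq_zero_iff bilinear_mapD(3)[OF b] linear_map_add[OF bilinear_mapD(1)[OF b]]
    linear_map_add[OF bilinear_mapD(2)[OF b]] linear_map_smult[OF bilinear_mapD(1)[OF b]]
    linear_map_smult[OF bilinear_mapD(2)[OF b]] P.minus_closed
  have "tensor_relations K V W \<subseteq> {x \<in> carrier (pair_module K V W). ?f x = \<zero>\<^bsub>T\<^esub>}"
    unfolding tensor_relations_def Let_def
    by (rule submodule_generated_least[OF submodule_kernel[OF pair_module T pair_lin_ext_linear]])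
      (auto simp: rules)
  then show ?thesis
    using assms by blast
qed

lemma tensor_lift_coset:
  "x \<in> carrier (pair_module K V W) \<Longrightarrow>
    tensor_lift K T b (tensor_relations K V W +>\<^bsub>pair_module K V W\<^esub> x) = lin_ext K T (\<lambda>(v, w). b v w) x"
  unfolding tensor_lift_def
  by (rule the_elem_coset[OF pair_module T tensor_relations_submodule pair_lin_ext_linear
        pair_lin_ext_relations])

lemma tensor_lift_pure:
  assumes "v \<in> carrier V" "w \<in> carrier W"
  shows "tensor_lift K T b (pure_tensor K V W v w) = b v w"
  using tensor_lift_coset[OF pair_basis_carrier[OF assms]]
    lin_ext_basis_vec[OF T, of "\<lambda>(v, w). b v w" "(v, w)"] bilinear_mapD(3)[OF b] assms
  by (simp add: pure_tensor_def)

lemma tensor_lift_linear: "linear_map K (tensor_module K V W) T (tensor_lift K T b)"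
  by (rule linear_map_factor[OF pair_module tensor_projection_linear tensor_projection_surj
        pair_lin_ext_linear tensor_lift_coset])

end

end

text \<open>Lifting in two variables keeps linearity in a third.  The product of a tensor algebra and the
  associator are both nested lifts, and this is what allows the outer lift to be taken.\<close>

lemma (in tensor_product) tensor_lift_bilinear:
  assumes "module K Z" "module K T"
    "\<And>z. z \<in> carrier Z \<Longrightarrow> bilinear_map K V W T (\<lambda>v w. b v w z)"
    "\<And>v w. v \<in> carrier V \<Longrightarrow> w \<in> carrier W \<Longrightarrow> linear_map K Z T (\<lambda>z. b v w z)"
  shows "bilinear_map K (tensor_module K V W) Z T (\<lambda>X z. tensor_lift K T (\<lambda>v w. b v w z) X)"
proof -
  have "linear_map K Z T (\<lambda>z. tensor_lift K T (\<lambda>v w. b v w z) X)"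
    if "X \<in> carrier (tensor_module K V W)" for X
    using that
  proof (induction rule: tensor_induct)
    case (pure v w)
    show ?case
      by (rule linear_map_cong[OF _ assms(1) assms(4)[OF pure]])
        (rule tensor_lift_pure[OF assms(2) assms(3) pure])
  next
    case (add X Y)
    show ?case
      by (rule linear_map_cong[OF _ assms(1) linear_map_plus[OF assms(2) add(3,4)]])
        (rule linear_map_add[OF tensor_lift_linear[OF assms(2) assms(3)] add(1,2)])
  qed
  then show ?thesis
    using tensor_lift_linear[OF assms(2) assms(3)] by (simp add: bilinear_map_def)
qed

lemma tensor_map_bilinear:
  assumes "tensor_product K V' W'" "linear_map K V V' f" "linear_map K W W' g"
  shows "bilinear_map K V W (tensor_module K V' W') (\<lambda>v w. pure_tensor K V' W' (f v) (g w))"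
proof -
  interpret T': tensor_product K V' W' by fact
  show ?thesis
    by (rule bilinear_map_comp[OF T'.pure_tensor_bilinear assms(2,3)])
qed

lemma tensor_map_linear:
  assumes "tensor_product K V W" "tensor_product K V' W'" "linear_map K V V' f" "linear_map K W W' g"
  shows "linear_map K (tensor_module K V W) (tensor_module K V' W') (tensor_map K V' W' f g)"
  unfolding tensor_map_def
  by (rule tensor_product.tensor_lift_linear[OF assms(1) tensor_product.tensor_module[OF assms(2)]
        tensor_map_bilinear[OF assms(2-4)]])

lemma tensor_map_pure:
  assumes "tensor_product K V W" "tensor_product K V' W'" "linear_map K V V' f" "linear_map K W W' g"
    "v \<in> carrier V" "w \<in> carrier W"
  shows "tensor_map K V' W' f g (pure_tensor K V W v w) = pure_tensor K V' W' (f v) (g w)"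
  unfolding tensor_map_def
  by (rule tensor_product.tensor_lift_pure[OF assms(1) tensor_product.tensor_module[OF assms(2)]
        tensor_map_bilinear[OF assms(2-4)] assms(5,6)])

section \<open>Tensor products of Hom-algebras\<close>

lemma tensor_alg_simps:
  "carrier (tensor_alg K A B) = carrier (tensor_module K A B)"
  "add (tensor_alg K A B) = add (tensor_module K A B)"
  "smult (tensor_alg K A B) = smult (tensor_module K A B)"
  "zero (tensor_alg K A B) = zero (tensor_module K A B)"
  "one (tensor_alg K A B) = pure_tensor K A B \<one>\<^bsub>A\<^esub> \<one>\<^bsub>B\<^esub>"
  "twist (tensor_alg K A B) = tensor_map K A B \<alpha>\<^bsub>A\<^esub> \<alpha>\<^bsub>B\<^esub>"
  by (simp_all add: tensor_alg_def Let_def)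

lemma linear_map_tensor_alg:
  "linear_map K (tensor_alg K A B) W = linear_map K (tensor_module K A B) W"
  "linear_map K V (tensor_alg K A B) = linear_map K V (tensor_module K A B)"
  by (simp_all add: linear_map_def tensor_alg_simps fun_eq_iff)

text \<open>The tensor constructions read only the carrier, the addition and the scalar multiplication, so an
  iterated tensor product may be formed from the algebra or from its underlying module.\<close>

lemma tensor_module_tensor_alg:
  "tensor_module K (tensor_alg K A B) W = tensor_module K (tensor_module K A B) W"
  "tensor_module K V (tensor_alg K A B) = tensor_module K V (tensor_module K A B)"
  "pure_tensor K (tensor_alg K A B) W = pure_tensor K (tensor_module K A B) W"
  "pure_tensor K V (tensor_alg K A B) = pure_tensor K V (tensor_module K A B)"
  by (simp_all add: tensor_module_def pure_tensor_def pair_module_def tensor_relations_def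
      tensor_alg_simps fun_eq_iff)

lemma tensor_product_hom_algs:
  assumes "hom_nonassoc_alg K A" "hom_nonassoc_alg K B"
  shows "tensor_product K A B"
  using assms by (simp add: tensor_product_def hom_nonassoc_alg_def hom_module_def)

lemma tensor_alg_module:
  assumes "tensor_product K A B"
  shows "module K (tensor_alg K A B)"
  by (rule module_cong[OF tensor_product.tensor_module[OF assms]]) (simp_all add: tensor_alg_simps)

context
  fixes K :: "('a, 'm) ring_scheme" and A :: "('a, 'b, 'n) hom_module_scheme"
    and B :: "('a, 'c, 'p) hom_module_scheme"
  assumes A: "hom_nonassoc_alg K A" and B: "hom_nonassoc_alg K B"
begin

interpretation A: hom_nonassoc_alg K A by (rule A)
interpretation B: hom_nonassoc_alg K B by (rule B)
interpretation T: tensor_product K A B by (rule tensor_product_hom_algs[OF A B])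

private abbreviation (input) m where
  "m x x' y y' \<equiv> pure_tensor K A B (x \<otimes>\<^bsub>A\<^esub> y) (x' \<otimes>\<^bsub>B\<^esub> y')"

private lemma factor_mult_bilinear:
  assumes "x \<in> carrier A" "x' \<in> carrier B"
  shows "bilinear_map K A B (tensor_module K A B) (m x x')"
  by (rule bilinear_map_comp[OF T.pure_tensor_bilinear A.mult_linear_right[OF assms(1)]
        B.mult_linear_right[OF assms(2)]])

text \<open>Here \<open>Y\<close> is fixed and \<open>x \<otimes> x'\<close> varies: linearity in \<open>x\<close> is obtained by treating \<open>x\<close> as the third
  variable of the lift over \<open>Y\<close>, and likewise for \<open>x'\<close>.\<close>

private lemma partial_mult_bilinear:
  assumes "Y \<in> carrier (tensor_module K A B)"
  shows "bilinear_map K A B (tensor_module K A B)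
    (\<lambda>x x'. tensor_lift K (tensor_module K A B) (m x x') Y)"
proof -
  have "bilinear_map K (tensor_module K A B) A (tensor_module K A B)
      (\<lambda>Y x. tensor_lift K (tensor_module K A B) (m x x') Y)" if "x' \<in> carrier B" for x'
  proof (rule T.tensor_lift_bilinear[OF A.module_axioms T.tensor_module])
    fix y y' assume "y \<in> carrier A" "y' \<in> carrier B"
    then show "linear_map K A (tensor_module K A B) (\<lambda>x. m x x' y y')"
      using linear_map_comp[OF A.mult_linear_left bilinear_mapD(2)[OF T.pure_tensor_bilinear]]
        B.mult_closed that by simp
  qed (use that factor_mult_bilinear in simp)
  moreover have "bilinear_map K (tensor_module K A B) B (tensor_module K A B)
      (\<lambda>Y x'. tensor_lift K (tensor_module K A B) (m x x') Y)" if "x \<in> carrier A" for x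
  proof (rule T.tensor_lift_bilinear[OF B.module_axioms T.tensor_module])
    fix y y' assume "y \<in> carrier A" "y' \<in> carrier B"
    then show "linear_map K B (tensor_module K A B) (\<lambda>x'. m x x' y y')"
      using linear_map_comp[OF B.mult_linear_left bilinear_mapD(1)[OF T.pure_tensor_bilinear]]
        A.mult_closed that by simp
  qed (use that factor_mult_bilinear in simp)
  ultimately show ?thesis
    using assms by (simp add: bilinear_map_def)
qed

private lemma tensor_alg_mult_bilinear:
  "bilinear_map K (tensor_module K A B) (tensor_module K A B) (tensor_module K A B)
    (\<lambda>X Y. X \<otimes>\<^bsub>tensor_alg K A B\<^esub> Y)"
proof -
  have "bilinear_map K (tensor_module K A B) (tensor_module K A B) (tensor_module K A B)
      (\<lambda>X Y. tensor_lift K (tensor_module K A B)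
        (\<lambda>x x'. tensor_lift K (tensor_module K A B) (m x x') Y) X)"
    by (rule T.tensor_lift_bilinear[OF T.tensor_module T.tensor_module partial_mult_bilinear
          T.tensor_lift_linear[OF T.tensor_module factor_mult_bilinear]])
  then show ?thesis
    by (simp add: tensor_alg_def Let_def)
qed

lemma tensor_alg_mult_pure:
  assumes "x \<in> carrier A" "x' \<in> carrier B" "y \<in> carrier A" "y' \<in> carrier B"
  shows "pure_tensor K A B x x' \<otimes>\<^bsub>tensor_alg K A B\<^esub> pure_tensor K A B y y'
    = pure_tensor K A B (x \<otimes>\<^bsub>A\<^esub> y) (x' \<otimes>\<^bsub>B\<^esub> y')"
  using assms
  by (simp add: tensor_alg_def Let_def T.tensor_lift_pure[OF T.tensor_module partial_mult_bilinear]
      T.tensor_lift_pure[OF T.tensor_module factor_mult_bilinear] T.pure_tensor_carrier)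

lemma tensor_alg_twist_pure:
  assumes "x \<in> carrier A" "x' \<in> carrier B"
  shows "\<alpha>\<^bsub>tensor_alg K A B\<^esub> (pure_tensor K A B x x') = pure_tensor K A B (\<alpha>\<^bsub>A\<^esub> x) (\<alpha>\<^bsub>B\<^esub> x')"
  unfolding tensor_alg_simps
  by (rule tensor_map_pure[OF T.tensor_product_axioms T.tensor_product_axioms A.twist_linear
        B.twist_linear assms])

lemma pure_tensor_alg_carrier:
  "x \<in> carrier A \<Longrightarrow> x' \<in> carrier B \<Longrightarrow> pure_tensor K A B x x' \<in> carrier (tensor_alg K A B)"
  by (simp add: tensor_alg_simps T.pure_tensor_carrier)

lemma tensor_alg_pure_add_left:
  "\<lbrakk>x \<in> carrier A; y \<in> carrier A; z \<in> carrier B\<rbrakk> \<Longrightarrow> pure_tensor K A B (x \<oplus>\<^bsub>A\<^esub> y) z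
    = pure_tensor K A B x z \<oplus>\<^bsub>tensor_alg K A B\<^esub> pure_tensor K A B y z"
  using linear_map_add[OF bilinear_mapD(2)[OF T.pure_tensor_bilinear]]
  by (simp add: tensor_alg_simps)

lemma tensor_alg_pure_add_right:
  "\<lbrakk>x \<in> carrier A; y \<in> carrier B; z \<in> carrier B\<rbrakk> \<Longrightarrow> pure_tensor K A B x (y \<oplus>\<^bsub>B\<^esub> z)
    = pure_tensor K A B x y \<oplus>\<^bsub>tensor_alg K A B\<^esub> pure_tensor K A B x z"
  using linear_map_add[OF bilinear_mapD(1)[OF T.pure_tensor_bilinear]]
  by (simp add: tensor_alg_simps)

lemma tensor_alg_hom_nonassoc: "hom_nonassoc_alg K (tensor_alg K A B)"
proof -
  interpret AB: module K "tensor_alg K A B"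
    by (rule tensor_alg_module[OF T.tensor_product_axioms])
  note lin = bilinear_mapD[OF tensor_alg_mult_bilinear]
  show ?thesis
  proof
    show "linear_map K (tensor_alg K A B) (tensor_alg K A B) \<alpha>\<^bsub>tensor_alg K A B\<^esub>"
      unfolding linear_map_tensor_alg unfolding tensor_alg_simps
      by (rule tensor_map_linear[OF T.tensor_product_axioms T.tensor_product_axioms A.twist_linear
            B.twist_linear])
  qed (use lin(3) linear_map_add[OF lin(1)] linear_map_add[OF lin(2)] linear_map_smult[OF lin(1)]
      linear_map_smult[OF lin(2)] in \<open>simp_all add: tensor_alg_simps\<close>)
qed

lemma tensor_alg_induct [consumes 1, case_names pure add]:
  assumes "X \<in> carrier (tensor_alg K A B)"
    and "\<And>x y. x \<in> carrier A \<Longrightarrow> y \<in> carrier B \<Longrightarrow> P (pure_tensor K A B x y)"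
    and "\<And>X Y. X \<in> carrier (tensor_alg K A B) \<Longrightarrow> Y \<in> carrier (tensor_alg K A B) \<Longrightarrow>
      P X \<Longrightarrow> P Y \<Longrightarrow> P (X \<oplus>\<^bsub>tensor_alg K A B\<^esub> Y)"
  shows "P X"
  using assms unfolding tensor_alg_simps by (rule T.tensor_induct)

end

text \<open>The axioms of unital and of multiplicative Hom-associative algebras are multilinear, so on a tensor
  product they need only be checked on pure tensors, where they hold in each factor.\<close>

lemma tensor_alg_unital:
  assumes "unital_hom_nonassoc_alg K A" "unital_hom_nonassoc_alg K B"
  shows "unital_hom_nonassoc_alg K (tensor_alg K A B)"
proof -
  interpret A: unital_hom_nonassoc_alg K A by fact
  interpret B: unital_hom_nonassoc_alg K B by fact
  note AB = A.hom_nonassoc_alg_axioms B.hom_nonassoc_alg_axioms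
  interpret T: hom_nonassoc_alg K "tensor_alg K A B"
    by (rule tensor_alg_hom_nonassoc[OF AB])
  show ?thesis
  proof
    show one: "\<one>\<^bsub>tensor_alg K A B\<^esub> \<in> carrier (tensor_alg K A B)"
      unfolding tensor_alg_simps(5)
      by (rule pure_tensor_alg_carrier[OF AB A.unit_closed B.unit_closed])
    fix X assume X: "X \<in> carrier (tensor_alg K A B)"
    show "\<one>\<^bsub>tensor_alg K A B\<^esub> \<otimes>\<^bsub>tensor_alg K A B\<^esub> X = X"
      using X
    proof (induction rule: tensor_alg_induct[OF AB, consumes 1, case_names pure add])
      case (pure x y)
      then show ?case
        by (simp add: tensor_alg_simps(5) tensor_alg_mult_pure[OF AB] A.unit_closed B.unit_closed
            A.unit_left B.unit_left)
    next
      case (add X Y)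
      then show ?case
        by (simp add: T.mult_add_right one)
    qed
    show "X \<otimes>\<^bsub>tensor_alg K A B\<^esub> \<one>\<^bsub>tensor_alg K A B\<^esub> = X"
      using X
    proof (induction rule: tensor_alg_induct[OF AB, consumes 1, case_names pure add])
      case (pure x y)
      then show ?case
        by (simp add: tensor_alg_simps(5) tensor_alg_mult_pure[OF AB] A.unit_closed B.unit_closed
            A.unit_right B.unit_right)
    next
      case (add X Y)
      then show ?case
        by (simp add: T.mult_add_left one)
    qed
  qed
qed

lemma tensor_alg_mult_hom_assoc:
  assumes "mult_hom_assoc_alg K A" "mult_hom_assoc_alg K B"
  shows "mult_hom_assoc_alg K (tensor_alg K A B)"
proof -
  interpret A: mult_hom_assoc_alg K A by fact
  interpret B: mult_hom_assoc_alg K B by fact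
  note AB = A.hom_nonassoc_alg_axioms B.hom_nonassoc_alg_axioms
  let ?T = "tensor_alg K A B"
  interpret T: hom_nonassoc_alg K ?T
    by (rule tensor_alg_hom_nonassoc[OF AB])
  note induct = tensor_alg_induct[OF AB, consumes 1, case_names pure add]
  note T = T.mult_closed T.twist_closed T.twist_add T.mult_add_left T.mult_add_right
  note pure = pure_tensor_alg_carrier[OF AB] tensor_alg_mult_pure[OF AB]
    tensor_alg_twist_pure[OF AB] A.mult_closed A.twist_closed B.mult_closed B.twist_closed
    A.hom_assoc B.hom_assoc A.multiplicative B.multiplicative
  show ?thesis
  proof
    fix X Y Z assume X: "X \<in> carrier ?T" and Y: "Y \<in> carrier ?T" and Z: "Z \<in> carrier ?T"
    have 1: "(pure_tensor K A B x x' \<otimes>\<^bsub>?T\<^esub> pure_tensor K A B y y') \<otimes>\<^bsub>?T\<^esub> \<alpha>\<^bsub>?T\<^esub> Z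
        = \<alpha>\<^bsub>?T\<^esub> (pure_tensor K A B x x') \<otimes>\<^bsub>?T\<^esub> (pure_tensor K A B y y' \<otimes>\<^bsub>?T\<^esub> Z)"
      if "x \<in> carrier A" "x' \<in> carrier B" "y \<in> carrier A" "y' \<in> carrier B" for x x' y y'
      using Z by (induction rule: induct) (use that in \<open>simp_all add: T pure\<close>)
    have 2: "(pure_tensor K A B x x' \<otimes>\<^bsub>?T\<^esub> Y) \<otimes>\<^bsub>?T\<^esub> \<alpha>\<^bsub>?T\<^esub> Z
        = \<alpha>\<^bsub>?T\<^esub> (pure_tensor K A B x x') \<otimes>\<^bsub>?T\<^esub> (Y \<otimes>\<^bsub>?T\<^esub> Z)"
      if "x \<in> carrier A" "x' \<in> carrier B" for x x'
      using Y
    proof (induction rule: induct)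
      case (pure y y')
      then show ?case using 1 that by blast
    qed (use that Z in \<open>simp_all add: T pure_tensor_alg_carrier[OF AB]\<close>)
    show "(X \<otimes>\<^bsub>?T\<^esub> Y) \<otimes>\<^bsub>?T\<^esub> \<alpha>\<^bsub>?T\<^esub> Z = \<alpha>\<^bsub>?T\<^esub> X \<otimes>\<^bsub>?T\<^esub> (Y \<otimes>\<^bsub>?T\<^esub> Z)"
      using X
    proof (induction rule: induct)
      case (pure x x')
      then show ?case using 2 by blast
    qed (use Y Z in \<open>simp_all add: T\<close>)
  next
    fix X Y assume X: "X \<in> carrier ?T" and Y: "Y \<in> carrier ?T"
    have 1: "\<alpha>\<^bsub>?T\<^esub> (pure_tensor K A B x x' \<otimes>\<^bsub>?T\<^esub> Y) = \<alpha>\<^bsub>?T\<^esub> (pure_tensor K A B x x') \<otimes>\<^bsub>?T\<^esub> \<alpha>\<^bsub>?T\<^esub> Y"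
      if "x \<in> carrier A" "x' \<in> carrier B" for x x'
      using Y by (induction rule: induct) (use that in \<open>simp_all add: T pure\<close>)
    show "\<alpha>\<^bsub>?T\<^esub> (X \<otimes>\<^bsub>?T\<^esub> Y) = \<alpha>\<^bsub>?T\<^esub> X \<otimes>\<^bsub>?T\<^esub> \<alpha>\<^bsub>?T\<^esub> Y"
      using X
    proof (induction rule: induct)
      case (pure x x')
      then show ?case using 1 by blast
    qed (use Y in \<open>simp_all add: T\<close>)
  qed
qed

lemma tensor_alg_twist_one:
  assumes "unital_hom_nonassoc_alg K A" "unital_hom_nonassoc_alg K B"
    "\<alpha>\<^bsub>A\<^esub> \<one>\<^bsub>A\<^esub> = \<one>\<^bsub>A\<^esub>" "\<alpha>\<^bsub>B\<^esub> \<one>\<^bsub>B\<^esub> = \<one>\<^bsub>B\<^esub>"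
  shows "\<alpha>\<^bsub>tensor_alg K A B\<^esub> \<one>\<^bsub>tensor_alg K A B\<^esub> = \<one>\<^bsub>tensor_alg K A B\<^esub>"
proof -
  interpret A: unital_hom_nonassoc_alg K A by fact
  interpret B: unital_hom_nonassoc_alg K B by fact
  show ?thesis
    unfolding tensor_alg_simps(5)
    by (simp add: tensor_alg_twist_pure[OF A.hom_nonassoc_alg_axioms B.hom_nonassoc_alg_axioms]
        A.unit_closed B.unit_closed assms(3,4))
qed

lemma tensor_map_morphism:
  assumes "hom_nonassoc_alg K A" "hom_nonassoc_alg K B" "hom_nonassoc_alg K A'" "hom_nonassoc_alg K B'"
    "hom_alg_morphism K A A' f" "hom_alg_morphism K B B' g"
  shows "hom_alg_morphism K (tensor_alg K A B) (tensor_alg K A' B') (tensor_map K A' B' f g)"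
proof -
  interpret A: hom_nonassoc_alg K A by fact
  interpret B: hom_nonassoc_alg K B by fact
  let ?T = "tensor_alg K A B" and ?T' = "tensor_alg K A' B'" and ?h = "tensor_map K A' B' f g"
  interpret T: hom_nonassoc_alg K ?T
    by (rule tensor_alg_hom_nonassoc[OF assms(1,2)])
  interpret T': hom_nonassoc_alg K ?T'
    by (rule tensor_alg_hom_nonassoc[OF assms(3,4)])
  note induct = tensor_alg_induct[OF assms(1,2), consumes 1, case_names pure add]
  note tp = tensor_product_hom_algs[OF assms(1,2)] tensor_product_hom_algs[OF assms(3,4)]
    morphism_linear[OF assms(5)] morphism_linear[OF assms(6)]
  have lin: "linear_map K ?T ?T' ?h"
    unfolding linear_map_tensor_alg by (rule tensor_map_linear[OF tp])
  note pure = pure_tensor_alg_carrier[OF assms(1,2)] tensor_alg_mult_pure[OF assms(1,2)]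
    tensor_alg_twist_pure[OF assms(1,2)] pure_tensor_alg_carrier[OF assms(3,4)]
    tensor_alg_mult_pure[OF assms(3,4)] tensor_alg_twist_pure[OF assms(3,4)] tensor_map_pure[OF tp]
    A.mult_closed B.mult_closed A.twist_closed B.twist_closed
    morphism_mult[OF assms(5)] morphism_mult[OF assms(6)] morphism_closed[OF assms(5)]
    morphism_closed[OF assms(6)] morphism_twist[OF assms(5)] morphism_twist[OF assms(6)]
  note T = T.mult_closed T.twist_closed T.twist_add T.mult_add_left T.mult_add_right
    T'.mult_closed T'.twist_closed T'.twist_add T'.mult_add_left T'.mult_add_right
    linear_map_add[OF lin] linear_map_closed[OF lin]
  have 1: "?h (pure_tensor K A B x x' \<otimes>\<^bsub>?T\<^esub> Y) = ?h (pure_tensor K A B x x') \<otimes>\<^bsub>?T'\<^esub> ?h Y"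
    if "Y \<in> carrier ?T" "x \<in> carrier A" "x' \<in> carrier B" for x x' Y
    using that(1) by (induction rule: induct) (use that in \<open>simp_all add: T pure\<close>)
  have "?h (X \<otimes>\<^bsub>?T\<^esub> Y) = ?h X \<otimes>\<^bsub>?T'\<^esub> ?h Y" if "X \<in> carrier ?T" "Y \<in> carrier ?T" for X Y
    using that(1)
  proof (induction rule: induct)
    case (pure x x')
    then show ?case using 1 that(2) by blast
  qed (use that(2) in \<open>simp_all add: T\<close>)
  moreover have "?h (\<alpha>\<^bsub>?T\<^esub> X) = \<alpha>\<^bsub>?T'\<^esub> (?h X)" if "X \<in> carrier ?T" for X
    using that by (induction rule: induct) (simp_all add: T pure)
  ultimately show ?thesis
    using lin by (simp add: hom_alg_morphism_def)
qed

lemma tensor_assoc_linear_pure: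
  assumes "module K U" "module K V" "module K W"
  shows "linear_map K (tensor_module K (tensor_module K U V) W)
      (tensor_module K U (tensor_module K V W)) (tensor_assoc K U V W)" (is "linear_map K ?S ?T _")
    and "\<lbrakk>u \<in> carrier U; v \<in> carrier V; w \<in> carrier W\<rbrakk> \<Longrightarrow>
      tensor_assoc K U V W (pure_tensor K (tensor_module K U V) W (pure_tensor K U V u v) w)
        = pure_tensor K U (tensor_module K V W) u (pure_tensor K V W v w)"
proof -
  interpret UV: tensor_product K U V
    using assms by (simp add: tensor_product_def)
  interpret VW: tensor_product K V W
    using assms by (simp add: tensor_product_def)
  interpret S: tensor_product K "tensor_module K U V" W
    using assms UV.tensor_module by (simp add: tensor_product_def)
  interpret T: tensor_product K U "tensor_module K V W"
    using assms VW.tensor_module by (simp add: tensor_product_def)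
  let ?b = "\<lambda>w u v. pure_tensor K U (tensor_module K V W) u (pure_tensor K V W v w)"
  have 1: "bilinear_map K U V ?T (?b w)" if "w \<in> carrier W" for w
  proof -
    have "linear_map K U U (\<lambda>u. u)"
      by (simp add: linear_map_def)
    from bilinear_map_comp[OF T.pure_tensor_bilinear this
        bilinear_mapD(2)[OF VW.pure_tensor_bilinear that]]
    show ?thesis .
  qed
  have 2: "linear_map K W ?T (\<lambda>w. ?b w u v)" if "u \<in> carrier U" "v \<in> carrier V" for u v
    by (rule linear_map_comp[OF bilinear_mapD(1)[OF VW.pure_tensor_bilinear that(2)]
          bilinear_mapD(1)[OF T.pure_tensor_bilinear that(1)]])
  have 3: "bilinear_map K (tensor_module K U V) W ?T (\<lambda>X w. tensor_lift K ?T (?b w) X)"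
    by (rule UV.tensor_lift_bilinear[OF assms(3) T.tensor_module 1 2])
  show "linear_map K ?S ?T (tensor_assoc K U V W)"
    unfolding tensor_assoc_def Let_def by (rule S.tensor_lift_linear[OF T.tensor_module 3])
  show "tensor_assoc K U V W (pure_tensor K (tensor_module K U V) W (pure_tensor K U V u v) w)
      = ?b w u v" if "u \<in> carrier U" "v \<in> carrier V" "w \<in> carrier W"
    unfolding tensor_assoc_def Let_def
    using S.tensor_lift_pure[OF T.tensor_module 3 UV.pure_tensor_carrier[OF that(1,2)] that(3)]
      UV.tensor_lift_pure[OF T.tensor_module 1[OF that(3)] that(1,2)] by simp
qed

lemma tensor_assoc_morphism:
  assumes "hom_nonassoc_alg K A" "hom_nonassoc_alg K B" "hom_nonassoc_alg K C"
  shows "hom_alg_morphism K (tensor_alg K (tensor_alg K A B) C) (tensor_alg K A (tensor_alg K B C))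
      (tensor_assoc K A B C)" (is "hom_alg_morphism K ?S ?T ?h")
    and "\<lbrakk>a \<in> carrier A; b \<in> carrier B; c \<in> carrier C\<rbrakk> \<Longrightarrow>
      tensor_assoc K A B C (pure_tensor K (tensor_alg K A B) C (pure_tensor K A B a b) c)
        = pure_tensor K A (tensor_alg K B C) a (pure_tensor K B C b c)"
proof -
  interpret A: hom_nonassoc_alg K A by fact
  interpret B: hom_nonassoc_alg K B by fact
  interpret C: hom_nonassoc_alg K C by fact
  note AB = tensor_alg_hom_nonassoc[OF assms(1,2)] and BC = tensor_alg_hom_nonassoc[OF assms(2,3)]
  interpret AB: hom_nonassoc_alg K "tensor_alg K A B" by (rule AB)
  interpret BC: hom_nonassoc_alg K "tensor_alg K B C" by (rule BC)
  interpret S: hom_nonassoc_alg K ?S by (rule tensor_alg_hom_nonassoc[OF AB assms(3)])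
  interpret T: hom_nonassoc_alg K ?T by (rule tensor_alg_hom_nonassoc[OF assms(1) BC])
  have lin: "linear_map K ?S ?T ?h"
    unfolding linear_map_tensor_alg tensor_module_tensor_alg
    by (rule tensor_assoc_linear_pure(1)[OF A.module_axioms B.module_axioms C.module_axioms])
  show h: "?h (pure_tensor K (tensor_alg K A B) C (pure_tensor K A B a b) c)
      = pure_tensor K A (tensor_alg K B C) a (pure_tensor K B C b c)"
    if "a \<in> carrier A" "b \<in> carrier B" "c \<in> carrier C" for a b c
    unfolding tensor_module_tensor_alg
    by (rule tensor_assoc_linear_pure(2)[OF A.module_axioms B.module_axioms C.module_axioms that])
  let ?p = "\<lambda>a b c. pure_tensor K (tensor_alg K A B) C (pure_tensor K A B a b) c"
  \<comment> \<open>Additivity of \<open>Z \<mapsto> Z \<otimes> c\<close> turns induction over sums twice into induction from triple pure tensors.\<close>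
  have induct: "P X" if "X \<in> carrier ?S"
    and pure: "\<And>a b c. a \<in> carrier A \<Longrightarrow> b \<in> carrier B \<Longrightarrow> c \<in> carrier C \<Longrightarrow> P (?p a b c)"
    and add: "\<And>X Y. X \<in> carrier ?S \<Longrightarrow> Y \<in> carrier ?S \<Longrightarrow> P X \<Longrightarrow> P Y \<Longrightarrow> P (X \<oplus>\<^bsub>?S\<^esub> Y)" for P X
    using that(1)
  proof (induction rule: tensor_alg_induct[OF AB assms(3), consumes 1, case_names pure add])
    case (pure Z c)
    from pure(1) show ?case
    proof (induction rule: tensor_alg_induct[OF assms(1,2), consumes 1, case_names pure add])
      case (pure a b)
      then show ?case using that(2) \<open>c \<in> carrier C\<close> by blast
    next
      case (add Z Z')
      then show ?case
        using \<open>c \<in> carrier C\<close>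
        by (simp add: tensor_alg_pure_add_left[OF AB assms(3)] that(3)
            pure_tensor_alg_carrier[OF AB assms(3)])
    qed
  qed (use that(3) in blast)
  note pure = pure_tensor_alg_carrier[OF assms(1,2)] tensor_alg_mult_pure[OF assms(1,2)]
    tensor_alg_twist_pure[OF assms(1,2)] pure_tensor_alg_carrier[OF assms(2,3)]
    tensor_alg_mult_pure[OF assms(2,3)] tensor_alg_twist_pure[OF assms(2,3)]
    pure_tensor_alg_carrier[OF AB assms(3)] tensor_alg_mult_pure[OF AB assms(3)]
    tensor_alg_twist_pure[OF AB assms(3)] pure_tensor_alg_carrier[OF assms(1) BC]
    tensor_alg_mult_pure[OF assms(1) BC] tensor_alg_twist_pure[OF assms(1) BC]
    A.mult_closed B.mult_closed C.mult_closed A.twist_closed B.twist_closed C.twist_closed h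
  note ST = S.mult_closed S.twist_closed S.twist_add S.mult_add_left S.mult_add_right
    T.mult_closed T.twist_closed T.twist_add T.mult_add_left T.mult_add_right
    linear_map_add[OF lin] linear_map_closed[OF lin]
  have 1: "?h (?p a b c \<otimes>\<^bsub>?S\<^esub> Y) = ?h (?p a b c) \<otimes>\<^bsub>?T\<^esub> ?h Y"
    if "Y \<in> carrier ?S" "a \<in> carrier A" "b \<in> carrier B" "c \<in> carrier C" for a b c Y
    using that(1) by (rule induct) (use that in \<open>simp_all add: ST pure\<close>)
  have "?h (X \<otimes>\<^bsub>?S\<^esub> Y) = ?h X \<otimes>\<^bsub>?T\<^esub> ?h Y" if "X \<in> carrier ?S" "Y \<in> carrier ?S" for X Y
    using that(1) by (rule induct) (use that(2) 1 in \<open>simp_all add: ST\<close>)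
  moreover have "?h (\<alpha>\<^bsub>?S\<^esub> X) = \<alpha>\<^bsub>?T\<^esub> (?h X)" if "X \<in> carrier ?S" for X
    using that by (rule induct) (simp_all add: ST pure)
  ultimately show "hom_alg_morphism K ?S ?T ?h"
    using lin by (simp add: hom_alg_morphism_def)
qed

section \<open>The free Hom-nonassociative algebra\<close>

abbreviation terms :: "('a, 'b, 'n) hom_module_scheme \<Rightarrow> 'b hna_term set"
  where "terms W \<equiv> {t. gens t \<subseteq> carrier W}"

lemma term_alg_simps:
  "carrier (term_alg K W) = carrier (free_module K (terms W))"
  "add (term_alg K W) = add (free_module K (terms W))"
  "smult (term_alg K W) = smult (free_module K (terms W))"
  "zero (term_alg K W) = zero (free_module K (terms W))"
  by (simp_all add: term_alg_def Let_def)

lemma term_alg_mult: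
  "\<phi> \<otimes>\<^bsub>term_alg K W\<^esub> \<psi> = (\<lambda>t. case t of Prod u v \<Rightarrow> \<phi> u \<otimes>\<^bsub>K\<^esub> \<psi> v | _ \<Rightarrow> \<zero>\<^bsub>K\<^esub>)"
  by (simp add: term_alg_def Let_def)

lemma term_alg_twist:
  "\<alpha>\<^bsub>term_alg K W\<^esub> \<phi> = (\<lambda>t. case t of Twist u \<Rightarrow> \<phi> u | _ \<Rightarrow> \<zero>\<^bsub>K\<^esub>)"
  by (simp add: term_alg_def Let_def)

lemma linear_map_term_alg:
  "linear_map K (term_alg K W) T f = linear_map K (free_module K (terms W)) T f"
  by (simp add: linear_map_def term_alg_simps)

lemma term_alg_hom_nonassoc:
  assumes "cring K"
  shows "hom_nonassoc_alg K (term_alg K W)"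
proof -
  interpret K: cring K by fact
  let ?T = "term_alg K W"
  interpret T: module K ?T
    by (rule module_cong[OF free_module_module[OF assms]]) (simp_all add: term_alg_simps)
  have carrierI: "\<phi> \<in> carrier ?T"
    if "\<And>t. \<phi> t \<in> carrier K" "\<And>t. t \<notin> terms W \<Longrightarrow> \<phi> t = \<zero>\<^bsub>K\<^esub>" "finite {t. \<phi> t \<noteq> \<zero>\<^bsub>K\<^esub>}" for \<phi>
    using that by (simp add: term_alg_simps free_module_def)
  have carrierD: "\<phi> t \<in> carrier K" "t \<notin> terms W \<Longrightarrow> \<phi> t = \<zero>\<^bsub>K\<^esub>" "finite {t. \<phi> t \<noteq> \<zero>\<^bsub>K\<^esub>}"
    if "\<phi> \<in> carrier ?T" for \<phi> t
    using that by (simp_all add: term_alg_simps free_module_def)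
  have ops: "(\<phi> \<oplus>\<^bsub>?T\<^esub> \<psi>) t = \<phi> t \<oplus>\<^bsub>K\<^esub> \<psi> t" "(c \<odot>\<^bsub>?T\<^esub> \<phi>) t = c \<otimes>\<^bsub>K\<^esub> \<phi> t" for \<phi> \<psi> c t
    by (simp_all add: term_alg_simps free_module_def)
  have mult: "\<phi> \<otimes>\<^bsub>?T\<^esub> \<psi> \<in> carrier ?T" if \<phi>: "\<phi> \<in> carrier ?T" and \<psi>: "\<psi> \<in> carrier ?T" for \<phi> \<psi>
  proof (rule carrierI)
    fix t
    show "(\<phi> \<otimes>\<^bsub>?T\<^esub> \<psi>) t \<in> carrier K"
      using carrierD(1)[OF \<phi>] carrierD(1)[OF \<psi>] by (simp add: term_alg_mult split: hna_term.split)
    show "(\<phi> \<otimes>\<^bsub>?T\<^esub> \<psi>) t = \<zero>\<^bsub>K\<^esub>" if "t \<notin> terms W"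
    proof (cases t)
      case (Prod u v)
      then have "\<phi> u = \<zero>\<^bsub>K\<^esub> \<or> \<psi> v = \<zero>\<^bsub>K\<^esub>"
        using that carrierD(2)[OF \<phi>, of u] carrierD(2)[OF \<psi>, of v] by auto
      then show ?thesis
        using Prod carrierD(1)[OF \<phi>] carrierD(1)[OF \<psi>] by (auto simp: term_alg_mult)
    qed (simp_all add: term_alg_mult)
  next
    have "{t. (\<phi> \<otimes>\<^bsub>?T\<^esub> \<psi>) t \<noteq> \<zero>\<^bsub>K\<^esub>}
        \<subseteq> (\<lambda>(u, v). Prod u v) ` ({t. \<phi> t \<noteq> \<zero>\<^bsub>K\<^esub>} \<times> {t. \<psi> t \<noteq> \<zero>\<^bsub>K\<^esub>})"
    proof
      fix t assume "t \<in> {t. (\<phi> \<otimes>\<^bsub>?T\<^esub> \<psi>) t \<noteq> \<zero>\<^bsub>K\<^esub>}"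
      then obtain u v where "t = Prod u v" "\<phi> u \<otimes>\<^bsub>K\<^esub> \<psi> v \<noteq> \<zero>\<^bsub>K\<^esub>"
        by (cases t) (auto simp: term_alg_mult)
      then show "t \<in> (\<lambda>(u, v). Prod u v) ` ({t. \<phi> t \<noteq> \<zero>\<^bsub>K\<^esub>} \<times> {t. \<psi> t \<noteq> \<zero>\<^bsub>K\<^esub>})"
        using carrierD(1)[OF \<phi>, of u] carrierD(1)[OF \<psi>, of v] by force
    qed
    then show "finite {t. (\<phi> \<otimes>\<^bsub>?T\<^esub> \<psi>) t \<noteq> \<zero>\<^bsub>K\<^esub>}"
      by (rule finite_subset) (simp add: carrierD(3)[OF \<phi>] carrierD(3)[OF \<psi>])
  qed
  have twist: "\<alpha>\<^bsub>?T\<^esub> \<phi> \<in> carrier ?T" if \<phi>: "\<phi> \<in> carrier ?T" for \<phi>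
  proof (rule carrierI)
    fix t
    show "\<alpha>\<^bsub>?T\<^esub> \<phi> t \<in> carrier K"
      using carrierD(1)[OF \<phi>] by (simp add: term_alg_twist split: hna_term.split)
    show "\<alpha>\<^bsub>?T\<^esub> \<phi> t = \<zero>\<^bsub>K\<^esub>" if "t \<notin> terms W"
      using that carrierD(2)[OF \<phi>] by (cases t) (auto simp: term_alg_twist)
  next
    have "{t. \<alpha>\<^bsub>?T\<^esub> \<phi> t \<noteq> \<zero>\<^bsub>K\<^esub>} \<subseteq> Twist ` {t. \<phi> t \<noteq> \<zero>\<^bsub>K\<^esub>}"
    proof
      fix t assume "t \<in> {t. \<alpha>\<^bsub>?T\<^esub> \<phi> t \<noteq> \<zero>\<^bsub>K\<^esub>}"
      then show "t \<in> Twist ` {t. \<phi> t \<noteq> \<zero>\<^bsub>K\<^esub>}"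
        by (cases t) (auto simp: term_alg_twist)
    qed
    then show "finite {t. \<alpha>\<^bsub>?T\<^esub> \<phi> t \<noteq> \<zero>\<^bsub>K\<^esub>}"
      by (rule finite_subset) (simp add: carrierD(3)[OF \<phi>])
  qed
  show ?thesis
  proof
    show "linear_map K ?T ?T \<alpha>\<^bsub>?T\<^esub>"
      unfolding linear_map_def
      by (auto simp: twist intro!: ext)
        (auto simp: term_alg_twist ops split: hna_term.split)
  qed (auto simp: mult intro!: ext,
      auto simp: term_alg_mult ops carrierD(1) K.l_distr K.r_distr K.m_assoc K.m_lcomm
        split: hna_term.split)
qed

lemma term_alg_basis:
  assumes "cring K"
  shows "basis_vec K u \<otimes>\<^bsub>term_alg K W\<^esub> basis_vec K v = basis_vec K (Prod u v)"
    and "\<alpha>\<^bsub>term_alg K W\<^esub> (basis_vec K u) = basis_vec K (Twist u)"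
proof -
  interpret K: cring K by fact
  show "basis_vec K u \<otimes>\<^bsub>term_alg K W\<^esub> basis_vec K v = basis_vec K (Prod u v)"
    by (auto simp: term_alg_mult basis_vec_def fun_eq_iff split: hna_term.split)
  show "\<alpha>\<^bsub>term_alg K W\<^esub> (basis_vec K u) = basis_vec K (Twist u)"
    by (auto simp: term_alg_twist basis_vec_def fun_eq_iff split: hna_term.split)
qed

primrec term_eval :: "('a, 'b, 'n) hom_module_scheme \<Rightarrow> ('w \<Rightarrow> 'b) \<Rightarrow> 'w hna_term \<Rightarrow> 'b"
  where
    "term_eval A f (Gen w) = f w"
  | "term_eval A f (Prod u v) = term_eval A f u \<otimes>\<^bsub>A\<^esub> term_eval A f v"
  | "term_eval A f (Twist u) = \<alpha>\<^bsub>A\<^esub> (term_eval A f u)"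

context hom_module
begin

lemma term_alg: "hom_nonassoc_alg K (term_alg K V)"
  by (rule term_alg_hom_nonassoc[OF R.is_cring])

lemma term_basis_carrier: "gens t \<subseteq> carrier V \<Longrightarrow> basis_vec K t \<in> carrier (term_alg K V)"
  unfolding term_alg_simps by (rule basis_vec_carrier[OF R.is_cring]) simp

lemma gen_basis_carrier: "w \<in> carrier V \<Longrightarrow> basis_vec K (Gen w) \<in> carrier (term_alg K V)"
  by (rule term_basis_carrier) simp

text \<open>The three families that make \<open>Gen\<close> linear and compatible with the twisting map, separated from the
  ideal conditions because membership and minimality use them in opposite directions.\<close>

definition respects_generators :: "('b hna_term \<Rightarrow> 'a) set \<Rightarrow> bool"
  where "respects_generators I \<longleftrightarrow>
    (let T = term_alg K V; g = (\<lambda>w. basis_vec K (Gen w)) in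
      {g (v \<oplus>\<^bsub>V\<^esub> w) \<ominus>\<^bsub>T\<^esub> (g v \<oplus>\<^bsub>T\<^esub> g w) | v w. v \<in> carrier V \<and> w \<in> carrier V} \<subseteq> I \<and>
      {g (c \<odot>\<^bsub>V\<^esub> w) \<ominus>\<^bsub>T\<^esub> c \<odot>\<^bsub>T\<^esub> g w | c w. c \<in> carrier K \<and> w \<in> carrier V} \<subseteq> I \<and>
      {g (\<alpha>\<^bsub>V\<^esub> w) \<ominus>\<^bsub>T\<^esub> \<alpha>\<^bsub>T\<^esub> (g w) | w. w \<in> carrier V} \<subseteq> I)"

lemma term_relations_eq:
  "term_relations K V = \<Inter>{I. two_sided_ideal K (term_alg K V) I \<and> \<alpha>\<^bsub>term_alg K V\<^esub> ` I \<subseteq> I \<and>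
    respects_generators I}"
  by (simp add: term_relations_def respects_generators_def Let_def)

text \<open>The whole algebra is an ideal of the kind in question, so the intersection is over a nonempty family
  and inherits all its conditions.\<close>

lemma term_relations_ideal:
  shows "two_sided_ideal K (term_alg K V) (term_relations K V)"
    and "\<alpha>\<^bsub>term_alg K V\<^esub> ` term_relations K V \<subseteq> term_relations K V"
    and "respects_generators (term_relations K V)"
proof -
  interpret T: hom_nonassoc_alg K "term_alg K V"
    by (rule term_alg)
  have "respects_generators (carrier (term_alg K V))"
    unfolding respects_generators_def Let_def
    by (auto intro!: gen_basis_carrier T.minus_closed T.twist_closed twist_closed)
  then have "carrier (term_alg K V) \<in> {I. two_sided_ideal K (term_alg K V) I \<and>
      \<alpha>\<^bsub>term_alg K V\<^esub> ` I \<subseteq> I \<and> respects_generators I}"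
    by (auto simp: T.carrier_two_sided_ideal T.twist_closed)
  then show "two_sided_ideal K (term_alg K V) (term_relations K V)"
    unfolding term_relations_eq by (intro two_sided_ideal_Inter[OF T.module_axioms]) auto
  show "\<alpha>\<^bsub>term_alg K V\<^esub> ` term_relations K V \<subseteq> term_relations K V"
    unfolding term_relations_eq by blast
  show "respects_generators (term_relations K V)"
    unfolding term_relations_eq unfolding respects_generators_def Let_def by blast
qed

lemma free_hna_projection:
  "hom_alg_morphism K (term_alg K V) (free_hna K V) (\<lambda>x. term_relations K V +>\<^bsub>term_alg K V\<^esub> x)"
  unfolding free_hna_def by (rule hom_quotient_projection[OF term_alg term_relations_ideal(1,2)])

lemma free_hna_surj:
  "(\<lambda>x. term_relations K V +>\<^bsub>term_alg K V\<^esub> x) ` carrier (term_alg K V) = carrier (free_hna K V)"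
  unfolding free_hna_def by (rule hom_quotient_surj)

lemma free_hna: "hom_nonassoc_alg K (free_hna K V)"
  unfolding free_hna_def
  by (rule hom_quotient_hom_nonassoc_alg[OF term_alg term_relations_ideal(1,2)])

lemma free_hna_gen_eqI:
  assumes "w \<in> carrier V" "x \<in> carrier (term_alg K V)"
    "basis_vec K (Gen w) \<ominus>\<^bsub>term_alg K V\<^esub> x \<in> term_relations K V"
  shows "free_hna_gen K V w = term_relations K V +>\<^bsub>term_alg K V\<^esub> x"
proof -
  interpret T: hom_nonassoc_alg K "term_alg K V"
    by (rule term_alg)
  have "submodule (term_relations K V) K (term_alg K V)"
    using term_relations_ideal(1) by (simp add: two_sided_ideal_def)
  then show ?thesis
    unfolding free_hna_gen_def
    by (rule coset_eqI[OF T.module_axioms _ assms(2) gen_basis_carrier[OF assms(1)] assms(3)])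
qed

lemma free_hna_gen_linear: "linear_map K V (free_hna K V) (free_hna_gen K V)"
  and free_hna_gen_twist:
    "w \<in> carrier V \<Longrightarrow> free_hna_gen K V (\<alpha>\<^bsub>V\<^esub> w) = \<alpha>\<^bsub>free_hna K V\<^esub> (free_hna_gen K V w)"
proof -
  interpret T: hom_nonassoc_alg K "term_alg K V"
    by (rule term_alg)
  note rel = term_relations_ideal(3)[unfolded respects_generators_def Let_def]
  note p = free_hna_projection
  have "free_hna_gen K V w \<in> carrier (free_hna K V)" if "w \<in> carrier V" for w
    unfolding free_hna_gen_def by (rule morphism_closed[OF p gen_basis_carrier[OF that]])
  moreover have "free_hna_gen K V (v \<oplus>\<^bsub>V\<^esub> w)
      = free_hna_gen K V v \<oplus>\<^bsub>free_hna K V\<^esub> free_hna_gen K V w"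
    if "v \<in> carrier V" "w \<in> carrier V" for v w
  proof -
    have "free_hna_gen K V (v \<oplus>\<^bsub>V\<^esub> w) = term_relations K V +>\<^bsub>term_alg K V\<^esub>
        (basis_vec K (Gen v) \<oplus>\<^bsub>term_alg K V\<^esub> basis_vec K (Gen w))"
      using rel that by (intro free_hna_gen_eqI) (auto simp: gen_basis_carrier)
    then show ?thesis
      unfolding free_hna_gen_def
      using that by (simp add: morphism_add[OF p] gen_basis_carrier)
  qed
  moreover have "free_hna_gen K V (c \<odot>\<^bsub>V\<^esub> w) = c \<odot>\<^bsub>free_hna K V\<^esub> free_hna_gen K V w"
    if "c \<in> carrier K" "w \<in> carrier V" for c w
  proof -
    have "free_hna_gen K V (c \<odot>\<^bsub>V\<^esub> w) = term_relations K V +>\<^bsub>term_alg K V\<^esub>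
        (c \<odot>\<^bsub>term_alg K V\<^esub> basis_vec K (Gen w))"
      using rel that by (intro free_hna_gen_eqI) (auto simp: gen_basis_carrier)
    then show ?thesis
      unfolding free_hna_gen_def
      using that by (simp add: morphism_smult[OF p] gen_basis_carrier)
  qed
  ultimately show "linear_map K V (free_hna K V) (free_hna_gen K V)"
    by (simp add: linear_map_def Pi_iff)
  show "free_hna_gen K V (\<alpha>\<^bsub>V\<^esub> w) = \<alpha>\<^bsub>free_hna K V\<^esub> (free_hna_gen K V w)" if "w \<in> carrier V" for w
  proof -
    have "free_hna_gen K V (\<alpha>\<^bsub>V\<^esub> w)
        = term_relations K V +>\<^bsub>term_alg K V\<^esub> \<alpha>\<^bsub>term_alg K V\<^esub> (basis_vec K (Gen w))"
      using rel that
      by (intro free_hna_gen_eqI) (auto simp: gen_basis_carrier twist_closed T.twist_closed)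
    then show ?thesis
      unfolding free_hna_gen_def
      using that by (simp add: morphism_twist[OF p] gen_basis_carrier)
  qed
qed

text \<open>The classes of basis vectors are reached by induction on terms, everything else by linearity,
  starting from zero as the generator of the zero vector.\<close>

lemma free_hna_induct [consumes 1, case_names gen add smult mult twist]:
  assumes "X \<in> carrier (free_hna K V)"
    and gen: "\<And>w. w \<in> carrier V \<Longrightarrow> P (free_hna_gen K V w)"
    and add: "\<And>X Y. X \<in> carrier (free_hna K V) \<Longrightarrow> Y \<in> carrier (free_hna K V) \<Longrightarrow>
      P X \<Longrightarrow> P Y \<Longrightarrow> P (X \<oplus>\<^bsub>free_hna K V\<^esub> Y)"
    and smult: "\<And>c X. c \<in> carrier K \<Longrightarrow> X \<in> carrier (free_hna K V) \<Longrightarrow> P X \<Longrightarrow>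
      P (c \<odot>\<^bsub>free_hna K V\<^esub> X)"
    and mult: "\<And>X Y. X \<in> carrier (free_hna K V) \<Longrightarrow> Y \<in> carrier (free_hna K V) \<Longrightarrow>
      P X \<Longrightarrow> P Y \<Longrightarrow> P (X \<otimes>\<^bsub>free_hna K V\<^esub> Y)"
    and twist: "\<And>X. X \<in> carrier (free_hna K V) \<Longrightarrow> P X \<Longrightarrow> P (\<alpha>\<^bsub>free_hna K V\<^esub> X)"
  shows "P X"
proof -
  let ?p = "\<lambda>x. term_relations K V +>\<^bsub>term_alg K V\<^esub> x"
  interpret T: hom_nonassoc_alg K "term_alg K V" by (rule term_alg)
  interpret F: hom_nonassoc_alg K "free_hna K V" by (rule free_hna)
  note p = free_hna_projection
  have "P (free_hna_gen K V \<zero>\<^bsub>V\<^esub>)"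
    by (rule gen) simp
  then have zero: "P (?p \<zero>\<^bsub>term_alg K V\<^esub>)"
    by (simp add: linear_map_zero[OF module_axioms F.module_axioms free_hna_gen_linear]
        linear_map_zero[OF T.module_axioms F.module_axioms morphism_linear[OF p]])
  have "submodule {x \<in> carrier (term_alg K V). P (?p x)} K (term_alg K V)"
    by (rule T.submoduleI_closed)
      (auto simp: zero morphism_add[OF p] morphism_smult[OF p] morphism_closed[OF p] intro: add smult)
  then have sub: "submodule {x \<in> carrier (term_alg K V). P (?p x)} K (free_module K (terms V))"
    by (simp add: submodule_def submodule_axioms_def subgroup_def term_alg_simps m_inv_def)
  have basis: "P (?p (basis_vec K t))" if "gens t \<subseteq> carrier V" for t
    using that
  proof (induction t)
    case (Gen w)
    then show ?case
      using gen[of w] by (simp add: free_hna_gen_def)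
  next
    case (Prod u v)
    then show ?case
      using mult[of "?p (basis_vec K u)" "?p (basis_vec K v)"]
      by (simp add: term_alg_basis(1)[OF R.is_cring, where W = V, symmetric] morphism_mult[OF p]
          morphism_closed[OF p] term_basis_carrier)
  next
    case (Twist u)
    then show ?case
      using twist[of "?p (basis_vec K u)"]
      by (simp add: term_alg_basis(2)[OF R.is_cring, where W = V, symmetric] morphism_twist[OF p]
          morphism_closed[OF p] term_basis_carrier)
  qed
  have "x \<in> {x \<in> carrier (term_alg K V). P (?p x)}" if "x \<in> carrier (term_alg K V)" for x
    by (rule free_module_span[OF R.is_cring sub _ that[unfolded term_alg_simps]])
      (simp add: basis term_basis_carrier)
  then show ?thesis
    using assms(1) by (auto simp flip: free_hna_surj)
qed

context
  fixes A :: "('a, 'y, 'z) hom_module_scheme" and f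
  assumes A: "hom_nonassoc_alg K A" and f: "linear_map K V A f"
    and f_twist: "\<And>w. w \<in> carrier V \<Longrightarrow> f (\<alpha>\<^bsub>V\<^esub> w) = \<alpha>\<^bsub>A\<^esub> (f w)"
begin

interpretation A: hom_nonassoc_alg K A by (rule A)
interpretation T: hom_nonassoc_alg K "term_alg K V" by (rule term_alg)

lemma term_eval_closed: "gens t \<subseteq> carrier V \<Longrightarrow> term_eval A f t \<in> carrier A"
  by (induction t) (simp_all add: A.mult_closed A.twist_closed linear_map_closed[OF f])

lemma eval_basis: "gens t \<subseteq> carrier V \<Longrightarrow> lin_ext K A (term_eval A f) (basis_vec K t) = term_eval A f t"
  by (rule lin_ext_basis_vec[where b = "term_eval A f", OF A.module_axioms term_eval_closed])

lemma eval_linear: "linear_map K (term_alg K V) A (lin_ext K A (term_eval A f))"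
  unfolding linear_map_term_alg
  by (rule lin_ext_linear[OF A.module_axioms]) (simp add: term_eval_closed)

text \<open>Both sides of each identity are linear in each argument, so they may be compared on basis vectors,
  where the operations of the term algebra are the term constructors.\<close>

lemma eval_morphism: "hom_alg_morphism K (term_alg K V) A (lin_ext K A (term_eval A f))"
proof -
  let ?T = "term_alg K V" and ?e = "lin_ext K A (term_eval A f)"
  have ext: "g \<phi> = h \<phi>" if "linear_map K ?T A g" "linear_map K ?T A h"
    "\<And>t. gens t \<subseteq> carrier V \<Longrightarrow> g (basis_vec K t) = h (basis_vec K t)" "\<phi> \<in> carrier ?T" for g h \<phi>
    by (rule free_module_ext[OF R.is_cring A.module_axioms that(1,2)[unfolded linear_map_term_alg] _
          that(4)[unfolded term_alg_simps]]) (simp add: that(3))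
  have 1: "?e (basis_vec K u \<otimes>\<^bsub>?T\<^esub> \<psi>) = ?e (basis_vec K u) \<otimes>\<^bsub>A\<^esub> ?e \<psi>"
    if "gens u \<subseteq> carrier V" "\<psi> \<in> carrier ?T" for u \<psi>
  proof (rule ext[OF _ _ _ that(2)])
    show "linear_map K ?T A (\<lambda>\<psi>. ?e (basis_vec K u \<otimes>\<^bsub>?T\<^esub> \<psi>))"
      by (rule linear_map_comp[OF T.mult_linear_right[OF term_basis_carrier[OF that(1)]] eval_linear])
    show "linear_map K ?T A (\<lambda>\<psi>. ?e (basis_vec K u) \<otimes>\<^bsub>A\<^esub> ?e \<psi>)"
      by (rule linear_map_comp[OF eval_linear A.mult_linear_right])
        (rule linear_map_closed[OF eval_linear term_basis_carrier[OF that(1)]])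
  qed (simp add: term_alg_basis(1)[OF R.is_cring] eval_basis that)
  have "?e (\<phi> \<otimes>\<^bsub>?T\<^esub> \<psi>) = ?e \<phi> \<otimes>\<^bsub>A\<^esub> ?e \<psi>" if "\<phi> \<in> carrier ?T" "\<psi> \<in> carrier ?T" for \<phi> \<psi>
  proof (rule ext[OF _ _ _ that(1)])
    show "linear_map K ?T A (\<lambda>\<phi>. ?e (\<phi> \<otimes>\<^bsub>?T\<^esub> \<psi>))"
      by (rule linear_map_comp[OF T.mult_linear_left[OF that(2)] eval_linear])
    show "linear_map K ?T A (\<lambda>\<phi>. ?e \<phi> \<otimes>\<^bsub>A\<^esub> ?e \<psi>)"
      by (rule linear_map_comp[OF eval_linear A.mult_linear_left])
        (rule linear_map_closed[OF eval_linear that(2)])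
  qed (simp add: 1 that(2))
  moreover have "?e (\<alpha>\<^bsub>?T\<^esub> \<phi>) = \<alpha>\<^bsub>A\<^esub> (?e \<phi>)" if "\<phi> \<in> carrier ?T" for \<phi>
  proof (rule ext[OF _ _ _ that])
    show "linear_map K ?T A (\<lambda>\<phi>. ?e (\<alpha>\<^bsub>?T\<^esub> \<phi>))"
      by (rule linear_map_comp[OF T.twist_linear eval_linear])
    show "linear_map K ?T A (\<lambda>\<phi>. \<alpha>\<^bsub>A\<^esub> (?e \<phi>))"
      by (rule linear_map_comp[OF eval_linear A.twist_linear])
  qed (simp add: term_alg_basis(2)[OF R.is_cring] eval_basis)
  ultimately show ?thesis
    using eval_linear by (simp add: hom_alg_morphism_def)
qed

lemma eval_term_relations:
  assumes "x \<in> term_relations K V"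
  shows "lin_ext K A (term_eval A f) x = \<zero>\<^bsub>A\<^esub>"
proof -
  let ?e = "lin_ext K A (term_eval A f)" and ?g = "\<lambda>w. basis_vec K (Gen w)"
  let ?I = "{x \<in> carrier (term_alg K V). ?e x = \<zero>\<^bsub>A\<^esub>}"
  have g: "?g w \<in> carrier (term_alg K V)" "?e (?g w) = f w" if "w \<in> carrier V" for w
    using that gen_basis_carrier eval_basis[of "Gen w"] by auto
  have "respects_generators ?I"
    unfolding respects_generators_def Let_def
    by (auto simp: g linear_map_minus[OF T.module_axioms A.module_axioms eval_linear]
        linear_map_add[OF eval_linear] linear_map_smult[OF eval_linear]
        morphism_twist[OF eval_morphism] T.twist_closed twist_closed linear_map_add[OF f]
        linear_map_smult[OF f] f_twist A.minus_eq_zero_iff linear_map_closed[OF f] A.twist_closed)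
  moreover have "\<alpha>\<^bsub>term_alg K V\<^esub> ` ?I \<subseteq> ?I"
    using morphism_kernel_twist[OF term_alg A eval_morphism] T.twist_closed by auto
  ultimately have "?I \<in> {I. two_sided_ideal K (term_alg K V) I \<and> \<alpha>\<^bsub>term_alg K V\<^esub> ` I \<subseteq> I \<and>
      respects_generators I}"
    using morphism_kernel_ideal[OF term_alg A eval_morphism] by simp
  then have "term_relations K V \<subseteq> ?I"
    unfolding term_relations_eq by (rule Inter_lower)
  then show ?thesis
    using assms by blast
qed

lemma free_hna_lift:
  obtains h where "hom_alg_morphism K (free_hna K V) A h"
    "\<And>w. w \<in> carrier V \<Longrightarrow> h (free_hna_gen K V w) = f w"
proof -
  obtain h where h: "hom_alg_morphism K (free_hna K V) A h"
    "\<And>x. x \<in> carrier (term_alg K V) \<Longrightarrow>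
      h (term_relations K V +>\<^bsub>term_alg K V\<^esub> x) = lin_ext K A (term_eval A f) x"
    using hom_quotient_lift[OF term_alg A term_relations_ideal(1,2) eval_morphism eval_term_relations]
    unfolding free_hna_def by metis
  have "h (free_hna_gen K V w) = f w" if "w \<in> carrier V" for w
    using that by (simp add: free_hna_gen_def h(2) gen_basis_carrier eval_basis)
  then show thesis
    using that h(1) by blast
qed

end

end

section \<open>Adjoining a unit\<close>

context hom_nonassoc_alg
begin

lemma unitization_unital: "unital_hom_nonassoc_alg K (unitization K A)"
proof -
  let ?U = "unitization K A"
  interpret U: module K ?U
  proof (rule moduleI[OF R.is_cring])
    show "abelian_group ?U"
    proof (rule abelian_groupI)
      fix x assume "x \<in> carrier ?U"
      then have "(\<ominus>\<^bsub>K\<^esub> fst x, \<ominus>\<^bsub>A\<^esub> snd x) \<in> carrier ?U"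
        "(\<ominus>\<^bsub>K\<^esub> fst x, \<ominus>\<^bsub>A\<^esub> snd x) \<oplus>\<^bsub>?U\<^esub> x = \<zero>\<^bsub>?U\<^esub>"
        by (auto simp: unitization_def R.l_neg M.l_neg)
      then show "\<exists>y\<in>carrier ?U. y \<oplus>\<^bsub>?U\<^esub> x = \<zero>\<^bsub>?U\<^esub>" by blast
    qed (auto simp: unitization_def R.a_ac M.a_ac)
  qed (auto simp: unitization_def R.l_distr R.r_distr R.m_assoc smult_l_distr smult_r_distr smult_assoc1)
  show ?thesis
  proof
    show "linear_map K ?U ?U \<alpha>\<^bsub>?U\<^esub>"
      by (auto simp: linear_map_def unitization_def twist_closed twist_add twist_smult)
  qed (auto simp: unitization_def mult_closed mult_add_left mult_add_right mult_smult_left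
      mult_smult_right R.l_distr R.r_distr R.m_ac smult_l_distr smult_r_distr smult_assoc1[symmetric]
      M.a_ac mult_zero_left mult_zero_right)
qed

lemma unitization_twist_one: "\<alpha>\<^bsub>unitization K A\<^esub> \<one>\<^bsub>unitization K A\<^esub> = \<one>\<^bsub>unitization K A\<^esub>"
  using linear_map_zero[OF module_axioms module_axioms twist_linear] by (simp add: unitization_def)

lemma unitization_inclusion: "hom_alg_morphism K A (unitization K A) (\<lambda>x. (\<zero>\<^bsub>K\<^esub>, x))"
  by (auto simp: hom_alg_morphism_def linear_map_def unitization_def mult_closed)

lemma unitization_decomp:
  "s \<in> carrier K \<Longrightarrow> x \<in> carrier A \<Longrightarrow>
    (s, x) = s \<odot>\<^bsub>unitization K A\<^esub> \<one>\<^bsub>unitization K A\<^esub> \<oplus>\<^bsub>unitization K A\<^esub> (\<zero>\<^bsub>K\<^esub>, x)"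
  by (simp add: unitization_def)

text \<open>The condition \<open>\<alpha>(1) = 1\<close> makes the extension commute with the twisting map on scalars, on which the
  twisting map of the unitization is the identity.\<close>

lemma unitization_lift:
  assumes "unital_hom_nonassoc_alg K B" "\<alpha>\<^bsub>B\<^esub> \<one>\<^bsub>B\<^esub> = \<one>\<^bsub>B\<^esub>" "hom_alg_morphism K A B g"
  shows "unital_hom_alg_morphism K (unitization K A) B (\<lambda>(s, x). s \<odot>\<^bsub>B\<^esub> \<one>\<^bsub>B\<^esub> \<oplus>\<^bsub>B\<^esub> g x)"
proof -
  interpret B: unital_hom_nonassoc_alg K B by fact
  note g = morphism_closed[OF assms(3)] morphism_add[OF assms(3)] morphism_smult[OF assms(3)]
    morphism_mult[OF assms(3)] morphism_twist[OF assms(3)]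
  note B = B.unit_closed B.unit_left B.unit_right B.mult_closed B.mult_add_left B.mult_add_right
    B.mult_smult_left B.mult_smult_right B.smult_l_distr B.smult_r_distr B.smult_assoc1[symmetric] B.a_ac
    B.twist_closed B.twist_add B.twist_smult R.m_ac
  have "g \<zero>\<^bsub>A\<^esub> = \<zero>\<^bsub>B\<^esub>"
    by (rule linear_map_zero[OF module_axioms B.module_axioms morphism_linear[OF assms(3)]])
  then show ?thesis
    by (auto simp: unital_hom_alg_morphism_def hom_alg_morphism_def linear_map_def unitization_def
        g B assms(2) mult_closed twist_closed)
qed

end

context hom_module
begin

lemma free_unital_hna: "unital_hom_nonassoc_alg K (free_unital_hna K V)"
  unfolding free_unital_hna_def by (rule hom_nonassoc_alg.unitization_unital[OF free_hna])

lemma free_unital_hna_twist_one: "\<alpha>\<^bsub>free_unital_hna K V\<^esub> \<one>\<^bsub>free_unital_hna K V\<^esub> = \<one>\<^bsub>free_unital_hna K V\<^esub>"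
  unfolding free_unital_hna_def by (rule hom_nonassoc_alg.unitization_twist_one[OF free_hna])

lemma free_unital_hna_inclusion:
  "hom_alg_morphism K (free_hna K V) (free_unital_hna K V) (\<lambda>x. (\<zero>\<^bsub>K\<^esub>, x))"
  unfolding free_unital_hna_def by (rule hom_nonassoc_alg.unitization_inclusion[OF free_hna])

lemma free_unital_hna_gen_linear: "linear_map K V (free_unital_hna K V) (free_unital_hna_gen K V)"
  using linear_map_comp[OF free_hna_gen_linear morphism_linear[OF free_unital_hna_inclusion]]
  by (simp add: linear_map_def free_unital_hna_gen_def Pi_iff)

lemma free_unital_hna_gen_twist:
  assumes "w \<in> carrier V"
  shows "free_unital_hna_gen K V (\<alpha>\<^bsub>V\<^esub> w) = \<alpha>\<^bsub>free_unital_hna K V\<^esub> (free_unital_hna_gen K V w)"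
  using morphism_twist[OF free_unital_hna_inclusion linear_map_closed[OF free_hna_gen_linear assms]]
  by (simp add: free_unital_hna_gen_def free_hna_gen_twist assms)

lemma free_unital_hna_induct [consumes 1, case_names gen one add smult mult twist]:
  assumes "X \<in> carrier (free_unital_hna K V)"
    and gen: "\<And>w. w \<in> carrier V \<Longrightarrow> P (free_unital_hna_gen K V w)"
    and one: "P \<one>\<^bsub>free_unital_hna K V\<^esub>"
    and add: "\<And>X Y. X \<in> carrier (free_unital_hna K V) \<Longrightarrow> Y \<in> carrier (free_unital_hna K V) \<Longrightarrow>
      P X \<Longrightarrow> P Y \<Longrightarrow> P (X \<oplus>\<^bsub>free_unital_hna K V\<^esub> Y)"
    and smult: "\<And>c X. c \<in> carrier K \<Longrightarrow> X \<in> carrier (free_unital_hna K V) \<Longrightarrow> P X \<Longrightarrow>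
      P (c \<odot>\<^bsub>free_unital_hna K V\<^esub> X)"
    and mult: "\<And>X Y. X \<in> carrier (free_unital_hna K V) \<Longrightarrow> Y \<in> carrier (free_unital_hna K V) \<Longrightarrow>
      P X \<Longrightarrow> P Y \<Longrightarrow> P (X \<otimes>\<^bsub>free_unital_hna K V\<^esub> Y)"
    and twist: "\<And>X. X \<in> carrier (free_unital_hna K V) \<Longrightarrow> P X \<Longrightarrow> P (\<alpha>\<^bsub>free_unital_hna K V\<^esub> X)"
  shows "P X"
proof -
  interpret F: unital_hom_nonassoc_alg K "free_unital_hna K V"
    by (rule free_unital_hna)
  note i = free_unital_hna_inclusion
  have incl: "P (\<zero>\<^bsub>K\<^esub>, x)" if "x \<in> carrier (free_hna K V)" for x
    using that
  proof (induction rule: free_hna_induct)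
    case (gen w)
    then show ?case using assms(2)[of w] by (simp add: free_unital_hna_gen_def)
  next
    case (add x y)
    then show ?case
      using assms(4)[OF morphism_closed[OF i] morphism_closed[OF i]] by (simp add: morphism_add[OF i])
  next
    case (smult c x)
    then show ?case
      using assms(5)[OF _ morphism_closed[OF i]] by (simp add: morphism_smult[OF i])
  next
    case (mult x y)
    then show ?case
      using assms(6)[OF morphism_closed[OF i] morphism_closed[OF i]] by (simp add: morphism_mult[OF i])
  next
    case (twist x)
    then show ?case
      using assms(7)[OF morphism_closed[OF i]] by (simp add: morphism_twist[OF i])
  qed
  obtain s x where X: "X = (s, x)" "s \<in> carrier K" "x \<in> carrier (free_hna K V)"
    using assms(1) by (auto simp: free_unital_hna_def unitization_def)
  have "X = s \<odot>\<^bsub>free_unital_hna K V\<^esub> \<one>\<^bsub>free_unital_hna K V\<^esub> \<oplus>\<^bsub>free_unital_hna K V\<^esub> (\<zero>\<^bsub>K\<^esub>, x)"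
    unfolding X(1) free_unital_hna_def
    by (rule hom_nonassoc_alg.unitization_decomp[OF free_hna X(2,3)])
  moreover have "P (s \<odot>\<^bsub>free_unital_hna K V\<^esub> \<one>\<^bsub>free_unital_hna K V\<^esub>
      \<oplus>\<^bsub>free_unital_hna K V\<^esub> (\<zero>\<^bsub>K\<^esub>, x))"
    by (intro add smult one incl F.smult_closed F.unit_closed X(2,3) morphism_closed[OF i])
  ultimately show ?thesis
    by simp
qed

lemma free_unital_hna_lift:
  assumes "unital_hom_nonassoc_alg K B" "\<alpha>\<^bsub>B\<^esub> \<one>\<^bsub>B\<^esub> = \<one>\<^bsub>B\<^esub>" "linear_map K V B f"
    "\<And>w. w \<in> carrier V \<Longrightarrow> f (\<alpha>\<^bsub>V\<^esub> w) = \<alpha>\<^bsub>B\<^esub> (f w)"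
  obtains h where "unital_hom_alg_morphism K (free_unital_hna K V) B h"
    "\<And>w. w \<in> carrier V \<Longrightarrow> h (free_unital_hna_gen K V w) = f w"
proof -
  interpret B: unital_hom_nonassoc_alg K B by fact
  obtain g where g: "hom_alg_morphism K (free_hna K V) B g"
    "\<And>w. w \<in> carrier V \<Longrightarrow> g (free_hna_gen K V w) = f w"
    using free_hna_lift[where f = f, OF B.hom_nonassoc_alg_axioms assms(3,4)] by metis
  let ?h = "\<lambda>(s, x). s \<odot>\<^bsub>B\<^esub> \<one>\<^bsub>B\<^esub> \<oplus>\<^bsub>B\<^esub> g x"
  have "unital_hom_alg_morphism K (free_unital_hna K V) B ?h"
    unfolding free_unital_hna_def
    by (rule hom_nonassoc_alg.unitization_lift[OF free_hna assms(1,2) g(1)])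
  moreover have "?h (free_unital_hna_gen K V w) = f w" if "w \<in> carrier V" for w
    using that linear_map_closed[OF assms(3)]
    by (simp add: free_unital_hna_gen_def g(2) B.unit_closed)
  ultimately show thesis
    using that by blast
qed

end

section \<open>The enveloping algebra\<close>

context mult_hom_lie_alg
begin

abbreviation (input) F where "F \<equiv> free_unital_hna K L"
abbreviation (input) j where "j \<equiv> free_unital_hna_gen K L"
abbreviation (input) U where "U \<equiv> envelope K L"
abbreviation (input) \<iota> where "\<iota> \<equiv> envelope_gen K L"

interpretation F: unital_hom_nonassoc_alg K F
  by (rule free_unital_hna)

lemma free_gen_closed: "x \<in> carrier L \<Longrightarrow> j x \<in> carrier F"
  by (rule linear_map_closed[OF free_unital_hna_gen_linear])

lemma envelope_relations_carrier: "envelope_relations K L \<subseteq> carrier F"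
  unfolding envelope_relations_def Let_def
  by (auto intro!: F.minus_closed F.mult_closed F.twist_closed free_gen_closed mult_closed)

lemma envelope_relations_mem:
  shows "\<lbrakk>x \<in> carrier F; y \<in> carrier F; z \<in> carrier F\<rbrakk> \<Longrightarrow>
      (x \<otimes>\<^bsub>F\<^esub> y) \<otimes>\<^bsub>F\<^esub> \<alpha>\<^bsub>F\<^esub> z \<ominus>\<^bsub>F\<^esub> \<alpha>\<^bsub>F\<^esub> x \<otimes>\<^bsub>F\<^esub> (y \<otimes>\<^bsub>F\<^esub> z) \<in> envelope_relations K L"
    and "\<lbrakk>x \<in> carrier F; y \<in> carrier F\<rbrakk> \<Longrightarrow>
      \<alpha>\<^bsub>F\<^esub> (x \<otimes>\<^bsub>F\<^esub> y) \<ominus>\<^bsub>F\<^esub> \<alpha>\<^bsub>F\<^esub> x \<otimes>\<^bsub>F\<^esub> \<alpha>\<^bsub>F\<^esub> y \<in> envelope_relations K L"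
    and "\<lbrakk>v \<in> carrier L; w \<in> carrier L\<rbrakk> \<Longrightarrow>
      j (v \<otimes>\<^bsub>L\<^esub> w) \<ominus>\<^bsub>F\<^esub> (j v \<otimes>\<^bsub>F\<^esub> j w \<ominus>\<^bsub>F\<^esub> j w \<otimes>\<^bsub>F\<^esub> j v) \<in> envelope_relations K L"
  unfolding envelope_relations_def Let_def by blast+

lemma envelope_ideal_seq_ideal: "two_sided_ideal K F (envelope_ideal_seq K L n)"
proof (induction n)
  case 0
  show ?case
    using ideal_generated_ideal[OF F.hom_nonassoc_alg_axioms envelope_relations_carrier] by simp
next
  case (Suc n)
  have "envelope_ideal_seq K L n \<subseteq> carrier F"
    using Suc F.submoduleE(1) by (simp add: two_sided_ideal_def)
  then have "envelope_ideal_seq K L n \<union> \<alpha>\<^bsub>F\<^esub> ` envelope_ideal_seq K L n \<subseteq> carrier F"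
    using F.twist_closed by blast
  then show ?case
    using ideal_generated_ideal[OF F.hom_nonassoc_alg_axioms] by simp
qed

lemma envelope_ideal_seq_mono: "m \<le> n \<Longrightarrow> envelope_ideal_seq K L m \<subseteq> envelope_ideal_seq K L n"
proof (rule lift_Suc_mono_le[of "envelope_ideal_seq K L"])
  show "envelope_ideal_seq K L n \<subseteq> envelope_ideal_seq K L (Suc n)" for n
    using ideal_generated_incl by fastforce
qed

text \<open>Two elements of the increasing union lie in a common member of the chain.\<close>

lemma envelope_ideal_ideal: "two_sided_ideal K F (envelope_ideal K L)"
proof -
  note I = envelope_ideal_seq_ideal[unfolded two_sided_ideal_def]
  have sub: "submodule (envelope_ideal_seq K L n) K F" for n
    using I by blast
  have "submodule (envelope_ideal K L) K F"
  proof (rule F.submoduleI_closed)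
    show "envelope_ideal K L \<subseteq> carrier F"
      unfolding envelope_ideal_def using F.submoduleE(1)[OF sub] by (rule UN_least)
    show "\<zero>\<^bsub>F\<^esub> \<in> envelope_ideal K L"
      unfolding envelope_ideal_def using F.submodule_zero[OF sub] by blast
    show "x \<oplus>\<^bsub>F\<^esub> y \<in> envelope_ideal K L" if xy: "x \<in> envelope_ideal K L" "y \<in> envelope_ideal K L" for x y
    proof -
      obtain m n where "x \<in> envelope_ideal_seq K L m" "y \<in> envelope_ideal_seq K L n"
        using xy unfolding envelope_ideal_def by blast
      then have "x \<in> envelope_ideal_seq K L (max m n)" "y \<in> envelope_ideal_seq K L (max m n)"
        using envelope_ideal_seq_mono[of m "max m n"] envelope_ideal_seq_mono[of n "max m n"] by auto
      then have "x \<oplus>\<^bsub>F\<^esub> y \<in> envelope_ideal_seq K L (max m n)"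
        by (rule F.submoduleE(5)[OF sub])
      then show ?thesis
        unfolding envelope_ideal_def by blast
    qed
    show "c \<odot>\<^bsub>F\<^esub> x \<in> envelope_ideal K L" if "c \<in> carrier K" "x \<in> envelope_ideal K L" for c x
      using that F.submoduleE(4)[OF sub] unfolding envelope_ideal_def by blast
  qed
  moreover have "a \<otimes>\<^bsub>F\<^esub> x \<in> envelope_ideal K L \<and> x \<otimes>\<^bsub>F\<^esub> a \<in> envelope_ideal K L"
    if "a \<in> carrier F" "x \<in> envelope_ideal K L" for a x
    using that I unfolding envelope_ideal_def by blast
  ultimately show ?thesis
    by (simp add: two_sided_ideal_def)
qed

text \<open>Applying the twisting map moves each member of the chain into the next one; no single member need be
  stable, which is why the union is taken.\<close>

lemma envelope_ideal_twist: "\<alpha>\<^bsub>F\<^esub> ` envelope_ideal K L \<subseteq> envelope_ideal K L"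
proof -
  have "\<alpha>\<^bsub>F\<^esub> ` envelope_ideal_seq K L n \<subseteq> envelope_ideal_seq K L (Suc n)" for n
    using ideal_generated_incl[of "envelope_ideal_seq K L n \<union> \<alpha>\<^bsub>F\<^esub> ` envelope_ideal_seq K L n" K F]
    by simp
  then show ?thesis
    unfolding envelope_ideal_def by blast
qed

lemma envelope_relations_in_ideal: "envelope_relations K L \<subseteq> envelope_ideal K L"
  using ideal_generated_incl[of "envelope_relations K L" K F]
  unfolding envelope_ideal_def by (metis UN_upper envelope_ideal_seq.simps(1) subset_trans UNIV_I)

lemma envelope_ideal_least:
  assumes "two_sided_ideal K F J" "\<alpha>\<^bsub>F\<^esub> ` J \<subseteq> J" "envelope_relations K L \<subseteq> J"
  shows "envelope_ideal K L \<subseteq> J"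
proof -
  have "envelope_ideal_seq K L n \<subseteq> J" for n
  proof (induction n)
    case 0
    show ?case
      using ideal_generated_least[OF assms(1,3)] by simp
  next
    case (Suc n)
    then have "envelope_ideal_seq K L n \<union> \<alpha>\<^bsub>F\<^esub> ` envelope_ideal_seq K L n \<subseteq> J"
      using assms(2) by blast
    then show ?case
      using ideal_generated_least[OF assms(1)] by simp
  qed
  then show ?thesis
    unfolding envelope_ideal_def by blast
qed

abbreviation (input) p where "p \<equiv> (\<lambda>x. envelope_ideal K L +>\<^bsub>F\<^esub> x)"

lemma envelope_projection: "unital_hom_alg_morphism K F U p"
proof -
  have "hom_alg_morphism K F U p"
    unfolding envelope_def
    by (rule hom_quotient_projection[OF F.hom_nonassoc_alg_axioms envelope_ideal_ideal envelope_ideal_twist])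
  then show ?thesis
    by (simp add: unital_hom_alg_morphism_def envelope_def hom_quotient_def)
qed

lemmas envelope_projection_morphism = unital_morphism_morphism[OF envelope_projection]

lemma envelope_surj: "p ` carrier F = carrier U"
  unfolding envelope_def by (rule hom_quotient_surj)

lemma envelope_projection_eqI:
  assumes "x \<in> carrier F" "y \<in> carrier F" "x \<ominus>\<^bsub>F\<^esub> y \<in> envelope_relations K L"
  shows "p x = p y"
  using assms envelope_relations_in_ideal envelope_ideal_ideal
  by (intro coset_eqI[OF F.module_axioms]) (auto simp: two_sided_ideal_def)

text \<open>The images of the first two families of relations are the identities of a multiplicative
  Hom-associative algebra, read on cosets.\<close>

lemma envelope_alg: "unital_mult_hom_assoc_alg K U"
proof -
  note mor = envelope_projection_morphism
  interpret U: unital_hom_nonassoc_alg K U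
  proof (rule unital_hom_nonassoc_alg_surj_image[OF free_unital_hna envelope_projection envelope_surj])
    show "p \<zero>\<^bsub>F\<^esub> = \<zero>\<^bsub>U\<^esub>"
      unfolding envelope_def by (rule hom_quotient_zero[OF F.hom_nonassoc_alg_axioms envelope_ideal_ideal])
  qed
  have ex: "\<exists>x\<in>carrier F. X = p x" if "X \<in> carrier U" for X
    using that envelope_surj by blast
  have assoc: "p ((x \<otimes>\<^bsub>F\<^esub> y) \<otimes>\<^bsub>F\<^esub> \<alpha>\<^bsub>F\<^esub> z) = p (\<alpha>\<^bsub>F\<^esub> x \<otimes>\<^bsub>F\<^esub> (y \<otimes>\<^bsub>F\<^esub> z))"
    if "x \<in> carrier F" "y \<in> carrier F" "z \<in> carrier F" for x y z
    by (rule envelope_projection_eqI)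
      (use that in \<open>simp_all add: F.mult_closed F.twist_closed envelope_relations_mem\<close>)
  have multi: "p (\<alpha>\<^bsub>F\<^esub> (x \<otimes>\<^bsub>F\<^esub> y)) = p (\<alpha>\<^bsub>F\<^esub> x \<otimes>\<^bsub>F\<^esub> \<alpha>\<^bsub>F\<^esub> y)"
    if "x \<in> carrier F" "y \<in> carrier F" for x y
    by (rule envelope_projection_eqI)
      (use that in \<open>simp_all add: F.mult_closed F.twist_closed envelope_relations_mem\<close>)
  show ?thesis
  proof
    fix X Y Z assume "X \<in> carrier U" "Y \<in> carrier U" "Z \<in> carrier U"
    then obtain x y z where "x \<in> carrier F" "y \<in> carrier F" "z \<in> carrier F"
      and "X = p x" "Y = p y" "Z = p z" using ex by meson
    then show "(X \<otimes>\<^bsub>U\<^esub> Y) \<otimes>\<^bsub>U\<^esub> \<alpha>\<^bsub>U\<^esub> Z = \<alpha>\<^bsub>U\<^esub> X \<otimes>\<^bsub>U\<^esub> (Y \<otimes>\<^bsub>U\<^esub> Z)"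
      using assoc[of x y z]
      by (simp add: morphism_mult[OF mor] morphism_twist[OF mor] F.mult_closed F.twist_closed)
  next
    fix X Y assume "X \<in> carrier U" "Y \<in> carrier U"
    then obtain x y where "x \<in> carrier F" "y \<in> carrier F" and "X = p x" "Y = p y" using ex by meson
    then show "\<alpha>\<^bsub>U\<^esub> (X \<otimes>\<^bsub>U\<^esub> Y) = \<alpha>\<^bsub>U\<^esub> X \<otimes>\<^bsub>U\<^esub> \<alpha>\<^bsub>U\<^esub> Y"
      using multi[of x y]
      by (simp add: morphism_mult[OF mor] morphism_twist[OF mor] F.mult_closed F.twist_closed)
  qed
qed

lemma envelope_twist_one: "\<alpha>\<^bsub>U\<^esub> \<one>\<^bsub>U\<^esub> = \<one>\<^bsub>U\<^esub>"
  using morphism_twist[OF envelope_projection_morphism F.unit_closed]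
    unital_morphism_one[OF envelope_projection] free_unital_hna_twist_one by simp

lemma envelope_gen_linear: "linear_map K L U \<iota>"
  unfolding envelope_gen_def
  by (rule linear_map_comp[OF free_unital_hna_gen_linear morphism_linear[OF envelope_projection_morphism]])

lemma envelope_gen_twist: "x \<in> carrier L \<Longrightarrow> \<iota> (\<alpha>\<^bsub>L\<^esub> x) = \<alpha>\<^bsub>U\<^esub> (\<iota> x)"
  by (simp add: envelope_gen_def free_unital_hna_gen_twist free_gen_closed
      morphism_twist[OF envelope_projection_morphism])

lemma envelope_gen_bracket:
  assumes "x \<in> carrier L" "y \<in> carrier L"
  shows "\<iota> (x \<otimes>\<^bsub>L\<^esub> y) = \<iota> x \<otimes>\<^bsub>U\<^esub> \<iota> y \<ominus>\<^bsub>U\<^esub> \<iota> y \<otimes>\<^bsub>U\<^esub> \<iota> x"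
proof -
  interpret U: unital_mult_hom_assoc_alg K U by (rule envelope_alg)
  note mor = envelope_projection_morphism
  have "p (j (x \<otimes>\<^bsub>L\<^esub> y)) = p (j x \<otimes>\<^bsub>F\<^esub> j y \<ominus>\<^bsub>F\<^esub> j y \<otimes>\<^bsub>F\<^esub> j x)"
    by (rule envelope_projection_eqI)
      (use assms in \<open>simp_all add: F.mult_closed F.minus_closed free_gen_closed mult_closed
        envelope_relations_mem\<close>)
  also have "\<dots> = p (j x) \<otimes>\<^bsub>U\<^esub> p (j y) \<ominus>\<^bsub>U\<^esub> p (j y) \<otimes>\<^bsub>U\<^esub> p (j x)"
    using assms by (simp add: morphism_mult[OF mor] free_gen_closed F.mult_closed
        linear_map_minus[OF F.module_axioms U.module_axioms morphism_linear[OF mor]])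
  finally show ?thesis
    by (simp add: envelope_gen_def)
qed

lemma envelope_ext:
  assumes "unital_hom_alg_morphism K U B g" "unital_hom_alg_morphism K U B h"
    "\<And>x. x \<in> carrier L \<Longrightarrow> g (\<iota> x) = h (\<iota> x)" "X \<in> carrier U"
  shows "g X = h X"
proof -
  note mor = envelope_projection_morphism
  note g = unital_morphism_morphism[OF assms(1)] and h = unital_morphism_morphism[OF assms(2)]
  have "g (p x) = h (p x)" if "x \<in> carrier F" for x
    using that
  proof (induction rule: free_unital_hna_induct)
    case (gen x)
    then show ?case
      using assms(3) by (simp add: envelope_gen_def)
  next
    case one
    show ?case
      by (simp add: unital_morphism_one[OF envelope_projection] unital_morphism_one[OF assms(1)]
          unital_morphism_one[OF assms(2)])
  qed (simp_all add: morphism_add[OF mor] morphism_smult[OF mor] morphism_mult[OF mor]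
      morphism_twist[OF mor] morphism_closed[OF mor] morphism_add[OF g] morphism_smult[OF g]
      morphism_mult[OF g] morphism_twist[OF g] morphism_add[OF h] morphism_smult[OF h]
      morphism_mult[OF h] morphism_twist[OF h])
  then show ?thesis
    using assms(4) by (auto simp flip: envelope_surj)
qed

text \<open>The extension of \<open>f\<close> to the unital free algebra has a twist-stable kernel, which contains the three
  families of relations because \<open>B\<close> is Hom-associative, because \<open>B\<close> is multiplicative, and because
  \<open>f\<close> sends brackets to commutators.\<close>

lemma envelope_lift:
  assumes "unital_mult_hom_assoc_alg K B" "\<alpha>\<^bsub>B\<^esub> \<one>\<^bsub>B\<^esub> = \<one>\<^bsub>B\<^esub>" "linear_map K L B f"
    "\<And>x. x \<in> carrier L \<Longrightarrow> f (\<alpha>\<^bsub>L\<^esub> x) = \<alpha>\<^bsub>B\<^esub> (f x)"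
    "\<And>x y. x \<in> carrier L \<Longrightarrow> y \<in> carrier L \<Longrightarrow> f (x \<otimes>\<^bsub>L\<^esub> y) = f x \<otimes>\<^bsub>B\<^esub> f y \<ominus>\<^bsub>B\<^esub> f y \<otimes>\<^bsub>B\<^esub> f x"
  obtains h where "unital_hom_alg_morphism K U B h" "\<And>x. x \<in> carrier L \<Longrightarrow> h (\<iota> x) = f x"
proof -
  interpret B: unital_mult_hom_assoc_alg K B by fact
  obtain g where g: "unital_hom_alg_morphism K F B g" "\<And>x. x \<in> carrier L \<Longrightarrow> g (j x) = f x"
    using free_unital_hna_lift[where f = f, OF B.unital_hom_nonassoc_alg_axioms assms(2-4)] by metis
  note gm = unital_morphism_morphism[OF g(1)]
  let ?J = "{x \<in> carrier F. g x = \<zero>\<^bsub>B\<^esub>}"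
  note kernel = F.hom_nonassoc_alg_axioms B.hom_nonassoc_alg_axioms gm
  have "g x = \<zero>\<^bsub>B\<^esub>" if "x \<in> envelope_relations K L" for x
    using that unfolding envelope_relations_def Let_def
    by (auto simp: linear_map_minus[OF F.module_axioms B.module_axioms morphism_linear[OF gm]]
        F.mult_closed F.twist_closed free_gen_closed mult_closed morphism_mult[OF gm]
        morphism_twist[OF gm] B.mult_closed B.twist_closed morphism_closed[OF gm] g(2) assms(5)
        B.hom_assoc B.multiplicative B.minus_eq_zero_iff linear_map_closed[OF assms(3)]
        B.minus_closed F.minus_closed)
  then have "envelope_relations K L \<subseteq> ?J"
    using envelope_relations_carrier by blast
  moreover have "\<alpha>\<^bsub>F\<^esub> ` ?J \<subseteq> ?J"
    using morphism_kernel_twist[OF kernel] F.twist_closed by auto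
  ultimately have J: "envelope_ideal K L \<subseteq> ?J"
    using morphism_kernel_ideal[OF kernel] by (intro envelope_ideal_least)
  obtain h where h: "hom_alg_morphism K U B h" "\<And>x. x \<in> carrier F \<Longrightarrow> h (p x) = g x"
  proof (rule hom_quotient_lift[OF F.hom_nonassoc_alg_axioms B.hom_nonassoc_alg_axioms
        envelope_ideal_ideal envelope_ideal_twist gm])
    show "g x = \<zero>\<^bsub>B\<^esub>" if "x \<in> envelope_ideal K L" for x
      using that J by blast
  qed (use that in \<open>simp add: envelope_def\<close>)
  have "h \<one>\<^bsub>U\<^esub> = \<one>\<^bsub>B\<^esub>"
    using h(2)[OF F.unit_closed] unital_morphism_one[OF g(1)] unital_morphism_one[OF envelope_projection]
    by simp
  then show thesis
    using h by (intro that[of h]) (simp_all add: unital_hom_alg_morphism_def envelope_gen_def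
        free_gen_closed g(2))
qed

section \<open>The comultiplication\<close>

abbreviation (input) UU where "UU \<equiv> tensor_alg K U U"

interpretation U: unital_mult_hom_assoc_alg K U
  by (rule envelope_alg)

lemma tensor_envelope_alg: "unital_mult_hom_assoc_alg K UU"
  unfolding unital_mult_hom_assoc_alg_def
  by (intro conjI tensor_alg_unital tensor_alg_mult_hom_assoc U.unital_hom_nonassoc_alg_axioms
      U.mult_hom_assoc_alg_axioms)

interpretation UU: unital_mult_hom_assoc_alg K UU
  by (rule tensor_envelope_alg)

lemma tensor_envelope_twist_one: "\<alpha>\<^bsub>UU\<^esub> \<one>\<^bsub>UU\<^esub> = \<one>\<^bsub>UU\<^esub>"
  using U.unital_hom_nonassoc_alg_axioms envelope_twist_one by (intro tensor_alg_twist_one)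

lemma envelope_gen_closed: "x \<in> carrier L \<Longrightarrow> \<iota> x \<in> carrier U"
  by (rule linear_map_closed[OF envelope_gen_linear])

lemmas U_alg = U.hom_nonassoc_alg_axioms

text \<open>The classical coproduct of a primitive element; the comultiplication of the enveloping algebra takes
  the value \<open>primitive (\<alpha> x)\<close> at a generator \<open>x\<close>.\<close>

definition primitive
  where "primitive u = pure_tensor K U U u \<one>\<^bsub>U\<^esub> \<oplus>\<^bsub>UU\<^esub> pure_tensor K U U \<one>\<^bsub>U\<^esub> u"

lemma pure_one_linear:
  "linear_map K U UU (\<lambda>u. pure_tensor K U U u \<one>\<^bsub>U\<^esub>)"
  "linear_map K U UU (\<lambda>u. pure_tensor K U U \<one>\<^bsub>U\<^esub> u)"
  using bilinear_mapD(1,2)[OF tensor_product.pure_tensor_bilinear[OF tensor_product_hom_algs[OF U_alg U_alg]]]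
    U.unit_closed by (simp_all add: linear_map_tensor_alg)

lemma primitive_linear: "linear_map K U UU primitive"
  unfolding primitive_def by (rule linear_map_plus[OF UU.module_axioms pure_one_linear])

lemma primitive_twist: "u \<in> carrier U \<Longrightarrow> primitive (\<alpha>\<^bsub>U\<^esub> u) = \<alpha>\<^bsub>UU\<^esub> (primitive u)"
  by (simp add: primitive_def UU.twist_add pure_tensor_alg_carrier[OF U_alg U_alg]
      tensor_alg_twist_pure[OF U_alg U_alg] U.unit_closed envelope_twist_one)

text \<open>The mixed terms \<open>u \<otimes> v + v \<otimes> u\<close> of the product are symmetric in \<open>u\<close> and \<open>v\<close>, so they disappear
  from the commutator.\<close>

lemma primitive_commutator:
  assumes "u \<in> carrier U" "v \<in> carrier U"
  shows "primitive u \<otimes>\<^bsub>UU\<^esub> primitive v \<ominus>\<^bsub>UU\<^esub> primitive v \<otimes>\<^bsub>UU\<^esub> primitive u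
    = primitive (u \<otimes>\<^bsub>U\<^esub> v \<ominus>\<^bsub>U\<^esub> v \<otimes>\<^bsub>U\<^esub> u)"
proof -
  let ?t = "pure_tensor K U U"
  note c = pure_tensor_alg_carrier[OF U_alg U_alg] U.unit_closed U.mult_closed
  have mult: "primitive u \<otimes>\<^bsub>UU\<^esub> primitive v
      = primitive (u \<otimes>\<^bsub>U\<^esub> v) \<oplus>\<^bsub>UU\<^esub> (?t u v \<oplus>\<^bsub>UU\<^esub> ?t v u)"
    if "u \<in> carrier U" "v \<in> carrier U" for u v
    using that
    by (simp add: primitive_def UU.mult_add_left UU.mult_add_right c UU.mult_closed
        tensor_alg_mult_pure[OF U_alg U_alg] U.unit_left U.unit_right UU.a_ac)
  have cancel: "(a \<oplus>\<^bsub>UU\<^esub> (s \<oplus>\<^bsub>UU\<^esub> t)) \<ominus>\<^bsub>UU\<^esub> (b \<oplus>\<^bsub>UU\<^esub> (t \<oplus>\<^bsub>UU\<^esub> s)) = a \<ominus>\<^bsub>UU\<^esub> b"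
    if "a \<in> carrier UU" "b \<in> carrier UU" "s \<in> carrier UU" "t \<in> carrier UU" for a b s t
  proof -
    have "(a \<oplus>\<^bsub>UU\<^esub> (s \<oplus>\<^bsub>UU\<^esub> t)) \<ominus>\<^bsub>UU\<^esub> (b \<oplus>\<^bsub>UU\<^esub> (t \<oplus>\<^bsub>UU\<^esub> s))
        = (a \<ominus>\<^bsub>UU\<^esub> b) \<oplus>\<^bsub>UU\<^esub> ((s \<oplus>\<^bsub>UU\<^esub> t) \<oplus>\<^bsub>UU\<^esub> \<ominus>\<^bsub>UU\<^esub> (s \<oplus>\<^bsub>UU\<^esub> t))"
      using that by (simp add: a_minus_def UU.minus_add UU.a_ac)
    then show ?thesis
      using that by (simp add: UU.r_neg)
  qed
  show ?thesis
    using assms linear_map_closed[OF primitive_linear]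
    by (simp add: mult cancel c linear_map_minus[OF U.module_axioms UU.module_axioms primitive_linear])
qed

lemma is_envelope_comult_alt:
  "is_envelope_comult K L \<Delta> \<longleftrightarrow>
    unital_hom_alg_morphism K U UU \<Delta> \<and> (\<forall>x\<in>carrier L. \<Delta> (\<iota> x) = primitive (\<iota> (\<alpha>\<^bsub>L\<^esub> x)))"
  by (simp add: is_envelope_comult_def primitive_def Let_def)

lemma comult_exists: "\<exists>\<Delta>. is_envelope_comult K L \<Delta>"
proof -
  let ?f = "\<lambda>x. primitive (\<iota> (\<alpha>\<^bsub>L\<^esub> x))"
  have lin: "linear_map K L UU ?f"
    by (rule linear_map_comp[OF linear_map_comp[OF twist_linear envelope_gen_linear] primitive_linear])
  have twist: "?f (\<alpha>\<^bsub>L\<^esub> x) = \<alpha>\<^bsub>UU\<^esub> (?f x)" if "x \<in> carrier L" for x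
    using that by (simp add: primitive_twist envelope_gen_twist[of "\<alpha>\<^bsub>L\<^esub> x"] twist_closed envelope_gen_closed)
  have bracket: "?f (x \<otimes>\<^bsub>L\<^esub> y) = ?f x \<otimes>\<^bsub>UU\<^esub> ?f y \<ominus>\<^bsub>UU\<^esub> ?f y \<otimes>\<^bsub>UU\<^esub> ?f x"
    if "x \<in> carrier L" "y \<in> carrier L" for x y
    using that by (simp add: multiplicative envelope_gen_bracket twist_closed primitive_commutator
        envelope_gen_closed)
  obtain \<Delta> where "unital_hom_alg_morphism K U UU \<Delta>" "\<And>x. x \<in> carrier L \<Longrightarrow> \<Delta> (\<iota> x) = ?f x"
    using envelope_lift[where f = ?f, OF tensor_envelope_alg tensor_envelope_twist_one lin twist bracket]
    by metis
  then have "is_envelope_comult K L \<Delta>"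
    by (simp add: is_envelope_comult_alt)
  then show ?thesis
    by (rule exI[where x = \<Delta>])
qed

lemma comult_unique:
  assumes "is_envelope_comult K L \<Delta>" "is_envelope_comult K L \<Delta>'" "X \<in> carrier U"
  shows "\<Delta> X = \<Delta>' X"
  by (rule envelope_ext[where B = UU, OF _ _ _ assms(3)])
    (use assms(1,2) in \<open>simp_all add: is_envelope_comult_alt\<close>)

text \<open>Being a comultiplication concerns only values on the carrier, so one may pass to the extensional
  representative, which is then unique.\<close>

lemma comult_restrict:
  assumes "is_envelope_comult K L \<Delta>"
  shows "is_envelope_comult K L (restrict \<Delta> (carrier U))"
  using assms
  by (simp add: is_envelope_comult_alt unital_hom_alg_morphism_def hom_alg_morphism_def
      linear_map_def U.mult_closed U.twist_closed U.unit_closed envelope_gen_closed Pi_iff)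

lemma comult_ex1: "\<exists>!\<Delta>. \<Delta> \<in> extensional (carrier U) \<and> is_envelope_comult K L \<Delta>"
proof -
  obtain \<Delta> where \<Delta>: "is_envelope_comult K L \<Delta>"
    using comult_exists by blast
  show ?thesis
  proof (rule ex1I)
    show "restrict \<Delta> (carrier U) \<in> extensional (carrier U) \<and>
        is_envelope_comult K L (restrict \<Delta> (carrier U))"
      using comult_restrict[OF \<Delta>] by simp
    fix \<Delta>' assume \<Delta>': "\<Delta>' \<in> extensional (carrier U) \<and> is_envelope_comult K L \<Delta>'"
    then show "\<Delta>' = restrict \<Delta> (carrier U)"
      using comult_unique[of \<Delta>' \<Delta>] \<Delta> by (intro extensionalityI[of _ "carrier U"]) simp_all
  qed
qed

lemma envelope_twist_morphism: "unital_hom_alg_morphism K U U \<alpha>\<^bsub>U\<^esub>"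
  using U.twist_linear U.multiplicative envelope_twist_one
  by (simp add: unital_hom_alg_morphism_def hom_alg_morphism_def)

text \<open>Both sides are unital morphisms in \<open>X\<close>, hence determined by their values on the generators.\<close>

lemma comult_coassociative:
  assumes "is_envelope_comult K L \<Delta>" "X \<in> carrier U"
  shows "tensor_assoc K U U U (tensor_map K UU U \<Delta> \<alpha>\<^bsub>U\<^esub> (\<Delta> X)) = tensor_map K U UU \<alpha>\<^bsub>U\<^esub> \<Delta> (\<Delta> X)"
proof -
  let ?T = "tensor_alg K U UU" and ?S = "tensor_alg K UU U"
  let ?l = "tensor_map K UU U \<Delta> \<alpha>\<^bsub>U\<^esub>" and ?r = "tensor_map K U UU \<alpha>\<^bsub>U\<^esub> \<Delta>"
  let ?a = "tensor_assoc K U U U" and ?e = "\<one>\<^bsub>U\<^esub>"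
  let ?t = "pure_tensor K U U" and ?tl = "pure_tensor K UU U" and ?tr = "pure_tensor K U UU"
  have \<Delta>: "unital_hom_alg_morphism K U UU \<Delta>"
    and \<Delta>_gen: "\<And>x. x \<in> carrier L \<Longrightarrow> \<Delta> (\<iota> x) = primitive (\<iota> (\<alpha>\<^bsub>L\<^esub> x))"
    using assms(1) by (auto simp: is_envelope_comult_alt)
  note UU_alg = UU.hom_nonassoc_alg_axioms
  note \<Delta>_mor = unital_morphism_morphism[OF \<Delta>] and \<alpha>_mor = unital_morphism_morphism[OF envelope_twist_morphism]
  have T_alg: "hom_nonassoc_alg K ?T"
    by (rule tensor_alg_hom_nonassoc[OF U_alg UU_alg])
  have l: "hom_alg_morphism K UU ?S ?l"
    by (rule tensor_map_morphism[OF U_alg U_alg UU_alg U_alg \<Delta>_mor \<alpha>_mor])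
  have r: "hom_alg_morphism K UU ?T ?r"
    by (rule tensor_map_morphism[OF U_alg U_alg U_alg UU_alg \<alpha>_mor \<Delta>_mor])
  note a = tensor_assoc_morphism[OF U_alg U_alg U_alg]
  have l_pure: "?l (?t u v) = ?tl (\<Delta> u) (\<alpha>\<^bsub>U\<^esub> v)" if "u \<in> carrier U" "v \<in> carrier U" for u v
    by (rule tensor_map_pure[OF tensor_product_hom_algs[OF U_alg U_alg]
          tensor_product_hom_algs[OF UU_alg U_alg] morphism_linear[OF \<Delta>_mor]
          morphism_linear[OF \<alpha>_mor] that])
  have r_pure: "?r (?t u v) = ?tr (\<alpha>\<^bsub>U\<^esub> u) (\<Delta> v)" if "u \<in> carrier U" "v \<in> carrier U" for u v
    by (rule tensor_map_pure[OF tensor_product_hom_algs[OF U_alg U_alg]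
          tensor_product_hom_algs[OF U_alg UU_alg] morphism_linear[OF \<alpha>_mor]
          morphism_linear[OF \<Delta>_mor] that])
  have one: "\<Delta> ?e = ?t ?e ?e"
    using unital_morphism_one[OF \<Delta>] by (simp add: tensor_alg_simps(5))
  note c = U.unit_closed pure_tensor_alg_carrier[OF U_alg U_alg]
    pure_tensor_alg_carrier[OF UU_alg U_alg] pure_tensor_alg_carrier[OF U_alg UU_alg]
    envelope_gen_closed twist_closed U.twist_closed UU.a_closed
  have "unital_hom_alg_morphism K U ?T (\<lambda>X. ?a (?l (\<Delta> X)))"
    using morphism_comp[OF morphism_comp[OF \<Delta>_mor l] a(1)]
    by (simp add: unital_hom_alg_morphism_def one l_pure U.unit_closed envelope_twist_one a(2)
        tensor_alg_simps(5))
  moreover have "unital_hom_alg_morphism K U ?T (\<lambda>X. ?r (\<Delta> X))"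
    using morphism_comp[OF \<Delta>_mor r]
    by (simp add: unital_hom_alg_morphism_def one r_pure U.unit_closed envelope_twist_one
        tensor_alg_simps(5))
  moreover have "?a (?l (\<Delta> (\<iota> x))) = ?r (\<Delta> (\<iota> x))" if x: "x \<in> carrier L" for x
  proof -
    define u where "u = \<iota> (\<alpha>\<^bsub>L\<^esub> (\<alpha>\<^bsub>L\<^esub> x))"
    have u: "u \<in> carrier U" "\<Delta> (\<iota> (\<alpha>\<^bsub>L\<^esub> x)) = ?t u ?e \<oplus>\<^bsub>UU\<^esub> ?t ?e u" "\<alpha>\<^bsub>U\<^esub> (\<iota> (\<alpha>\<^bsub>L\<^esub> x)) = u"
      using x by (simp_all add: u_def c \<Delta>_gen envelope_gen_twist[of "\<alpha>\<^bsub>L\<^esub> x"] primitive_def)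
    have Sadd: "?l (Y \<oplus>\<^bsub>UU\<^esub> Z) = ?l Y \<oplus>\<^bsub>?S\<^esub> ?l Z" "?r (Y \<oplus>\<^bsub>UU\<^esub> Z) = ?r Y \<oplus>\<^bsub>?T\<^esub> ?r Z"
      if "Y \<in> carrier UU" "Z \<in> carrier UU" for Y Z
      using that by (simp_all add: morphism_add[OF l] morphism_add[OF r])
    interpret S: hom_nonassoc_alg K ?S
      by (rule tensor_alg_hom_nonassoc[OF UU_alg U_alg])
    interpret T: hom_nonassoc_alg K ?T
      by (rule T_alg)
    have "?a (?l (\<Delta> (\<iota> x)))
        = ?tr u (?t ?e ?e) \<oplus>\<^bsub>?T\<^esub> ?tr ?e (?t u ?e) \<oplus>\<^bsub>?T\<^esub> ?tr ?e (?t ?e u)"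
      using x u(1)
      by (simp add: \<Delta>_gen primitive_def Sadd c l_pure u(2,3) one envelope_twist_one
          tensor_alg_pure_add_left[OF UU_alg U_alg] morphism_add[OF a(1)] a(2))
    moreover have "?r (\<Delta> (\<iota> x))
        = ?tr u (?t ?e ?e) \<oplus>\<^bsub>?T\<^esub> ?tr ?e (?t u ?e) \<oplus>\<^bsub>?T\<^esub> ?tr ?e (?t ?e u)"
      using x u(1)
      by (simp add: \<Delta>_gen primitive_def Sadd c r_pure u(2,3) one envelope_twist_one
          tensor_alg_pure_add_right[OF U_alg UU_alg] T.a_assoc)
    ultimately show ?thesis
      by simp
  qed
  ultimately show ?thesis
    using assms(2) by (rule envelope_ext)
qed

lemma comult_hom_bialgebra:
  assumes "is_envelope_comult K L \<Delta>"
  shows "hom_bialgebra K U \<Delta>"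
proof
  show "hom_alg_morphism K U UU \<Delta>"
    using assms unital_morphism_morphism by (auto simp: is_envelope_comult_alt)
qed (rule comult_coassociative[OF assms])

end

theorem theorem3p11:
  fixes K :: "('a, 'm) ring_scheme" and L :: "('a, 'b, 'n) hom_module_scheme"
  assumes "field K"
    and char_0: "\<And>n::nat. 0 < n \<Longrightarrow> [n] \<cdot>\<^bsub>K\<^esub> \<one>\<^bsub>K\<^esub> \<noteq> \<zero>\<^bsub>K\<^esub>"
    and "mult_hom_lie_alg K L"
  shows "unital_mult_hom_assoc_alg K (envelope K L) \<and>
    unital_mult_hom_assoc_alg K (tensor_alg K (envelope K L) (envelope K L)) \<and>
    (\<exists>!\<Delta>. \<Delta> \<in> extensional (carrier (envelope K L)) \<and> is_envelope_comult K L \<Delta>) \<and>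
    (\<forall>\<Delta>. is_envelope_comult K L \<Delta> \<longrightarrow> hom_bialgebra K (envelope K L) \<Delta>)"
proof -
  interpret L: mult_hom_lie_alg K L by fact
  show ?thesis
    by (intro conjI allI impI L.envelope_alg L.tensor_envelope_alg L.comult_ex1 L.comult_hom_bialgebra)
qed

end
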